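(* Let $\mathcal{I}=[0,1]$ and $p\in[1,\infty)$. If $q:\mathcal{I}\to\mathbb{C}$ is continuous and non-negative, then for every $\tau\ge0$ $$\left\|e^{-\tau(D_0+Q)}-\left(e^{-\tau D_0/n}\,e^{-\tau Q/n}\right)^n\right\|_{\mathcal{L}(L^p(\mathcal{I}))}=o(1)\qquad\text{as } n\to\infty.$$
   Context: $L^p(\mathcal{I})=L^p(\mathcal{I},\mathbb{C})$, and $\mathcal{L}(L^p(\mathcal{I}))$ is the space of bounded operators on it with the operator norm. Sign convention: $e^{-\tau G}$ denotes the $C_0$-semigroup with $\lim_{\tau\to+0}(e^{-\tau G}f-f)/\tau=-Gf$ for $f\in\mathrm{dom}(G)$. $D_0$ is the differentiation operator $(D_0f)(t)=\partial_tf(t)$ with $\mathrm{dom}(D_0)=\{f\in W^{1,p}(\mathcal{I}): f(0)=0\}$; it generates the shift semigroup $(e^{-\tau D_0}f)(t)=\chi_{\mathcal{I}}(t-\tau)f(t-\tau)$. $Q$ is the bounded multiplication operator $(Qf)(t)=q(t)f(t)$ on $L^p(\mathcal{I})$, and $D_0+Q$ has domain $\mathrm{dom}(D_0)$. $g(n)=o(f(n))$ means $\limsup_{n\to\infty}|g(n)/f(n)|=0$. *)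

theory Defs
  imports "HOL-Analysis.Analysis" "HOL-Library.Landau_Symbols" "HOL-Library.Nonpos_Ints"
begin

abbreviation unit_meas :: "real measure"
  where "unit_meas \<equiv> lebesgue_on {0..1}"

definition ae_eq :: "(real \<Rightarrow> complex) \<Rightarrow> (real \<Rightarrow> complex) \<Rightarrow> bool"
  where "ae_eq f g \<longleftrightarrow> f \<in> borel_measurable unit_meas \<and> g \<in> borel_measurable unit_meas
    \<and> (AE t in unit_meas. f t = g t)"

(* Classes of measurable functions [0,1] -> C modulo equality almost everywhere.  For each
   real p, L^p is a subset of this one type, so p can remain an ordinary variable.
   "cls f" is meaningful only if f is measurable on [0,1]; "rep u" is some representative. *)
quotient_type l0 = "real \<Rightarrow> complex" / partial: ae_eq
  morphisms rep cls
proof (rule part_equivpI)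
  show "\<exists>f. ae_eq f f"
    by (rule exI[of _ "\<lambda>_. 0"]) (simp add: ae_eq_def)
  show "symp ae_eq"
    by (auto simp: symp_def ae_eq_def)
  show "transp ae_eq"
    unfolding transp_def ae_eq_def by auto
qed

instantiation l0 :: real_vector
begin

lift_definition zero_l0 :: l0 is "\<lambda>_. 0"
  by (simp add: ae_eq_def)

lift_definition plus_l0 :: "l0 \<Rightarrow> l0 \<Rightarrow> l0" is "\<lambda>f g t. f t + g t"
  unfolding ae_eq_def by auto

lift_definition minus_l0 :: "l0 \<Rightarrow> l0 \<Rightarrow> l0" is "\<lambda>f g t. f t - g t"
  unfolding ae_eq_def by auto

lift_definition uminus_l0 :: "l0 \<Rightarrow> l0" is "\<lambda>f t. - f t"
  unfolding ae_eq_def by auto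

lift_definition scaleR_l0 :: "real \<Rightarrow> l0 \<Rightarrow> l0" is "\<lambda>c f t. c *\<^sub>R f t"
  unfolding ae_eq_def by auto

instance
  by (standard; transfer) (auto simp: ae_eq_def algebra_simps)

end

definition mult_op :: "(real \<Rightarrow> complex) \<Rightarrow> l0 \<Rightarrow> l0"
  where "mult_op q u = cls (\<lambda>t. q t * rep u t)"

definition Lp :: "real \<Rightarrow> l0 set"
  where "Lp p = {u. integrable unit_meas (\<lambda>t. norm (rep u t) powr p)}"

definition Lp_norm :: "real \<Rightarrow> l0 \<Rightarrow> real"
  where "Lp_norm p u = (LINT t|unit_meas. norm (rep u t) powr p) powr (1 / p)"

text \<open>Operators on \<open>L\<^sup>p\<close> are functions on \<^typ>\<open>l0\<close>; only their values on
  \<^term>\<open>Lp p\<close> matter.\<close>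

definition bounded_op :: "real \<Rightarrow> (l0 \<Rightarrow> l0) \<Rightarrow> bool"
  where "bounded_op p T \<longleftrightarrow>
    (\<forall>u\<in>Lp p. T u \<in> Lp p) \<and>
    (\<forall>u\<in>Lp p. \<forall>v\<in>Lp p. T (u + v) = T u + T v) \<and>
    (\<forall>c. \<forall>u\<in>Lp p. T (mult_op (\<lambda>_. c) u) = mult_op (\<lambda>_. c) (T u)) \<and>
    (\<exists>C. \<forall>u\<in>Lp p. Lp_norm p (T u) \<le> C * Lp_norm p u)"

(* A real supremum: it is the operator norm when bounded_op p T holds. *)
definition op_norm :: "real \<Rightarrow> (l0 \<Rightarrow> l0) \<Rightarrow> real"
  where "op_norm p T = Sup {Lp_norm p (T u) | u. u \<in> Lp p \<and> Lp_norm p u \<le> 1}"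

definition C0_semigroup :: "real \<Rightarrow> (real \<Rightarrow> l0 \<Rightarrow> l0) \<Rightarrow> bool"
  where "C0_semigroup p T \<longleftrightarrow>
    (\<forall>\<tau>\<ge>0. bounded_op p (T \<tau>)) \<and>
    (\<forall>u\<in>Lp p. T 0 u = u) \<and>
    (\<forall>\<sigma>\<ge>0. \<forall>\<tau>\<ge>0. \<forall>u\<in>Lp p. T (\<sigma> + \<tau>) u = T \<sigma> (T \<tau> u)) \<and>
    (\<forall>u\<in>Lp p. ((\<lambda>\<tau>. Lp_norm p (T \<tau> u - u)) \<longlongrightarrow> 0) (at_right 0))"

definition right_deriv_at_0 :: "real \<Rightarrow> (real \<Rightarrow> l0 \<Rightarrow> l0) \<Rightarrow> l0 \<Rightarrow> l0 \<Rightarrow> bool"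
  where "right_deriv_at_0 p T u v \<longleftrightarrow> v \<in> Lp p \<and>
    ((\<lambda>\<tau>. Lp_norm p ((1 / \<tau>) *\<^sub>R (T \<tau> u - u) - v)) \<longlongrightarrow> 0) (at_right 0)"

text \<open>An unbounded operator is given by its domain \<open>D\<close> and its action \<open>G\<close> on \<open>D\<close>. The sign
  convention is that the semigroup associated with \<open>G\<close> has derivative \<open>- G\<close> at \<open>0\<close>.\<close>

definition generates :: "real \<Rightarrow> l0 set \<Rightarrow> (l0 \<Rightarrow> l0) \<Rightarrow> (real \<Rightarrow> l0 \<Rightarrow> l0) \<Rightarrow> bool"
  where "generates p D G T \<longleftrightarrow> C0_semigroup p T \<and>
    D = {u \<in> Lp p. \<exists>v. right_deriv_at_0 p T u v} \<and>
    (\<forall>u\<in>D. right_deriv_at_0 p T u (- G u))"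

(* exp(-tau G).  A C0-semigroup is determined by its generator, so for tau >= 0 the choice
   is immaterial on Lp p. *)
definition exp_neg :: "real \<Rightarrow> l0 set \<Rightarrow> (l0 \<Rightarrow> l0) \<Rightarrow> real \<Rightarrow> l0 \<Rightarrow> l0"
  where "exp_neg p D G = (SOME T. generates p D G T)"

(* Continuously differentiable test functions with compact support in the open interval (0,1)
   (Brezis); they give the same weak derivatives as smooth ones. *)
definition weak_deriv :: "l0 \<Rightarrow> l0 \<Rightarrow> bool"
  where "weak_deriv u v \<longleftrightarrow> u \<in> Lp 1 \<and> v \<in> Lp 1 \<and>
    (\<forall>\<phi> \<phi>' :: real \<Rightarrow> complex.
      (\<forall>t. (\<phi> has_vector_derivative \<phi>' t) (at t)) \<longrightarrow>
      continuous_on UNIV \<phi>' \<longrightarrow>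
      (\<exists>a b. 0 < a \<and> b < 1 \<and> (\<forall>t. t \<notin> {a..b} \<longrightarrow> \<phi> t = 0)) \<longrightarrow>
      (LINT t|unit_meas. rep u t * \<phi>' t) = - (LINT t|unit_meas. rep v t * \<phi> t))"

definition W1p :: "real \<Rightarrow> l0 set"
  where "W1p p = {u \<in> Lp p. \<exists>v\<in>Lp p. weak_deriv u v}"

(* The boundary value f(0) is that of the continuous representative of f. *)
definition dom_D0 :: "real \<Rightarrow> l0 set"
  where "dom_D0 p = {u \<in> W1p p. \<exists>h. continuous_on {0..1} h \<and> u = cls h \<and> h 0 = 0}"

definition D0 :: "l0 \<Rightarrow> l0"
  where "D0 u = (THE v. weak_deriv u v)"

end

theory Submission
  imports Defs
begin

text \<open>The semigroup of \<open>D\<^sub>0 + Q\<close> is the weighted shift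
  taking \<open>u\<close> to \<open>t \<mapsto> exp (- I) u (t - \<tau>)\<close>, where \<open>I\<close> is the integral of \<open>q\<close> over \<open>[t - \<tau>, t]\<close>,
  and the \<open>n\<close>-fold product is the same shift with \<open>I\<close> replaced by a Riemann sum of mesh \<open>\<tau> / n\<close>. Since \<open>q\<close> is uniformly continuous and
  \<open>\<bar>exp (- a) - exp (- b)\<bar> \<le> \<bar>a - b\<bar>\<close> for nonnegative \<open>a\<close> and \<open>b\<close>, the weights converge uniformly,
  hence so do the operators in norm.

  Since \<open>exp_neg\<close> is merely some semigroup with the given generator, one also needs that a generator
  determines its semigroup (local boundedness from the uniform boundedness principle, then a mean
  value argument with right derivatives) and that the explicit semigroups have the right generators.
  The generator of the shift extends \<open>- D\<^sub>0\<close> because it is closed and is known on primitives of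
  continuous functions. It is no larger: \<open>D\<^sub>0\<close> is onto, and a vector with derivative zero is fixed by
  the shift semigroup, which is nilpotent. Adding \<open>Q\<close> is a bounded perturbation.\<close>

subsection \<open>Uniform boundedness in a complete normed subspace\<close>

text \<open>As \<open>p\<close> is a variable, the space is a subset of \<open>l0\<close> with a
  norm function and not a type; hence the semigroup theory is developed for a subspace
  \<open>V\<close> with a norm \<open>N\<close> and instantiated for each \<open>p\<close>. It uses
  no vector-valued integrals: where one usually writes \<open>T t u - u\<close> as the integral of
  \<open>T s v\<close>, a mean value inequality for right-hand increments is used. Weighted shifts
  are closed under composition, so both sides of the formula lie in one family and their distance is
  the supremum of a difference of weights. The weight of the limit is written
  \<open>exp (R (t - \<tau>) - R t)\<close>, with \<open>R\<close> a primitive of the rate on the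
  whole line: the semigroup law becomes telescoping, and the mean value theorem replaces integrals
  of \<open>q\<close>. To this end \<open>q\<close> is first continued constantly beyond [0,1],
  which keeps it bounded, nonnegative and uniformly continuous.\<close>

lemma le_if_right_upper_derivative_nonpos:
  fixes f :: "real \<Rightarrow> real"
  assumes "0 \<le> t" and cont: "continuous_on {0..t} f"
    and right: "\<And>s e. 0 \<le> s \<Longrightarrow> s < t \<Longrightarrow> 0 < e \<Longrightarrow>
      \<exists>d>0. \<forall>h. 0 < h \<longrightarrow> h < d \<longrightarrow> s + h \<le> t \<longrightarrow> f (s + h) - f s \<le> e * h"
  shows "f t \<le> f 0"
proof -
  have *: "f t - f 0 \<le> e * t" if e: "0 < e" for e
  proof (rule ccontr)
    assume neg: "\<not> f t - f 0 \<le> e * t"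
    \<comment> \<open>Compare \<open>f\<close> with the line of slope \<open>e\<close> through
      \<open>f 0\<close>. The last point at which \<open>f\<close> is not above this line cannot lie
      before \<open>t\<close>, because the right-hand estimate carries the bound a little
      further.\<close>
    define A where "A = {s \<in> {0..t}. f s - f 0 - e * s \<le> 0}"
    have "compact A"
    proof -
      have "closed A"
        unfolding A_def
        by (rule continuous_on_closed_Collect_le) (auto intro!: continuous_intros cont)
      moreover have "A \<subseteq> {0..t}" by (auto simp: A_def)
      ultimately show ?thesis
        by (meson bounded_closed_interval bounded_subset compact_eq_bounded_closed)
    qed
    moreover have "0 \<in> A" using assms(1) by (simp add: A_def)
    ultimately obtain s where s: "s \<in> A" and max: "\<And>r. r \<in> A \<Longrightarrow> r \<le> s"
      using compact_attains_sup[of A] by blast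
    have "s \<noteq> t" using s neg by (auto simp: A_def)
    then have st: "0 \<le> s" "s < t" using s by (auto simp: A_def)
    obtain d where d: "d > 0" "\<And>h. 0 < h \<Longrightarrow> h < d \<Longrightarrow> s + h \<le> t \<Longrightarrow> f (s + h) - f s \<le> e * h"
      using right[OF st e] by blast
    define h where "h = min (d / 2) (t - s)"
    have h: "0 < h" "h < d" "s + h \<le> t" using d(1) st by (auto simp: h_def)
    have "f (s + h) - f s \<le> e * h" using d(2) h by blast
    then have "s + h \<in> A" using s h by (auto simp: A_def algebra_simps)
    then show False using max[of "s + h"] h by simp
  qed
  show ?thesis
  proof (rule ccontr)
    assume "\<not> f t \<le> f 0"
    then have pos: "f t - f 0 > 0" by simp
    \<comment> \<open>\<open>t + 1\<close> instead of \<open>t\<close> keeps the denominator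
      positive when \<open>t = 0\<close>; with this slope \<open>c * t\<close> stays below
      \<open>f t - f 0\<close>.\<close>
    define c where "c = (f t - f 0) / (2 * (t + 1))"
    have c: "c > 0" "f t - f 0 = c * (2 * (t + 1))" using assms(1) pos by (auto simp: c_def)
    have "c * t < c * (2 * (t + 1))" using assms(1) c(1) by (intro mult_strict_left_mono) auto
    then show False using *[OF c(1)] c(2) by linarith
  qed
qed

text \<open>Completeness is asked only for series dominated by powers of 1/3, the kind of series
  built in the uniform boundedness argument. Nonnegativity of \<open>N\<close> follows from
  subadditivity and homogeneity.\<close>

locale banach_subspace =
  fixes V :: "'a::real_vector set" and N :: "'a \<Rightarrow> real"
  assumes subspace_V: "subspace V"
    and N_eq_0: "\<And>u. u \<in> V \<Longrightarrow> N u = 0 \<Longrightarrow> u = 0"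
    and N_add: "\<And>u v. u \<in> V \<Longrightarrow> v \<in> V \<Longrightarrow> N (u + v) \<le> N u + N v"
    and N_scaleR: "\<And>c u. u \<in> V \<Longrightarrow> N (c *\<^sub>R u) = \<bar>c\<bar> * N u"
    and complete: "\<And>x. (\<And>k::nat. x k \<in> V) \<Longrightarrow> (\<And>k. N (x k) \<le> (1/3) ^ k) \<Longrightarrow>
      \<exists>s\<in>V. (\<lambda>n. N (s - (\<Sum>k<n. x k))) \<longlonglongrightarrow> 0"
begin

lemma V_intros [simp, intro]:
  "0 \<in> V"
  "u \<in> V \<Longrightarrow> v \<in> V \<Longrightarrow> u + v \<in> V"
  "u \<in> V \<Longrightarrow> v \<in> V \<Longrightarrow> u - v \<in> V"
  "u \<in> V \<Longrightarrow> c *\<^sub>R u \<in> V"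
  "u \<in> V \<Longrightarrow> - u \<in> V"
  using subspace_V by (auto simp: subspace_0 subspace_add subspace_diff subspace_scale subspace_neg)

lemma N_0 [simp]: "N 0 = 0"
  using N_scaleR[of 0 0] by simp

lemma N_minus: "u \<in> V \<Longrightarrow> N (- u) = N u"
  using N_scaleR[of u "-1"] by simp

lemma N_nonneg: "u \<in> V \<Longrightarrow> 0 \<le> N u"
  using N_add[of u "- u"] by (simp add: N_minus)

lemma N_diff_commute: "u \<in> V \<Longrightarrow> v \<in> V \<Longrightarrow> N (u - v) = N (v - u)"
  using N_minus[of "u - v"] by simp

lemma N_diff_le: "u \<in> V \<Longrightarrow> v \<in> V \<Longrightarrow> N (u - v) \<le> N u + N v"
  using N_add[of u "- v"] by (simp add: N_minus)

lemma N_triangle_sub: "u \<in> V \<Longrightarrow> v \<in> V \<Longrightarrow> N u \<le> N v + N (u - v)"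
  using N_add[of v "u - v"] by simp

lemma N_triangle: "u \<in> V \<Longrightarrow> v \<in> V \<Longrightarrow> w \<in> V \<Longrightarrow> N (u - w) \<le> N (u - v) + N (v - w)"
  using N_add[of "u - v" "v - w"] by simp

text \<open>Homogeneity is over the reals because difference quotients use real scalars; the complex
  linearity in \<open>bounded_op\<close> implies it.\<close>

definition bl_op :: "('a \<Rightarrow> 'a) \<Rightarrow> bool"
  where "bl_op T \<longleftrightarrow> (\<forall>u\<in>V. T u \<in> V) \<and> (\<forall>u\<in>V. \<forall>v\<in>V. T (u + v) = T u + T v) \<and>
    (\<forall>c. \<forall>u\<in>V. T (c *\<^sub>R u) = c *\<^sub>R T u) \<and> (\<exists>C. \<forall>u\<in>V. N (T u) \<le> C * N u)"

lemma bl_opD: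
  assumes "bl_op T"
  shows bl_op_V: "u \<in> V \<Longrightarrow> T u \<in> V"
    and bl_op_add: "u \<in> V \<Longrightarrow> v \<in> V \<Longrightarrow> T (u + v) = T u + T v"
    and bl_op_scaleR: "u \<in> V \<Longrightarrow> T (c *\<^sub>R u) = c *\<^sub>R T u"
  using assms by (auto simp: bl_op_def)

lemma bl_op_0: "bl_op T \<Longrightarrow> T 0 = 0"
  using bl_op_scaleR[of T 0 0] by simp

lemma bl_op_minus: "bl_op T \<Longrightarrow> u \<in> V \<Longrightarrow> T (- u) = - T u"
  using bl_op_scaleR[of T u "-1"] by simp

lemma bl_op_diff: "bl_op T \<Longrightarrow> u \<in> V \<Longrightarrow> v \<in> V \<Longrightarrow> T (u - v) = T u - T v"
  using bl_op_add[of T u "- v"] by (simp add: bl_op_minus)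

lemma bl_op_bound:
  assumes "bl_op T"
  obtains C where "C > 0" "\<And>u. u \<in> V \<Longrightarrow> N (T u) \<le> C * N u"
proof -
  obtain C where C: "\<forall>u\<in>V. N (T u) \<le> C * N u" using assms by (auto simp: bl_op_def)
  have "N (T u) \<le> max C 1 * N u" if "u \<in> V" for u
    using C that N_nonneg[OF that] by (meson max.cobounded1 mult_right_mono order_trans)
  then show ?thesis using that[of "max C 1"] by simp
qed

text \<open>\<open>C\<close> is the operator norm. The supremum need not be attained, but
  \<open>C > K \<ge> 0\<close> puts \<open>2/3 * C\<close> strictly below it. The factor 2/3 exceeds
  the 1/2 that the tail of a series with ratio 1/3 will consume.\<close>

lemma bl_op_nearly_attained:
  assumes T: "bl_op T" and unb: "\<exists>u\<in>V. N (T u) > K * N u" and "0 \<le> K"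
  obtains C z where "C > K" "\<And>u. u \<in> V \<Longrightarrow> N (T u) \<le> C * N u"
    "z \<in> V" "N z = 1" "N (T z) \<ge> 2/3 * C"
proof -
  define A where "A = {N (T u) |u. u \<in> V \<and> N u = 1}"
  obtain B where B: "B > 0" "\<And>u. u \<in> V \<Longrightarrow> N (T u) \<le> B * N u" using bl_op_bound[OF T] by metis
  have bdd: "bdd_above A"
  proof (rule bdd_aboveI)
    fix a assume "a \<in> A"
    then obtain u where "a = N (T u)" "u \<in> V" "N u = 1" by (auto simp: A_def)
    then show "a \<le> B" using B(2)[of u] by simp
  qed
  have scale: "\<exists>z\<in>V. N z = 1 \<and> N (T u) = N (T z) * N u" if "u \<in> V" "N u \<noteq> 0" for u
  proof -
    have "0 < N u" using N_nonneg[OF that(1)] that(2) by simp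
    then show ?thesis using that
      by (intro bexI[of _ "(1 / N u) *\<^sub>R u"]) (simp_all add: N_scaleR bl_op_scaleR[OF T] bl_op_V[OF T])
  qed
  have zero: "N (T u) = 0" if "u \<in> V" "N u = 0" for u
    using N_eq_0[OF that] bl_op_0[OF T] by simp
  define C where "C = Sup A"
  have le: "N (T u) \<le> C * N u" if u: "u \<in> V" for u
  proof (cases "N u = 0")
    case True
    then show ?thesis using zero[OF u True] by simp
  next
    case False
    from scale[OF u False] obtain z where z: "z \<in> V" "N z = 1" and eq: "N (T u) = N (T z) * N u"
      by blast
    have "N (T z) \<in> A" using z by (auto simp: A_def)
    then have "N (T z) \<le> C" unfolding C_def using bdd by (rule cSup_upper)
    then show ?thesis unfolding eq by (rule mult_right_mono) (rule N_nonneg[OF u])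
  qed
  obtain u where u: "u \<in> V" "N (T u) > K * N u" using unb by blast
  have "N u \<noteq> 0" using u zero[of u] by (cases "N u = 0") auto
  then have pos: "N u > 0" using N_nonneg[OF u(1)] by simp
  have "K * N u < C * N u" using u le[OF u(1)] by simp
  then have "K < C" using pos by simp
  have "A \<noteq> {}" using scale[OF u(1) \<open>N u \<noteq> 0\<close>] by (auto simp: A_def)
  moreover have "2/3 * C < Sup A" using \<open>K < C\<close> \<open>0 \<le> K\<close> by (simp add: C_def)
  ultimately obtain a where a: "a \<in> A" "2/3 * C < a"
    by (meson less_cSupD)
  then obtain z where "z \<in> V" "N z = 1" "a = N (T z)" by (auto simp: A_def)
  with a show ?thesis using that[OF \<open>K < C\<close> le, of z] by simp
qed

text \<open>Sokal's elementary proof of the uniform boundedness principle: among \<open>x + z\<close> and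
  \<open>x - z\<close>, one has an image at least as large as that of \<open>z\<close>.\<close>

theorem uniform_boundedness:
  fixes T :: "nat \<Rightarrow> 'a \<Rightarrow> 'a"
  assumes T: "\<And>n. bl_op (T n)" and ptw: "\<And>u. u \<in> V \<Longrightarrow> \<exists>B. \<forall>n. N (T n u) \<le> B"
  shows "\<exists>M. \<forall>n. \<forall>u\<in>V. N (T n u) \<le> M * N u"
proof (rule ccontr)
  assume "\<not> ?thesis"
  then have unb: "\<exists>n. \<exists>u\<in>V. N (T n u) > M * N u" for M by (metis not_le)
  \<comment> \<open>The growth \<open>6 * k * 3^k\<close> is dictated by the end of the proof: a
    vector of norm \<open>(1/3)^k\<close> costs a factor \<open>3^k\<close>, and the tail leaves the
    fraction \<open>2/3 - 1/2 = 1/6\<close> of \<open>C k\<close>, so that more than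
    \<open>k\<close> survives.\<close>
  have "\<forall>k::nat. \<exists>n (C::real) z. C > 6 * real k * 3^k \<and> (\<forall>u\<in>V. N (T n u) \<le> C * N u) \<and>
      z \<in> V \<and> N z = 1 \<and> N (T n z) \<ge> 2/3 * C"
  proof
    fix k :: nat
    obtain n where "\<exists>u\<in>V. N (T n u) > (6 * real k * 3^k) * N u" using unb by blast
    then obtain C z where "C > 6 * real k * 3^k"
      "\<And>u. u \<in> V \<Longrightarrow> N (T n u) \<le> C * N u" "z \<in> V" "N z = 1" "N (T n z) \<ge> 2/3 * C"
      by (rule bl_op_nearly_attained[OF T]) auto
    then show "\<exists>n (C::real) z. C > 6 * real k * 3^k \<and> (\<forall>u\<in>V. N (T n u) \<le> C * N u) \<and>
      z \<in> V \<and> N z = 1 \<and> N (T n z) \<ge> 2/3 * C" by blast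
  qed
  from this[unfolded choice_iff] obtain n z and C :: "nat \<Rightarrow> real"
    where C: "\<And>k::nat. C k > 6 * real k * 3^k"
    and bound: "\<And>k u. u \<in> V \<Longrightarrow> N (T (n k) u) \<le> C k * N u"
    and z: "\<And>k. z k \<in> V" "\<And>k. N (z k) = 1" "\<And>k. N (T (n k) (z k)) \<ge> 2/3 * C k"
    by blast
  define y where "y k = (1/3)^k *\<^sub>R z k" for k
  have y: "y k \<in> V" "N (y k) = (1/3)^k" "N (T (n k) (y k)) \<ge> 2/3 * C k * (1/3)^k" for k
    using z[of k] by (auto simp: y_def N_scaleR bl_op_scaleR[OF T] bl_op_V[OF T] power_one_over
        divide_simps)
  have sign: "N (T m w) \<le> max (N (T m (x + w))) (N (T m (x - w)))" if "x \<in> V" "w \<in> V" for x w m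
  proof -
    have "T m (x + w) - T m (x - w) = 2 *\<^sub>R T m w"
      using that by (simp add: bl_op_add[OF T] bl_op_diff[OF T] scaleR_2)
    then have "2 * N (T m w) \<le> N (T m (x + w)) + N (T m (x - w))"
      using N_diff_le[of "T m (x + w)" "T m (x - w)"] that by (simp add: bl_op_V[OF T] N_scaleR)
    then show ?thesis by linarith
  qed
  \<comment> \<open>The sign of \<open>y k\<close> is chosen so that after adding it to
    \<open>x\<close> the image under \<open>T (n k)\<close> is at least as large as that of
    \<open>y k\<close>; by \<open>sign\<close> one of the two choices works.\<close>
  define f where "f k x = (if N (T (n k) (y k)) \<le> N (T (n k) (x + y k)) then y k else - y k)" for k x
  define x where "x = rec_nat 0 (\<lambda>k x. x + f k x)"
  have x0: "x 0 = 0" and xS: "x (Suc k) = x k + f k (x k)" for k by (auto simp: x_def)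
  have fV: "f k u \<in> V" "N (f k u) = (1/3)^k" for k u by (auto simp: f_def y N_minus)
  have xV: "x k \<in> V" for k by (induction k) (auto simp: x0 xS fV)
  have xsum: "x k = (\<Sum>j<k. f j (x j))" for k by (induction k) (auto simp: x0 xS add.commute)
  have large: "N (T (n k) (x (Suc k))) \<ge> 2/3 * C k * (1/3)^k" for k
    using sign[OF xV y(1), of "n k" k k] y(3)[of k] by (auto simp: xS f_def)
  have "\<exists>s\<in>V. (\<lambda>m. N (s - (\<Sum>k<m. f k (x k)))) \<longlonglongrightarrow> 0"
    by (rule complete) (auto simp: fV)
  then obtain s where s: "s \<in> V" "(\<lambda>m. N (s - x m)) \<longlonglongrightarrow> 0" by (auto simp: xsum[symmetric])
  \<comment> \<open>The steps taken after stage \<open>k\<close> have norms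
    \<open>(1/3)^(k+1)\<close>, \<open>(1/3)^(k+2)\<close> and so on, with total
    \<open>(1/2) * (1/3)^k\<close>. Multiplied by \<open>C k\<close> this is less than the size
    secured at stage \<open>k\<close>, so later steps cannot undo it.\<close>
  have tail: "N (x (Suc k + j) - x (Suc k)) \<le> (1/2) * (1/3)^k - (1/2) * (1/3)^(k+j)" for k j
  proof (induction j)
    case (Suc j)
    have "N (x (Suc k + Suc j) - x (Suc k)) \<le> N (f (Suc k + j) (x (Suc k + j))) + N (x (Suc k + j) - x (Suc k))"
      using N_add[of "f (Suc k + j) (x (Suc k + j))" "x (Suc k + j) - x (Suc k)"]
      by (simp add: xS fV xV algebra_simps)
    with Suc show ?case by (simp add: fV)
  qed simp
  have tail_s: "N (s - x (Suc k)) \<le> (1/2) * (1/3)^k" for k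
  proof (rule LIMSEQ_le_const)
    show "(\<lambda>j. N (s - x (Suc k + j)) + (1/2) * (1/3)^k) \<longlonglongrightarrow> (1/2) * (1/3)^k"
      using LIMSEQ_ignore_initial_segment[OF s(2), of "Suc k"]
      by (auto intro!: tendsto_eq_intros simp: add.commute)
    show "\<exists>m. \<forall>j\<ge>m. N (s - x (Suc k)) \<le> N (s - x (Suc k + j)) + (1/2) * (1/3)^k"
    proof (intro exI allI impI)
      fix j :: nat
      have "N (s - x (Suc k)) \<le> N (s - x (Suc k + j)) + N (x (Suc k + j) - x (Suc k))"
        using s xV by (intro N_triangle) auto
      also have "N (x (Suc k + j) - x (Suc k)) \<le> (1/2) * (1/3)^k"
        by (rule order_trans[OF tail]) simp
      finally show "N (s - x (Suc k)) \<le> N (s - x (Suc k + j)) + (1/2) * (1/3)^k" by simp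
    qed
  qed
  have big: "N (T (n k) s) > real k" for k
  proof -
    have "0 \<le> 6 * real k * 3^k" by simp
    then have Cpos: "C k > 0" using C[of k] by linarith
    have "N (T (n k) (x (Suc k))) \<le> N (T (n k) s) + N (T (n k) (x (Suc k)) - T (n k) s)"
      using s xV by (intro N_triangle_sub) (auto simp: bl_op_V[OF T])
    also have "T (n k) (x (Suc k)) - T (n k) s = T (n k) (x (Suc k) - s)"
      using s xV by (simp add: bl_op_diff[OF T])
    also have "N \<dots> \<le> C k * N (s - x (Suc k))"
      using bound[of "x (Suc k) - s" k] s xV by (simp add: N_diff_commute)
    also have "\<dots> \<le> C k * ((1/2) * (1/3)^k)"
      using tail_s[of k] Cpos by (intro mult_left_mono) auto
    finally have "N (T (n k) s) \<ge> 2/3 * C k * (1/3)^k - C k * ((1/2) * (1/3)^k)"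
      using large[of k] by simp
    also have "2/3 * C k * (1/3)^k - C k * ((1/2) * (1/3)^k) = C k / (6 * 3^k)"
      by (simp add: power_one_over field_simps)
    finally have ge: "N (T (n k) s) \<ge> C k / (6 * 3^k)" .
    have "real k < C k / (6 * 3^k)" using C[of k] by (simp add: field_simps)
    with ge show ?thesis by simp
  qed
  obtain B where "\<forall>m. N (T m s) \<le> B" using ptw[OF s(1)] by blast
  moreover obtain k :: nat where "B < real k" using reals_Archimedean2 by blast
  ultimately show False using big[of k] by (meson not_le less_trans order_less_le_trans)
qed

subsection \<open>Strongly continuous semigroups and their generators\<close>

definition semigr :: "(real \<Rightarrow> 'a \<Rightarrow> 'a) \<Rightarrow> bool"
  where "semigr T \<longleftrightarrow> (\<forall>\<tau>\<ge>0. bl_op (T \<tau>)) \<and> (\<forall>u\<in>V. T 0 u = u) \<and>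
    (\<forall>\<sigma>\<ge>0. \<forall>\<tau>\<ge>0. \<forall>u\<in>V. T (\<sigma> + \<tau>) u = T \<sigma> (T \<tau> u)) \<and>
    (\<forall>u\<in>V. ((\<lambda>\<tau>. N (T \<tau> u - u)) \<longlongrightarrow> 0) (at_right 0))"

definition rderiv :: "(real \<Rightarrow> 'a \<Rightarrow> 'a) \<Rightarrow> 'a \<Rightarrow> 'a \<Rightarrow> bool"
  where "rderiv T u v \<longleftrightarrow> v \<in> V \<and>
    ((\<lambda>\<tau>. N ((1 / \<tau>) *\<^sub>R (T \<tau> u - u) - v)) \<longlongrightarrow> 0) (at_right 0)"

lemma semigrD:
  assumes "semigr T"
  shows semigr_bl_op: "0 \<le> \<tau> \<Longrightarrow> bl_op (T \<tau>)"
    and semigr_V [simp]: "0 \<le> \<tau> \<Longrightarrow> u \<in> V \<Longrightarrow> T \<tau> u \<in> V"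
    and semigr_0: "u \<in> V \<Longrightarrow> T 0 u = u"
    and semigr_add: "0 \<le> \<sigma> \<Longrightarrow> 0 \<le> \<tau> \<Longrightarrow> u \<in> V \<Longrightarrow> T (\<sigma> + \<tau>) u = T \<sigma> (T \<tau> u)"
    and semigr_tendsto: "u \<in> V \<Longrightarrow> ((\<lambda>\<tau>. N (T \<tau> u - u)) \<longlongrightarrow> 0) (at_right 0)"
  using assms by (auto simp: semigr_def bl_op_V)

lemma semigr_diff:
  "semigr T \<Longrightarrow> 0 \<le> \<tau> \<Longrightarrow> u \<in> V \<Longrightarrow> v \<in> V \<Longrightarrow> T \<tau> (u - v) = T \<tau> u - T \<tau> v"
  by (simp add: bl_op_diff semigr_bl_op)

lemma N_tendsto_0_at_right:
  fixes f :: "real \<Rightarrow> 'a"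
  assumes "\<And>\<tau>. 0 < \<tau> \<Longrightarrow> f \<tau> \<in> V"
  shows "((\<lambda>\<tau>. N (f \<tau>)) \<longlongrightarrow> 0) (at_right 0) \<longleftrightarrow>
    (\<forall>e>0. \<exists>d>0. \<forall>h. 0 < h \<longrightarrow> h < d \<longrightarrow> N (f h) < e)"
proof -
  have "(\<forall>h. 0 < h \<longrightarrow> h < d \<longrightarrow> dist (N (f h)) 0 < e) = (\<forall>h. 0 < h \<longrightarrow> h < d \<longrightarrow> N (f h) < e)" for d e :: real
    using N_nonneg[OF assms] by (auto simp: dist_real_def)
  then show ?thesis
    by (simp add: tendsto_iff eventually_at_right_field)
qed

text \<open>Otherwise there are times \<open>t n\<close> tending to 0 at which the operator norm
  exceeds \<open>n\<close>. Strong continuity at 0 bounds every orbit along this sequence,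
  contradicting uniform boundedness.\<close>

lemma semigr_bounded_near_0:
  assumes T: "semigr T"
  shows "\<exists>d>0. \<exists>M. \<forall>\<tau> u. 0 \<le> \<tau> \<longrightarrow> \<tau> \<le> d \<longrightarrow> u \<in> V \<longrightarrow> N (T \<tau> u) \<le> M * N u"
proof (rule ccontr)
  assume neg: "\<not> ?thesis"
  have "\<exists>\<tau>. 0 \<le> \<tau> \<and> \<tau> \<le> 1 / (real n + 1) \<and> (\<exists>u\<in>V. N (T \<tau> u) > real n * N u)" for n
  proof -
    have "(1 / (real n + 1)) > 0" by simp
    then show ?thesis using neg by (metis not_le)
  qed
  then obtain t where t: "\<And>n. 0 \<le> t n" "\<And>n. t n \<le> 1 / (real n + 1)"
    and big: "\<And>n. \<exists>u\<in>V. N (T (t n) u) > real n * N u" by metis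
  have t0: "t \<longlonglongrightarrow> 0"
  proof (rule tendsto_sandwich[of "\<lambda>_. 0"])
    show "(\<lambda>n. 1 / (real n + 1)) \<longlonglongrightarrow> 0"
      using LIMSEQ_inverse_real_of_nat by (simp add: field_simps)
  qed (use t in auto)
  have "\<exists>M. \<forall>n. \<forall>u\<in>V. N (T (t n) u) \<le> M * N u"
  proof (rule uniform_boundedness)
    show "bl_op (T (t n))" for n using T t by (intro semigr_bl_op)
    fix u assume u: "u \<in> V"
    have "(\<lambda>n. N (T (t n) u - u)) \<longlonglongrightarrow> 0"
    proof (rule LIMSEQ_I)
      fix e :: real assume "e > 0"
      then obtain d where d: "d > 0" "\<And>h. 0 < h \<Longrightarrow> h < d \<Longrightarrow> N (T h u - u) < e"
        using semigr_tendsto[OF T u] N_tendsto_0_at_right[of "\<lambda>h. T h u - u"] T u by auto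
      obtain n0 where n0: "\<And>n. n \<ge> n0 \<Longrightarrow> t n < d"
        using order_tendstoD(2)[OF t0 d(1)] by (auto simp: eventually_sequentially)
      have "N (T (t n) u - u) < e" if "n \<ge> n0" for n
        using d(2)[of "t n"] n0[OF that] t(1)[of n] u \<open>e > 0\<close>
        by (cases "t n = 0") (auto simp: semigr_0[OF T])
      moreover have "N (T (t n) u - u) \<ge> 0" for n using T t u by (intro N_nonneg) auto
      ultimately show "\<exists>no. \<forall>n\<ge>no. norm (N (T (t n) u - u) - 0) < e" by auto
    qed
    then obtain B where B: "\<And>n. N (T (t n) u - u) \<le> B"
      using convergentI convergent_imp_Bseq by (metis BseqE abs_le_D1 real_norm_def)
    show "\<exists>B. \<forall>n. N (T (t n) u) \<le> B"
      using N_triangle_sub[of "T (t _) u" u] B T t u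
      by (intro exI[of _ "N u + B"]) (meson add_left_mono order_trans semigr_V)
  qed
  then obtain M where M: "\<And>n u. u \<in> V \<Longrightarrow> N (T (t n) u) \<le> M * N u" by blast
  obtain n :: nat where n: "M < real n" using reals_Archimedean2 by blast
  obtain u where u: "u \<in> V" "N (T (t n) u) > real n * N u" using big by blast
  have "M * N u \<le> real n * N u" using n N_nonneg[OF u(1)] by (simp add: mult_right_mono)
  with u M[of u n] show False by linarith
qed

text \<open>A time is split into steps of length at most \<open>d\<close>, each costing a factor
  \<open>K\<close>. Raising \<open>K\<close> to at least 1 makes its powers increasing, so one power
  serves for all shorter times as well.\<close>

lemma semigr_locally_bounded:
  assumes T: "semigr T"
  obtains M where "M > 0" "\<And>\<tau> u. 0 \<le> \<tau> \<Longrightarrow> \<tau> \<le> t \<Longrightarrow> u \<in> V \<Longrightarrow> N (T \<tau> u) \<le> M * N u"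
proof -
  obtain d K0 where d: "d > 0" and
    K0: "\<And>\<tau> u. 0 \<le> \<tau> \<Longrightarrow> \<tau> \<le> d \<Longrightarrow> u \<in> V \<Longrightarrow> N (T \<tau> u) \<le> K0 * N u"
    using semigr_bounded_near_0[OF T] by metis
  define K where "K = max K0 1"
  have K: "K \<ge> 1" "\<And>\<tau> u. 0 \<le> \<tau> \<Longrightarrow> \<tau> \<le> d \<Longrightarrow> u \<in> V \<Longrightarrow> N (T \<tau> u) \<le> K * N u"
  proof -
    fix \<tau> u assume *: "0 \<le> \<tau>" "\<tau> \<le> d" "u \<in> V"
    have "K0 * N u \<le> K * N u" using N_nonneg[OF *(3)] by (intro mult_right_mono) (auto simp: K_def)
    with K0[OF *] show "N (T \<tau> u) \<le> K * N u" by linarith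
  qed (simp add: K_def)
  have *: "N (T \<tau> u) \<le> K ^ n * N u" if "0 \<le> \<tau>" "\<tau> \<le> real n * d" "u \<in> V" for n \<tau> u
    using that
  proof (induction n arbitrary: \<tau>)
    case 0
    then show ?case by (simp add: semigr_0[OF T])
  next
    case (Suc n)
    show ?case
    proof (cases "\<tau> \<le> d")
      case True
      have "K * N u \<le> K ^ Suc n * N u"
        using K(1) N_nonneg[OF Suc.prems(3)] self_le_power[of K "Suc n"] by (intro mult_right_mono) auto
      then show ?thesis using K(2)[of \<tau> u] Suc.prems True by linarith
    next
      case False
      have "T \<tau> u = T (d + (\<tau> - d)) u" by simp
      also have "\<dots> = T d (T (\<tau> - d) u)" using False d Suc.prems by (intro semigr_add[OF T]) auto
      finally have "N (T \<tau> u) \<le> K * N (T (\<tau> - d) u)"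
        using K(2)[of d "T (\<tau> - d) u"] d False Suc.prems T by simp
      also have "\<dots> \<le> K * (K ^ n * N u)"
        using Suc.IH[of "\<tau> - d"] Suc.prems False K(1) by (intro mult_left_mono) (auto simp: algebra_simps)
      finally show ?thesis by (simp add: mult.assoc)
    qed
  qed
  obtain n :: nat where "t / d \<le> real n" using real_arch_simple by blast
  then have "t \<le> real n * d" using d by (simp add: field_simps)
  then show ?thesis using that[of "K ^ n"] * K(1) by fastforce
qed

text \<open>To the left of \<open>s\<close> the earlier operator is factored out,
  \<open>T s u - T r u = T r (T (s - r) u - u)\<close>, and the local bound controls
  \<open>T r\<close> uniformly for \<open>r \<le> s\<close>.\<close>

lemma semigr_continuous:
  assumes T: "semigr T" and u: "u \<in> V" and s: "0 \<le> s" and e: "0 < e"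
  shows "\<exists>d>0. \<forall>r\<ge>0. \<bar>r - s\<bar> < d \<longrightarrow> N (T r u - T s u) < e"
proof -
  obtain M where M: "M > 0" "\<And>\<tau> u. 0 \<le> \<tau> \<Longrightarrow> \<tau> \<le> s \<Longrightarrow> u \<in> V \<Longrightarrow> N (T \<tau> u) \<le> M * N u"
    using semigr_locally_bounded[OF T, of s] by metis
  obtain d where d: "d > 0" "\<And>h. 0 < h \<Longrightarrow> h < d \<Longrightarrow> N (T h u - u) < e / M"
  proof -
    have "e / M > 0" using e M by simp
    then show ?thesis
      using semigr_tendsto[OF T u] N_tendsto_0_at_right[of "\<lambda>h. T h u - u"] T u that by auto
  qed
  have *: "N (T (a + h) u - T a u) < e" if "0 \<le> a" "a \<le> s" "0 < h" "h < d" for a h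
  proof -
    have "T (a + h) u - T a u = T a (T h u - u)"
      using that u by (simp add: semigr_add[OF T] semigr_diff[OF T] semigr_V[OF T])
    then have "N (T (a + h) u - T a u) \<le> M * N (T h u - u)"
      using M(2)[of a "T h u - u"] that u T by simp
    also have "\<dots> < M * (e / M)" using d(2)[of h] that M(1) by (intro mult_strict_left_mono) auto
    finally show ?thesis using M by simp
  qed
  have "N (T r u - T s u) < e" if "0 \<le> r" "\<bar>r - s\<bar> < d" for r
  proof -
    consider "r = s" | "r < s" | "r > s" by linarith
    then show ?thesis
    proof cases
      case 2
      then show ?thesis using *[of r "s - r"] that T u s by (simp add: N_diff_commute)
    next
      case 3
      then show ?thesis using *[of s "r - s"] that s by simp
    qed (use e in simp)
  qed
  with d show ?thesis by blast
qed

text \<open>By the triangle inequality the scalar function \<open>N (w s - w 0) - L * s\<close>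
  inherits the right-hand estimate, so it cannot grow. Increments to the right are what
  \<open>rderiv\<close> provides.\<close>

lemma right_lipschitz_imp_le:
  assumes t: "0 \<le> t" and w: "\<And>s. 0 \<le> s \<Longrightarrow> s \<le> t \<Longrightarrow> w s \<in> V"
    and cont: "\<And>s e. 0 \<le> s \<Longrightarrow> s \<le> t \<Longrightarrow> 0 < e \<Longrightarrow>
      \<exists>d>0. \<forall>r. 0 \<le> r \<longrightarrow> r \<le> t \<longrightarrow> \<bar>r - s\<bar> < d \<longrightarrow> N (w r - w s) < e"
    and right: "\<And>s e. 0 \<le> s \<Longrightarrow> s < t \<Longrightarrow> 0 < e \<Longrightarrow>
      \<exists>d>0. \<forall>h. 0 < h \<longrightarrow> h < d \<longrightarrow> s + h \<le> t \<longrightarrow> N (w (s + h) - w s) \<le> (L + e) * h"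
  shows "N (w t - w 0) \<le> L * t"
proof -
  have diff: "\<bar>N (w r - w 0) - N (w s - w 0)\<bar> \<le> N (w r - w s)"
    if "0 \<le> r" "r \<le> t" "0 \<le> s" "s \<le> t" for r s
    using N_triangle[of "w r" "w s" "w 0"] N_triangle[of "w s" "w r" "w 0"] w that
      N_diff_commute[of "w r" "w s"] t by (smt (verit))
  have "N (w t - w 0) - L * t \<le> N (w 0 - w 0) - L * 0"
  proof (rule le_if_right_upper_derivative_nonpos[OF t])
    have "continuous_on {0..t} (\<lambda>s. N (w s - w 0))"
      unfolding continuous_on_iff
    proof (intro ballI allI impI)
      fix s e :: real assume "s \<in> {0..t}" "0 < e"
      then show "\<exists>d>0. \<forall>x'\<in>{0..t}. dist x' s < d \<longrightarrow> dist (N (w x' - w 0)) (N (w s - w 0)) < e"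
        using cont[of s e] diff unfolding dist_real_def by (smt (verit) atLeastAtMost_iff)
    qed
    then show "continuous_on {0..t} (\<lambda>s. N (w s - w 0) - L * s)"
      by (intro continuous_intros)
  next
    fix s e :: real assume *: "0 \<le> s" "s < t" "0 < e"
    obtain d where d: "d > 0"
      "\<And>h. 0 < h \<Longrightarrow> h < d \<Longrightarrow> s + h \<le> t \<Longrightarrow> N (w (s + h) - w s) \<le> (L + e) * h"
      using right[OF *] by blast
    have "N (w (s + h) - w 0) - L * (s + h) - (N (w s - w 0) - L * s) \<le> e * h"
      if "0 < h" "h < d" "s + h \<le> t" for h
      using d(2)[OF that] diff[of "s + h" s] that * by (simp add: algebra_simps)
    with d(1) show "\<exists>d>0. \<forall>h. 0 < h \<longrightarrow> h < d \<longrightarrow> s + h \<le> t \<longrightarrow>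
        N (w (s + h) - w 0) - L * (s + h) - (N (w s - w 0) - L * s) \<le> e * h" by blast
  qed
  then show ?thesis by simp
qed

lemma rderiv_iff:
  assumes "semigr T" "u \<in> V" "v \<in> V"
  shows "rderiv T u v \<longleftrightarrow> (\<forall>e>0. \<exists>d>0. \<forall>h. 0 < h \<longrightarrow> h < d \<longrightarrow> N (T h u - u - h *\<^sub>R v) \<le> e * h)"
proof -
  have scale: "N ((1 / h) *\<^sub>R (T h u - u) - v) = N (T h u - u - h *\<^sub>R v) / h" if "h > 0" for h
  proof -
    have "(1 / h) *\<^sub>R (T h u - u) - v = (1 / h) *\<^sub>R (T h u - u - h *\<^sub>R v)"
      using that by (simp add: scaleR_diff_right)
    then show ?thesis using that assms by (simp add: N_scaleR)
  qed
  have "rderiv T u v \<longleftrightarrow> (\<forall>e>0. \<exists>d>0. \<forall>h. 0 < h \<longrightarrow> h < d \<longrightarrow> N (T h u - u - h *\<^sub>R v) < e * h)"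
    unfolding rderiv_def using assms
    by (subst N_tendsto_0_at_right)
      (auto simp: scale pos_divide_less_eq simp del: scaleR_minus_left cong: conj_cong imp_cong)
  also have "\<dots> \<longleftrightarrow> (\<forall>e>0. \<exists>d>0. \<forall>h. 0 < h \<longrightarrow> h < d \<longrightarrow> N (T h u - u - h *\<^sub>R v) \<le> e * h)"
  proof
    assume r: "\<forall>e>0. \<exists>d>0. \<forall>h. 0 < h \<longrightarrow> h < d \<longrightarrow> N (T h u - u - h *\<^sub>R v) \<le> e * h"
    show "\<forall>e>0. \<exists>d>0. \<forall>h. 0 < h \<longrightarrow> h < d \<longrightarrow> N (T h u - u - h *\<^sub>R v) < e * h"
    proof (intro allI impI)
      fix e :: real assume e: "e > 0"
      then obtain d where d: "d > 0" "\<And>h. 0 < h \<Longrightarrow> h < d \<Longrightarrow> N (T h u - u - h *\<^sub>R v) \<le> e / 2 * h"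
        using r half_gt_zero by metis
      have "N (T h u - u - h *\<^sub>R v) < e * h" if "0 < h" "h < d" for h
      proof -
        have "e / 2 * h < e * h" using e that by simp
        with d(2)[OF that] show ?thesis by linarith
      qed
      with d(1) show "\<exists>d>0. \<forall>h. 0 < h \<longrightarrow> h < d \<longrightarrow> N (T h u - u - h *\<^sub>R v) < e * h" by blast
    qed
  qed (meson less_imp_le)
  finally show ?thesis .
qed

lemma rderivE:
  assumes "rderiv T u v" "semigr T" "u \<in> V" "e > 0"
  obtains d where "d > 0" "\<And>h. 0 < h \<Longrightarrow> h < d \<Longrightarrow> N (T h u - u - h *\<^sub>R v) \<le> e * h"
proof -
  have "v \<in> V" using assms by (simp add: rderiv_def)
  then show ?thesis using assms rderiv_iff[of T u v] that by metis
qed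

lemma rderiv_V: "rderiv T u v \<Longrightarrow> v \<in> V"
  by (simp add: rderiv_def)

lemma rderiv_diff:
  assumes T: "semigr T" and u: "u \<in> V" "u' \<in> V" and d: "rderiv T u v" "rderiv T u' v'"
  shows "rderiv T (u - u') (v - v')"
proof -
  have v: "v \<in> V" "v' \<in> V" using d by (auto dest: rderiv_V)
  have "\<exists>d>0. \<forall>h. 0 < h \<longrightarrow> h < d \<longrightarrow> N (T h (u - u') - (u - u') - h *\<^sub>R (v - v')) \<le> e * h"
    if e: "e > 0" for e
  proof -
    have e2: "e / 2 > 0" using e by simp
    obtain d1 where d1: "d1 > 0" "\<And>h. 0 < h \<Longrightarrow> h < d1 \<Longrightarrow> N (T h u - u - h *\<^sub>R v) \<le> e / 2 * h"
      using rderivE[OF d(1) T u(1) e2] by blast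
    obtain d2 where d2: "d2 > 0" "\<And>h. 0 < h \<Longrightarrow> h < d2 \<Longrightarrow> N (T h u' - u' - h *\<^sub>R v') \<le> e / 2 * h"
      using rderivE[OF d(2) T u(2) e2] by blast
    have "N (T h (u - u') - (u - u') - h *\<^sub>R (v - v')) \<le> e * h" if h: "0 < h" "h < min d1 d2" for h
    proof -
      have "T h (u - u') - (u - u') - h *\<^sub>R (v - v') = (T h u - u - h *\<^sub>R v) - (T h u' - u' - h *\<^sub>R v')"
        using T u h by (simp add: semigr_diff algebra_simps)
      also have "N \<dots> \<le> N (T h u - u - h *\<^sub>R v) + N (T h u' - u' - h *\<^sub>R v')"
        using T u v h by (intro N_diff_le) auto
      finally show ?thesis using d1(2)[of h] d2(2)[of h] h by simp
    qed
    then show ?thesis using d1(1) d2(1) by (intro exI[of _ "min d1 d2"]) auto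
  qed
  then show ?thesis using rderiv_iff[OF T, of "u - u'" "v - v'"] u v by simp
qed

lemma rderiv_scaleR:
  assumes T: "semigr T" and u: "u \<in> V" and d: "rderiv T u v"
  shows "rderiv T (c *\<^sub>R u) (c *\<^sub>R v)"
proof -
  have v: "v \<in> V" using d by (auto dest: rderiv_V)
  have "((\<lambda>\<tau>. \<bar>c\<bar> * N ((1 / \<tau>) *\<^sub>R (T \<tau> u - u) - v)) \<longlongrightarrow> \<bar>c\<bar> * 0) (at_right 0)"
    using d by (intro tendsto_mult_left) (auto simp: rderiv_def)
  moreover have "\<forall>\<^sub>F \<tau> in at_right 0. \<bar>c\<bar> * N ((1 / \<tau>) *\<^sub>R (T \<tau> u - u) - v) =
      N ((1 / \<tau>) *\<^sub>R (T \<tau> (c *\<^sub>R u) - c *\<^sub>R u) - c *\<^sub>R v)"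
    using eventually_at_right_less[of "0::real"]
  proof eventually_elim
    case (elim \<tau>)
    have "(1 / \<tau>) *\<^sub>R (T \<tau> (c *\<^sub>R u) - c *\<^sub>R u) - c *\<^sub>R v = c *\<^sub>R ((1 / \<tau>) *\<^sub>R (T \<tau> u - u) - v)"
      using T u elim by (simp add: bl_op_scaleR[OF semigr_bl_op] scaleR_diff_right mult.commute)
    then show ?case using T u v elim by (simp add: N_scaleR)
  qed
  ultimately show ?thesis using v by (auto simp: rderiv_def elim: Lim_transform_eventually)
qed

text \<open>The operators of a semigroup commute, so the bounded operator \<open>T s\<close> can be
  pulled out of the increment over time \<open>h\<close>.\<close>

lemma rderiv_semigr:
  assumes T: "semigr T" and u: "u \<in> V" and d: "rderiv T u v" and s: "0 \<le> s"
  shows "rderiv T (T s u) (T s v)"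
proof -
  have v: "v \<in> V" using d by (auto dest: rderiv_V)
  obtain M where M: "M > 0" "\<And>u. u \<in> V \<Longrightarrow> N (T s u) \<le> M * N u"
    using bl_op_bound[OF semigr_bl_op[OF T s]] by metis
  have "\<exists>d>0. \<forall>h. 0 < h \<longrightarrow> h < d \<longrightarrow> N (T h (T s u) - T s u - h *\<^sub>R T s v) \<le> e * h" if e: "e > 0" for e
  proof -
    have e2: "e / M > 0" using e M by simp
    obtain d1 where d1: "d1 > 0" "\<And>h. 0 < h \<Longrightarrow> h < d1 \<Longrightarrow> N (T h u - u - h *\<^sub>R v) \<le> e / M * h"
      using rderivE[OF d T u e2] by blast
    have "N (T h (T s u) - T s u - h *\<^sub>R T s v) \<le> e * h" if h: "0 < h" "h < d1" for h
    proof -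
      have "T h (T s u) = T s (T h u)"
        using semigr_add[OF T, of h s u] semigr_add[OF T, of s h u] h s u by (simp add: add.commute)
      then have "T h (T s u) - T s u - h *\<^sub>R T s v = T s (T h u - u - h *\<^sub>R v)"
        using T u v h s by (simp add: semigr_diff bl_op_scaleR[OF semigr_bl_op])
      also have "N \<dots> \<le> M * N (T h u - u - h *\<^sub>R v)" using M T u v h by simp
      also have "\<dots> \<le> M * (e / M * h)" using M(1) d1(2)[OF h] by (intro mult_left_mono) auto
      finally show ?thesis using M(1) by simp
    qed
    with d1(1) show ?thesis by blast
  qed
  then show ?thesis using rderiv_iff[OF T, of "T s u" "T s v"] T u v s by simp
qed

lemma rderiv_unique:
  assumes T: "semigr T" and u: "u \<in> V" and d: "rderiv T u v" "rderiv T u v'"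
  shows "v = v'"
proof -
  have v: "v \<in> V" "v' \<in> V" using d by (auto dest: rderiv_V)
  have "((\<lambda>\<tau>. N ((1 / \<tau>) *\<^sub>R (T \<tau> u - u) - v) + N ((1 / \<tau>) *\<^sub>R (T \<tau> u - u) - v')) \<longlongrightarrow> 0 + 0) (at_right 0)"
    using d by (intro tendsto_add) (auto simp: rderiv_def)
  moreover have "\<forall>\<^sub>F \<tau> in at_right 0. N (v - v') \<le> N ((1 / \<tau>) *\<^sub>R (T \<tau> u - u) - v) + N ((1 / \<tau>) *\<^sub>R (T \<tau> u - u) - v')"
    using eventually_at_right_less[of "0::real"]
  proof eventually_elim
    case (elim \<tau>)
    let ?x = "(1 / \<tau>) *\<^sub>R (T \<tau> u - u)"
    have "?x \<in> V" using T u elim by auto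
    then show ?case using N_triangle[of v ?x v'] v N_diff_commute[of v ?x] by simp
  qed
  ultimately have "N (v - v') \<le> 0" by (intro tendsto_lowerbound) auto
  then show ?thesis using N_eq_0[of "v - v'"] N_nonneg[of "v - v'"] v by simp
qed

text \<open>Takes the place of the formula for \<open>T t u - u\<close> as the integral of
  \<open>T s v\<close> over \<open>[0, t]\<close>: the increment after time \<open>s\<close> is
  \<open>T s (T h u - u)\<close>, whose norm is at most \<open>(M * N v + e) * h\<close> for small
  \<open>h\<close>.\<close>

lemma rderiv_lipschitz:
  assumes T: "semigr T" and u: "u \<in> V" and d: "rderiv T u v" and t: "0 \<le> t"
    and M: "\<And>\<tau> u. 0 \<le> \<tau> \<Longrightarrow> \<tau> \<le> t \<Longrightarrow> u \<in> V \<Longrightarrow> N (T \<tau> u) \<le> M * N u" and M0: "M > 0"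
  shows "N (T t u - u) \<le> M * N v * t"
proof -
  have v: "v \<in> V" using d by (auto dest: rderiv_V)
  have "N (T t u - T 0 u) \<le> M * N v * t"
  proof (rule right_lipschitz_imp_le[OF t])
    fix s e :: real assume *: "0 \<le> s" "s < t" "0 < e"
    have "e / M > 0" using * M0 by simp
    then obtain d1 where d1: "d1 > 0" "\<And>h. 0 < h \<Longrightarrow> h < d1 \<Longrightarrow> N (T h u - u - h *\<^sub>R v) \<le> e / M * h"
      using rderivE[OF d T u] by blast
    have "N (T (s + h) u - T s u) \<le> (M * N v + e) * h" if h: "0 < h" "h < d1" for h
    proof -
      have "N (T (s + h) u - T s u) = N (T s (T h u - u))"
        using T u h * by (simp add: semigr_add semigr_diff)
      also have "\<dots> \<le> M * N (T h u - u)" using M T u h * by simp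
      also have "N (T h u - u) \<le> N (h *\<^sub>R v) + N (T h u - u - h *\<^sub>R v)"
        using T u v h by (intro N_triangle_sub) auto
      also have "N (h *\<^sub>R v) + N (T h u - u - h *\<^sub>R v) \<le> h * N v + e / M * h"
        using d1(2)[OF h] h v by (simp add: N_scaleR)
      finally show ?thesis using M0 by (simp add: algebra_simps)
    qed
    with d1(1) show "\<exists>d>0. \<forall>h. 0 < h \<longrightarrow> h < d \<longrightarrow> s + h \<le> t \<longrightarrow>
        N (T (s + h) u - T s u) \<le> (M * N v + e) * h" by blast
  next
    fix s e :: real assume "0 \<le> s" "0 < e"
    then show "\<exists>d>0. \<forall>r. 0 \<le> r \<longrightarrow> r \<le> t \<longrightarrow> \<bar>r - s\<bar> < d \<longrightarrow> N (T r u - T s u) < e"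
      using semigr_continuous[OF T u, of s e] by blast
  qed (use T u in auto)
  then show ?thesis by (simp add: semigr_0[OF T u])
qed

lemma rderiv_0_imp_fixed:
  assumes T: "semigr T" and u: "u \<in> V" and d: "rderiv T u 0" and t: "0 \<le> t"
  shows "T t u = u"
proof -
  obtain M where "M > 0" "\<And>\<tau> u. 0 \<le> \<tau> \<Longrightarrow> \<tau> \<le> t \<Longrightarrow> u \<in> V \<Longrightarrow> N (T \<tau> u) \<le> M * N u"
    using semigr_locally_bounded[OF T, of t] by metis
  then have "N (T t u - u) \<le> 0" using rderiv_lipschitz[OF T u d t, of M] by simp
  then show ?thesis using N_eq_0[of "T t u - u"] N_nonneg[of "T t u - u"] T u t by simp
qed

text \<open>The distance of \<open>vn n\<close> from \<open>v\<close> enters the increment of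
  \<open>u - un n\<close> over time \<open>h\<close> only as a multiple of \<open>h\<close>,
  uniformly for \<open>h \<le> 1\<close>. Hence \<open>n\<close> can be fixed before
  \<open>h\<close> becomes small.\<close>

lemma rderiv_closed:
  fixes un vn :: "nat \<Rightarrow> 'a"
  assumes T: "semigr T" and V: "u \<in> V" "v \<in> V" "\<And>n. un n \<in> V" and d: "\<And>n. rderiv T (un n) (vn n)"
    and un: "(\<lambda>n. N (un n - u)) \<longlonglongrightarrow> 0" and vn: "(\<lambda>n. N (vn n - v)) \<longlonglongrightarrow> 0"
  shows "rderiv T u v"
proof -
  have vnV: "vn n \<in> V" for n using d by (auto dest: rderiv_V)
  obtain M where M: "M > 0" "\<And>\<tau> u. 0 \<le> \<tau> \<Longrightarrow> \<tau> \<le> 1 \<Longrightarrow> u \<in> V \<Longrightarrow> N (T \<tau> u) \<le> M * N u"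
    using semigr_locally_bounded[OF T, of 1] by metis
  \<comment> \<open>\<open>u - un n\<close> is not yet known to lie in the domain. The Lipschitz
    bound is applied to \<open>un m - un n\<close>, which does, and \<open>m\<close> then tends to
    infinity.\<close>
  have approx: "N (T h (u - un n) - (u - un n)) \<le> M * N (v - vn n) * h" if h: "0 \<le> h" "h \<le> 1" for h n
  proof -
    let ?a = "\<lambda>m. (M + 1) * N (un m - u) + M * (N (v - vn n) + N (vn m - v)) * h"
    have "?a \<longlonglongrightarrow> (M + 1) * 0 + M * (N (v - vn n) + 0) * h"
      by (intro tendsto_intros un vn)
    moreover have "N (T h (u - un n) - (u - un n)) \<le> ?a m" for m
    proof -
      have "N (T h (un m - un n) - (un m - un n)) \<le> M * N (vn m - vn n) * h"
        using M h V by (intro rderiv_lipschitz[OF T _ rderiv_diff[OF T _ _ d d]]) auto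
      also have "\<dots> \<le> M * (N (v - vn n) + N (vn m - v)) * h"
        using N_triangle[of "vn m" v "vn n"] V vnV M(1) h by (intro mult_right_mono mult_left_mono) auto
      finally have 1: "N (T h (un m - un n) - (un m - un n)) \<le> M * (N (v - vn n) + N (vn m - v)) * h" .
      have "T h (u - un n) - (u - un n) =
          (T h (un m - un n) - (un m - un n)) - (T h (un m - u) - (un m - u))"
        using T V h by (simp add: semigr_diff)
      also have "N \<dots> \<le> N (T h (un m - un n) - (un m - un n)) + N (T h (un m - u) - (un m - u))"
        using T V h by (intro N_diff_le) auto
      also have "N (T h (un m - u) - (un m - u)) \<le> N (T h (un m - u)) + N (un m - u)"
        using T V h by (intro N_diff_le) auto
      also have "N (T h (un m - u)) \<le> M * N (un m - u)" using M h V by simp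
      finally show ?thesis using 1 by (simp add: algebra_simps)
    qed
    ultimately show ?thesis by (intro LIMSEQ_le_const[of ?a]) auto
  qed
  have "\<exists>d>0. \<forall>h. 0 < h \<longrightarrow> h < d \<longrightarrow> N (T h u - u - h *\<^sub>R v) \<le> e * h" if e: "e > 0" for e
  proof -
    \<comment> \<open>\<open>M\<close> pays for the bound \<open>approx\<close>, and 1 for the term
      \<open>h *\<^sub>R (v - vn n)\<close>.\<close>
    have "e / (2 * (M + 1)) > 0" using e M by simp
    then obtain n where n: "N (vn n - v) < e / (2 * (M + 1))"
      using order_tendstoD(2)[OF vn] by (auto simp: eventually_sequentially)
    have n': "(M + 1) * N (v - vn n) \<le> e / 2"
      using n M(1) V vnV N_diff_commute[of v "vn n"] by (simp add: field_simps)
    have "e / 2 > 0" using e by simp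
    then obtain d1 where d1: "d1 > 0"
      "\<And>h. 0 < h \<Longrightarrow> h < d1 \<Longrightarrow> N (T h (un n) - un n - h *\<^sub>R vn n) \<le> e / 2 * h"
      using rderivE[OF d T V(3)] by blast
    have "N (T h u - u - h *\<^sub>R v) \<le> e * h" if h: "0 < h" "h < min d1 1" for h
    proof -
      have "T h u - u - h *\<^sub>R v = (T h (un n) - un n - h *\<^sub>R vn n) +
          ((T h (u - un n) - (u - un n)) - h *\<^sub>R (v - vn n))"
        using T V h by (simp add: semigr_diff algebra_simps)
      also have "N \<dots> \<le> N (T h (un n) - un n - h *\<^sub>R vn n) +
          N ((T h (u - un n) - (u - un n)) - h *\<^sub>R (v - vn n))"
        using T V vnV h by (intro N_add) auto
      also have "N ((T h (u - un n) - (u - un n)) - h *\<^sub>R (v - vn n)) \<le>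
          N (T h (u - un n) - (u - un n)) + N (h *\<^sub>R (v - vn n))"
        using T V vnV h by (intro N_diff_le) auto
      also have "N (h *\<^sub>R (v - vn n)) = h * N (v - vn n)" using V vnV h by (simp add: N_scaleR)
      also have "N (T h (u - un n) - (u - un n)) + h * N (v - vn n) \<le> (M + 1) * N (v - vn n) * h"
        using approx[of h n] h by (simp add: algebra_simps)
      also have "\<dots> \<le> e / 2 * h" using n' h by (intro mult_right_mono) auto
      finally show ?thesis using d1(2)[of h] h by simp
    qed
    then show ?thesis using d1(1) by (intro exI[of _ "min d1 1"]) auto
  qed
  then show ?thesis using rderiv_iff[OF T, of u v] V by simp
qed

text \<open>If \<open>u\<close> has derivative \<open>v\<close>, then its difference quotients tend
  to \<open>v\<close> and themselves lie in the domain. Surjectivity of the generator thus replaces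
  the usual averaging of orbits over short times.\<close>

lemma domain_dense:
  assumes T: "semigr T" and surj: "\<And>v. v \<in> V \<Longrightarrow> \<exists>u\<in>V. rderiv T u v" and v: "v \<in> V" and e: "e > 0"
  shows "\<exists>u\<in>V. (\<exists>w. rderiv T u w) \<and> N (u - v) < e"
proof -
  obtain u where u: "u \<in> V" "rderiv T u v" using surj v by blast
  have "\<forall>\<^sub>F \<tau> in at_right 0. N ((1 / \<tau>) *\<^sub>R (T \<tau> u - u) - v) < e"
    using u e by (intro order_tendstoD(2)) (auto simp: rderiv_def)
  then have "\<forall>\<^sub>F \<tau> in at_right 0. 0 < \<tau> \<and> N ((1 / \<tau>) *\<^sub>R (T \<tau> u - u) - v) < e"
    using eventually_at_right_less[of "0::real"] by eventually_elim auto
  then obtain \<tau> :: real where \<tau>: "0 < \<tau>" "N ((1 / \<tau>) *\<^sub>R (T \<tau> u - u) - v) < e"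
    using eventually_happens trivial_limit_at_right_real by (metis (mono_tags, lifting))
  have "rderiv T ((1 / \<tau>) *\<^sub>R (T \<tau> u - u)) ((1 / \<tau>) *\<^sub>R (T \<tau> v - v))"
    using T u \<tau> by (intro rderiv_scaleR rderiv_diff rderiv_semigr) auto
  then show ?thesis using T u \<tau> by (intro bexI[of _ "(1 / \<tau>) *\<^sub>R (T \<tau> u - u)"]) auto
qed

text \<open>For \<open>u\<close> in the domain, the curve \<open>s \<mapsto> T (t - s) (S s u)\<close> from \<open>T t u\<close> to \<open>S t u\<close> has
  right derivative zero.\<close>

theorem semigr_unique:
  assumes T: "semigr T" and S: "semigr S"
    and gen: "\<And>u v. u \<in> V \<Longrightarrow> rderiv S u v \<Longrightarrow> rderiv T u v"
    and dense: "\<And>v e. v \<in> V \<Longrightarrow> e > 0 \<Longrightarrow> \<exists>u\<in>V. (\<exists>w. rderiv S u w) \<and> N (u - v) < e"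
    and t: "0 \<le> t" and u: "u \<in> V"
  shows "T t u = S t u"
proof -
  obtain M where M: "M > 0" "\<And>\<tau> u. 0 \<le> \<tau> \<Longrightarrow> \<tau> \<le> t \<Longrightarrow> u \<in> V \<Longrightarrow> N (T \<tau> u) \<le> M * N u"
    using semigr_locally_bounded[OF T, of t] by metis
  have dom: "T t u = S t u" if u: "u \<in> V" and d: "rderiv S u v" for u v
  proof -
    define w where "w s = T (t - s) (S s u)" for s
    have wV: "w s \<in> V" if "0 \<le> s" "s \<le> t" for s using T S u that by (simp add: w_def)
    \<comment> \<open>Both values of \<open>w\<close> factor through \<open>T (t - (s + h))\<close>,
      which leaves \<open>S h - T h\<close> applied to \<open>S s u\<close>. Since the two
      semigroups have the same derivative there, the terms of first order in \<open>h\<close>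
      cancel.\<close>
    have step: "N (w (s + h) - w s) \<le> M * N (S h (S s u) - T h (S s u))"
      if "0 \<le> s" "0 \<le> h" "s + h \<le> t" for s h
    proof -
      have "w s = T ((t - (s + h)) + h) (S s u)" by (simp add: w_def)
      also have "\<dots> = T (t - (s + h)) (T h (S s u))"
        using that u S by (intro semigr_add[OF T]) auto
      finally have ws: "w s = T (t - (s + h)) (T h (S s u))" .
      have "w (s + h) = T (t - (s + h)) (S h (S s u))"
        using semigr_add[OF S, of h s u] that u by (simp add: w_def add.commute)
      then have "w (s + h) - w s = T (t - (s + h)) (S h (S s u) - T h (S s u))"
        using T S u that by (simp add: ws semigr_diff)
      then show ?thesis using M(2) T S u that by simp
    qed
    have "N (w t - w 0) \<le> 0 * t"
    proof (rule right_lipschitz_imp_le[OF t])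
      fix s e :: real assume *: "0 \<le> s" "s < t" "0 < e"
      have x: "S s u \<in> V" "rderiv S (S s u) (S s v)" using S u d * by (auto intro: rderiv_semigr)
      then have x': "rderiv T (S s u) (S s v)" by (intro gen)
      have vV: "S s v \<in> V" using x by (auto dest: rderiv_V)
      have e2: "e / (2 * M) > 0" using * M by simp
      obtain d1 where d1: "d1 > 0"
        "\<And>h. 0 < h \<Longrightarrow> h < d1 \<Longrightarrow> N (S h (S s u) - S s u - h *\<^sub>R S s v) \<le> e / (2 * M) * h"
        using rderivE[OF x(2) S x(1) e2] by blast
      obtain d2 where d2: "d2 > 0"
        "\<And>h. 0 < h \<Longrightarrow> h < d2 \<Longrightarrow> N (T h (S s u) - S s u - h *\<^sub>R S s v) \<le> e / (2 * M) * h"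
        using rderivE[OF x' T x(1) e2] by blast
      have "N (w (s + h) - w s) \<le> (0 + e) * h" if h: "0 < h" "h < min d1 d2" "s + h \<le> t" for h
      proof -
        have "S h (S s u) - T h (S s u) =
            (S h (S s u) - S s u - h *\<^sub>R S s v) - (T h (S s u) - S s u - h *\<^sub>R S s v)" by simp
        also have "N \<dots> \<le> N (S h (S s u) - S s u - h *\<^sub>R S s v) + N (T h (S s u) - S s u - h *\<^sub>R S s v)"
          using T S x vV h by (intro N_diff_le) auto
        also have "\<dots> \<le> e / M * h" using d1(2)[of h] d2(2)[of h] h by (simp add: field_simps)
        finally have "M * N (S h (S s u) - T h (S s u)) \<le> M * (e / M * h)"
          using M(1) by (intro mult_left_mono) auto
        then show ?thesis using step[of s h] * h M(1) by simp
      qed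
      then show "\<exists>d>0. \<forall>h. 0 < h \<longrightarrow> h < d \<longrightarrow> s + h \<le> t \<longrightarrow> N (w (s + h) - w s) \<le> (0 + e) * h"
        using d1(1) d2(1) by (intro exI[of _ "min d1 d2"]) auto
    next
      fix s e :: real assume *: "0 \<le> s" "s \<le> t" "0 < e"
      have x: "S s u \<in> V" using S u * by simp
      \<comment> \<open>An increment to the right of \<open>s\<close> costs
        \<open>M * (2 * e')\<close>, one to the left \<open>M * (e' + M * e')\<close>. Both are at
        most \<open>M * (2 + M) * e'\<close>, which is below \<open>e\<close>.\<close>
      define e' where "e' = e / (2 * M * (M + 1))"
      have e': "e' > 0" using * M by (simp add: e'_def)
      obtain d1 where d1: "d1 > 0" "\<And>r. 0 \<le> r \<Longrightarrow> \<bar>r - s\<bar> < d1 \<Longrightarrow> N (S r u - S s u) < e'"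
        using semigr_continuous[OF S u *(1) e'] by blast
      obtain d2 where d2: "d2 > 0" "\<And>r. 0 \<le> r \<Longrightarrow> \<bar>r - 0\<bar> < d2 \<Longrightarrow> N (T r (S s u) - T 0 (S s u)) < e'"
        using semigr_continuous[OF T x, of 0 e'] e' by (metis order_refl)
      have Te: "M * (2 + M) * e' < e" if "M * (2 + M) < 2 * M * (M + 1)"
      proof -
        have "M * (2 + M) * e' < 2 * M * (M + 1) * e'" using that e' by (rule mult_strict_right_mono)
        then show ?thesis using M(1) by (simp add: e'_def)
      qed
      have MM: "M * (2 + M) < 2 * M * (M + 1)" using M(1) by (simp add: algebra_simps)
      have "N (w r - w s) < e" if r: "0 \<le> r" "r \<le> t" "\<bar>r - s\<bar> < min d1 d2" for r
      proof -
        consider "r = s" | "r > s" | "r < s" by linarith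
        then show ?thesis
        proof cases
          case 1
          then show ?thesis using * by simp
        next
          case 2
          define h where "h = r - s"
          have h: "0 < h" "r = s + h" using 2 by (auto simp: h_def)
          have "S h (S s u) = S r u" using semigr_add[OF S, of h s u] h * u by (simp add: add.commute)
          then have "N (S h (S s u) - T h (S s u)) \<le> N (S r u - S s u) + N (S s u - T h (S s u))"
            using S T u x h r by (metis N_triangle less_imp_le semigr_V)
          also have "\<dots> = N (S r u - S s u) + N (T h (S s u) - T 0 (S s u))"
            using S T u x h by (simp add: semigr_0 N_diff_commute)
          also have "\<dots> < e' + e'" using d1(2)[of r] d2(2)[of h] r h by (intro add_strict_mono) auto
          finally have "M * N (S h (S s u) - T h (S s u)) \<le> M * (2 * e')"
            using M(1) by (intro mult_left_mono) auto
          moreover have "M * (2 * e') \<le> M * (2 + M) * e'" using M(1) e' by (simp add: algebra_simps)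
          ultimately show ?thesis using step[of s h] h r * Te[OF MM] by simp
        next
          case 3
          define h where "h = s - r"
          have h: "0 < h" "s = r + h" using 3 by (auto simp: h_def)
          have hr: "S h (S r u) = S s u" using semigr_add[OF S, of h r u] h r u by (simp add: add.commute)
          have y: "S r u \<in> V" using S u r by simp
          have "N (w s - w r) \<le> M * N (S s u - T h (S r u))"
            using step[of r h] h r * hr by simp
          \<comment> \<open>The modulus \<open>d2\<close> concerns only the orbit of the fixed
            vector \<open>S s u\<close> under \<open>T\<close>, whereas \<open>S r u\<close> moves
            with \<open>r\<close>; so \<open>S r u\<close> is first replaced by
            \<open>S s u\<close>.\<close>
          also have "N (S s u - T h (S r u)) \<le> N (S s u - T h (S s u)) + N (T h (S s u) - T h (S r u))"
            using T x y h by (intro N_triangle) auto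
          also have "N (S s u - T h (S s u)) = N (T h (S s u) - T 0 (S s u))"
            using T x h by (simp add: semigr_0 N_diff_commute)
          also have "N (T h (S s u) - T h (S r u)) = N (T h (S s u - S r u))"
            using T x y h by (simp add: semigr_diff)
          also have "\<dots> \<le> M * N (S r u - S s u)"
            using M(2)[of h "S s u - S r u"] x y h r * by (simp add: N_diff_commute)
          finally have "N (w s - w r) \<le> M * (N (T h (S s u) - T 0 (S s u)) + M * N (S r u - S s u))"
            using M(1) by simp
          also have "\<dots> \<le> M * (e' + M * e')"
            using d1(2)[of r] d2(2)[of h] r h M(1) by (intro mult_left_mono add_mono) auto
          also have "\<dots> \<le> M * (2 + M) * e'" using M(1) e' by (simp add: algebra_simps)
          finally show ?thesis using Te[OF MM] wV r * by (simp add: N_diff_commute)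
        qed
      qed
      then show "\<exists>d>0. \<forall>r. 0 \<le> r \<longrightarrow> r \<le> t \<longrightarrow> \<bar>r - s\<bar> < d \<longrightarrow> N (w r - w s) < e"
        using d1(1) d2(1) by (intro exI[of _ "min d1 d2"]) auto
    qed (use wV in auto)
    then have "w t = w 0"
      using N_eq_0[of "w t - w 0"] N_nonneg[of "w t - w 0"] wV t by simp
    then show ?thesis using S T u t by (simp add: w_def semigr_0)
  qed
  obtain K where K: "K > 0" "\<And>u. u \<in> V \<Longrightarrow> N (S t u) \<le> K * N u"
    using bl_op_bound[OF semigr_bl_op[OF S t]] by metis
  have "N (T t u - S t u) \<le> 0 + e" if "e > 0" for e
  proof -
    have "e / (M + K) > 0" using that M K by simp
    then obtain w where w: "w \<in> V" "\<exists>v. rderiv S w v" "N (w - u) < e / (M + K)"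
      using dense[OF u] by blast
    have eq: "T t w = S t w" using dom w by blast
    have "T t u - S t u = S t (w - u) - T t (w - u)"
      using T S t u w by (simp add: semigr_diff eq)
    also have "N \<dots> \<le> N (S t (w - u)) + N (T t (w - u))"
      using T S t u w by (intro N_diff_le) auto
    also have "\<dots> \<le> K * N (w - u) + M * N (w - u)"
      using K M t u w by (intro add_mono) auto
    also have "\<dots> = (M + K) * N (w - u)" by (simp add: algebra_simps)
    also have "\<dots> \<le> e" using w M K by (simp add: field_simps)
    finally show ?thesis by simp
  qed
  then have "N (T t u - S t u) \<le> 0" by (rule field_le_epsilon)
  then show ?thesis using N_eq_0[of "T t u - S t u"] N_nonneg[of "T t u - S t u"] T S t u by simp
qed

end

subsection \<open>The spaces \<open>L\<^sup>p\<close>\<close>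

abbreviation meas :: "(real \<Rightarrow> complex) \<Rightarrow> bool"
  where "meas f \<equiv> f \<in> borel_measurable unit_meas"

lemma ae_eq_refl_iff: "ae_eq f f \<longleftrightarrow> meas f"
  by (simp add: ae_eq_def)

lemma rep_measurable [measurable, simp]: "meas (rep u)"
  using Quotient3_rep_reflp[OF Quotient3_l0, of u] by (simp add: ae_eq_refl_iff)

lemma cls_rep [simp]: "cls (rep u) = u"
  by (rule Quotient3_abs_rep[OF Quotient3_l0])

lemma cls_eqI: "meas f \<Longrightarrow> meas g \<Longrightarrow> AE t in unit_meas. f t = g t \<Longrightarrow> cls f = cls g"
  using Quotient3_rel[OF Quotient3_l0, of f g] by (simp add: ae_eq_def)

lemma cls_eqD: "meas f \<Longrightarrow> meas g \<Longrightarrow> cls f = cls g \<Longrightarrow> AE t in unit_meas. f t = g t"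
  using Quotient3_rel[OF Quotient3_l0, of f g] by (simp add: ae_eq_def)

lemma cls_cong: "meas f \<Longrightarrow> (\<And>t. 0 \<le> t \<Longrightarrow> t \<le> 1 \<Longrightarrow> f t = g t) \<Longrightarrow> cls f = cls g"
  by (rule cls_eqI) (auto cong: measurable_cong_simp elim!: measurable_cong[THEN iffD1, rotated])

lemma rep_cls: "meas f \<Longrightarrow> AE t in unit_meas. rep (cls f) t = f t"
  by (rule cls_eqD) auto

lemma
  assumes [simp]: "meas f"
  shows cls_add: "meas g \<Longrightarrow> cls f + cls g = cls (\<lambda>t. f t + g t)"
    and cls_diff: "meas g \<Longrightarrow> cls f - cls g = cls (\<lambda>t. f t - g t)"
    and cls_scaleR: "c *\<^sub>R cls f = cls (\<lambda>t. c *\<^sub>R f t)"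
  by (simp_all add: plus_l0.abs_eq minus_l0.abs_eq scaleR_l0.abs_eq ae_eq_refl_iff)

lemma cls_0: "cls (\<lambda>_. 0) = 0"
  by (simp add: zero_l0_def)

lemma mult_op_cls:
  assumes [measurable]: "meas a" "meas f"
  shows "mult_op a (cls f) = cls (\<lambda>t. a t * f t)"
  unfolding mult_op_def
proof (rule cls_eqI)
  show "AE t in unit_meas. a t * rep (cls f) t = a t * f t"
    using rep_cls[OF assms(2)] by eventually_elim simp
qed measurable

lemma mult_op_const: "mult_op (\<lambda>_. complex_of_real c) u = c *\<^sub>R u"
  using cls_scaleR[of "rep u" c] by (simp add: mult_op_def scaleR_conv_of_real)

lemma Lp_cls:
  assumes [measurable]: "meas f"
  shows "cls f \<in> Lp p \<longleftrightarrow> integrable unit_meas (\<lambda>t. norm (f t) powr p)"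
  unfolding Lp_def mem_Collect_eq
  by (rule integrable_cong_AE) (use rep_cls[OF assms] in \<open>auto elim!: eventually_mono\<close>)

lemma Lp_norm_cls:
  assumes [measurable]: "meas f"
  shows "Lp_norm p (cls f) = (LINT t|unit_meas. norm (f t) powr p) powr (1 / p)"
proof -
  have "(LINT t|unit_meas. norm (rep (cls f) t) powr p) = (LINT t|unit_meas. norm (f t) powr p)"
    by (rule integral_cong_AE) (use rep_cls[OF assms] in \<open>auto elim!: eventually_mono\<close>)
  then show ?thesis by (simp add: Lp_norm_def)
qed

lemma Lp_norm_nonneg: "0 \<le> Lp_norm p u"
  by (simp add: Lp_norm_def)

lemma finite_measure_unit_meas: "finite_measure unit_meas"
  by (rule finite_measure_lebesgue_on) simp

lemma measure_unit_meas: "measure unit_meas {0..1} = 1"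
  by (simp add: measure_restrict_space)

text \<open>When an argument is zero its term drops out, since \<open>0 powr p = 0\<close>, and the
  claim reduces to \<open>k powr p \<le> k\<close> for \<open>k\<close> in [0,1].\<close>

lemma convex_powr_nonneg:
  fixes a b :: real
  assumes "1 \<le> p" "0 \<le> a" "0 \<le> b" "0 \<le> l" "0 \<le> m" "l + m = 1"
  shows "(l * a + m * b) powr p \<le> l * a powr p + m * b powr p"
proof -
  have le: "(k * x) powr p \<le> k * x powr p" if "0 \<le> k" "k \<le> 1" "0 \<le> x" for k x :: real
  proof -
    have "k powr p \<le> k"
      using powr_mono'[of 1 p k] that assms(1) by (cases "k = 0") auto
    then show ?thesis using that by (simp add: powr_mult mult_right_mono)
  qed
  consider "a = 0" | "b = 0" | "a > 0" "b > 0" using assms by linarith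
  then show ?thesis
  proof cases
    case 3
    have l: "l = 1 - m" using assms by simp
    show ?thesis
      using convex_onD[OF powr_convex[OF assms(1)], of m a b] assms 3 unfolding l by simp
  qed (use le assms in auto)
qed

locale Lp_space =
  fixes p :: real
  assumes p1: "1 \<le> p"
begin

lemma Lp_norm_powr:
  "u \<in> Lp p \<Longrightarrow> Lp_norm p u powr p = (LINT t|unit_meas. norm (rep u t) powr p)"
  using p1 by (simp add: Lp_norm_def powr_powr)

lemma Lp_cls_dominated:
  assumes [measurable]: "meas f" and g: "g \<in> Lp p" and "0 \<le> C"
    and le: "AE t in unit_meas. norm (f t) \<le> C * norm (rep g t)"
  shows "cls f \<in> Lp p" "Lp_norm p (cls f) \<le> C * Lp_norm p g"
proof -
  have int: "integrable unit_meas (\<lambda>t. C powr p * norm (rep g t) powr p)"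
    using g by (simp add: Lp_def)
  have le': "AE t in unit_meas. norm (f t) powr p \<le> C powr p * norm (rep g t) powr p"
    using le
  proof eventually_elim
    case (elim t)
    then have "norm (f t) powr p \<le> (C * norm (rep g t)) powr p" using p1 by (intro powr_mono2) auto
    then show ?case using \<open>0 \<le> C\<close> by (simp add: powr_mult)
  qed
  have int_f: "integrable unit_meas (\<lambda>t. norm (f t) powr p)"
    by (rule Bochner_Integration.integrable_bound[OF int]) (use le' in auto)
  then show f: "cls f \<in> Lp p" by (simp add: Lp_cls)
  have "(LINT t|unit_meas. norm (f t) powr p) \<le> (LINT t|unit_meas. C powr p * norm (rep g t) powr p)"
    by (rule integral_mono_AE[OF int_f int le'])
  also have "\<dots> = (C * Lp_norm p g) powr p"
    using \<open>0 \<le> C\<close> g by (simp add: powr_mult Lp_norm_powr Lp_norm_nonneg)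
  finally have "(LINT t|unit_meas. norm (f t) powr p) powr (1/p) \<le> ((C * Lp_norm p g) powr p) powr (1/p)"
    using p1 by (intro powr_mono2) (auto intro!: integral_nonneg_AE)
  then show "Lp_norm p (cls f) \<le> C * Lp_norm p g"
    using \<open>0 \<le> C\<close> p1 by (simp add: Lp_norm_cls powr_powr Lp_norm_nonneg)
qed

lemma Lp_bounded:
  assumes [measurable]: "meas f" and B: "\<And>t. 0 \<le> t \<Longrightarrow> t \<le> 1 \<Longrightarrow> norm (f t) \<le> B"
  shows "cls f \<in> Lp p" "Lp_norm p (cls f) \<le> B"
proof -
  interpret finite_measure unit_meas by (rule finite_measure_unit_meas)
  have "B \<ge> 0" using order_trans[OF norm_ge_zero B[of 0]] by simp
  have "meas (\<lambda>_. 1)" by simp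
  \<comment> \<open>The interval has measure 1, so the constant 1 has norm 1 and domination by
    \<open>B\<close> times it gives the bound \<open>B\<close> with no volume factor.\<close>
  have 1: "cls (\<lambda>_. 1) \<in> Lp p" "Lp_norm p (cls (\<lambda>_. 1)) = 1"
    by (simp_all add: Lp_cls Lp_norm_cls measure_unit_meas)
  have "AE t in unit_meas. norm (f t) \<le> B * norm (rep (cls (\<lambda>_. 1)) t)"
    using rep_cls[OF \<open>meas (\<lambda>_. 1)\<close>] AE_space by eventually_elim (use B in auto)
  from Lp_cls_dominated[OF assms(1) 1(1) \<open>B \<ge> 0\<close> this] 1
  show "cls f \<in> Lp p" "Lp_norm p (cls f) \<le> B" by auto
qed

text \<open>Precedes the triangle inequality, whose proof needs the \<open>p\<close>-th power of the
  sum to be integrable. For that a crude bound with the factor \<open>2 powr p\<close> is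
  enough.\<close>

lemma Lp_add:
  assumes "u \<in> Lp p" "v \<in> Lp p" shows "u + v \<in> Lp p"
proof -
  have "u + v = cls (\<lambda>t. rep u t + rep v t)" using cls_add[of "rep u" "rep v"] by simp
  moreover have "integrable unit_meas (\<lambda>t. norm (rep u t + rep v t) powr p)"
  proof (rule Bochner_Integration.integrable_bound)
    show "integrable unit_meas (\<lambda>t. 2 powr p * (norm (rep u t) powr p + norm (rep v t) powr p))"
      using assms by (simp add: Lp_def)
    show "AE t in unit_meas. norm (norm (rep u t + rep v t) powr p) \<le>
      norm (2 powr p * (norm (rep u t) powr p + norm (rep v t) powr p))"
    proof (rule AE_I2)
      fix t
      let ?a = "norm (rep u t)" and ?b = "norm (rep v t)"
      have "norm (rep u t + rep v t) powr p \<le> (2 * max ?a ?b) powr p"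
        using p1 norm_triangle_ineq[of "rep u t" "rep v t"] by (intro powr_mono2) auto
      also have "\<dots> = 2 powr p * max ?a ?b powr p" by (simp add: powr_mult)
      also have "max ?a ?b powr p \<le> ?a powr p + ?b powr p" by (auto simp: max_def)
      finally show "norm (norm (rep u t + rep v t) powr p) \<le> norm (2 powr p * (?a powr p + ?b powr p))"
        by simp
    qed
  qed measurable
  ultimately show ?thesis by (simp add: Lp_cls)
qed

lemma Lp_norm_scaleR: "Lp_norm p (c *\<^sub>R u) = \<bar>c\<bar> * Lp_norm p u"
proof -
  have "c *\<^sub>R u = cls (\<lambda>t. c *\<^sub>R rep u t)" using cls_scaleR[of "rep u" c] by simp
  then have "Lp_norm p (c *\<^sub>R u) = (\<bar>c\<bar> powr p * (LINT t|unit_meas. norm (rep u t) powr p)) powr (1/p)"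
    by (simp add: Lp_norm_cls powr_mult)
  also have "\<dots> = \<bar>c\<bar> * Lp_norm p u"
    using p1 by (simp add: powr_mult Lp_norm_def integral_nonneg_AE powr_powr)
  finally show ?thesis .
qed

lemma Lp_scaleR:
  assumes "u \<in> Lp p" shows "c *\<^sub>R u \<in> Lp p"
proof -
  have "c *\<^sub>R u = cls (\<lambda>t. c *\<^sub>R rep u t)" using cls_scaleR[of "rep u" c] by simp
  then show ?thesis using assms by (simp add: Lp_cls powr_mult) (simp add: Lp_def)
qed

lemma zero_in_Lp: "0 \<in> Lp p"
  using p1 by (simp add: Lp_cls cls_0[symmetric])

lemma Lp_norm_eq_0:
  assumes "u \<in> Lp p" "Lp_norm p u = 0" shows "u = 0"
proof -
  have "(LINT t|unit_meas. norm (rep u t) powr p) = 0"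
    using Lp_norm_powr[OF assms(1)] assms(2) by simp
  then have "AE t in unit_meas. norm (rep u t) powr p = 0"
    using assms(1) by (subst (asm) integral_nonneg_eq_0_iff_AE) (auto simp: Lp_def)
  then have "AE t in unit_meas. rep u t = 0" by eventually_elim simp
  then have "cls (rep u) = cls (\<lambda>_. 0)" by (intro cls_eqI) auto
  then show ?thesis by (simp add: cls_0)
qed

text \<open>With \<open>A\<close> and \<open>B\<close> the norms of \<open>u\<close> and \<open>v\<close>, integrate the convexity inequality for the
  convex combination of \<open>\<bar>u\<bar> / A\<close> and \<open>\<bar>v\<bar> / B\<close> with weights \<open>A / (A + B)\<close> and \<open>B / (A + B)\<close>.\<close>

lemma Minkowski:
  assumes u: "u \<in> Lp p" and v: "v \<in> Lp p"
  shows "Lp_norm p (u + v) \<le> Lp_norm p u + Lp_norm p v"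
proof (cases "Lp_norm p u = 0 \<or> Lp_norm p v = 0")
  case True
  then show ?thesis using Lp_norm_eq_0 u v Lp_norm_nonneg by fastforce
next
  case False
  define A B where "A = Lp_norm p u" and "B = Lp_norm p v"
  have pos: "A > 0" "B > 0" using False Lp_norm_nonneg[of p u] Lp_norm_nonneg[of p v]
    by (auto simp: A_def B_def)
  define l m where "l = A / (A + B)" and "m = B / (A + B)"
  have lm: "l \<ge> 0" "m \<ge> 0" "l + m = 1" using pos by (auto simp: l_def m_def add_divide_distrib[symmetric])
  let ?f = "rep u" and ?g = "rep v"
  let ?h = "\<lambda>t. (A + B) powr p * (l * (norm (?f t) powr p / A powr p) + m * (norm (?g t) powr p / B powr p))"
  have int: "integrable unit_meas (\<lambda>t. norm (?f t) powr p)" "integrable unit_meas (\<lambda>t. norm (?g t) powr p)"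
    using u v by (auto simp: Lp_def)
  have uv: "u + v = cls (\<lambda>t. ?f t + ?g t)" using cls_add[of ?f ?g] by simp
  have "(LINT t|unit_meas. norm (?f t + ?g t) powr p) \<le> (LINT t|unit_meas. ?h t)"
  proof (rule integral_mono)
    show "integrable unit_meas (\<lambda>t. norm (?f t + ?g t) powr p)"
      using Lp_add[OF u v] by (simp add: uv Lp_cls)
    show "integrable unit_meas ?h"
      by (intro integrable_mult_right Bochner_Integration.integrable_add integrable_divide int)
    fix t
    have "norm (?f t + ?g t) powr p \<le> ((A + B) * (l * (norm (?f t) / A) + m * (norm (?g t) / B))) powr p"
    proof (rule powr_mono2)
      have "(A + B) * (l * (norm (?f t) / A) + m * (norm (?g t) / B)) = norm (?f t) + norm (?g t)"
        using pos by (simp add: l_def m_def divide_simps)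
      then show "norm (?f t + ?g t) \<le> (A + B) * (l * (norm (?f t) / A) + m * (norm (?g t) / B))"
        using norm_triangle_ineq by simp
    qed (use p1 in auto)
    also have "\<dots> = (A + B) powr p * (l * (norm (?f t) / A) + m * (norm (?g t) / B)) powr p"
      using pos lm by (simp add: powr_mult)
    also have "(l * (norm (?f t) / A) + m * (norm (?g t) / B)) powr p \<le>
        l * (norm (?f t) / A) powr p + m * (norm (?g t) / B) powr p"
      using p1 pos lm by (intro convex_powr_nonneg) auto
    finally show "norm (?f t + ?g t) powr p \<le> ?h t"
      using pos by (simp add: powr_divide mult_left_mono)
  qed
  also have "(LINT t|unit_meas. ?h t) = (A + B) powr p * (l * (A powr p / A powr p) + m * (B powr p / B powr p))"
    using int by (simp add: Lp_norm_powr[OF u, folded A_def] Lp_norm_powr[OF v, folded B_def])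
  also have "\<dots> = (A + B) powr p" using pos lm by simp
  finally have "(LINT t|unit_meas. norm (?f t + ?g t) powr p) powr (1/p) \<le> ((A + B) powr p) powr (1/p)"
    using p1 by (intro powr_mono2) (auto intro!: integral_nonneg_AE)
  then show ?thesis using p1 pos by (simp add: uv Lp_norm_cls powr_powr A_def B_def)
qed

lemma Lp_dominated_convergence:
  fixes F :: "nat \<Rightarrow> real \<Rightarrow> complex" and w :: "real \<Rightarrow> real"
  assumes [measurable]: "\<And>n. meas (F n)" and w: "integrable unit_meas w"
    and le: "\<And>n. AE t in unit_meas. norm (F n t) powr p \<le> w t"
    and lim: "AE t in unit_meas. (\<lambda>n. F n t) \<longlonglongrightarrow> 0"
  shows "cls (F n) \<in> Lp p" "(\<lambda>n. Lp_norm p (cls (F n))) \<longlonglongrightarrow> 0"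
proof -
  have lim': "AE t in unit_meas. (\<lambda>n. norm (F n t) powr p) \<longlonglongrightarrow> 0"
    using lim
  proof eventually_elim
    case (elim t)
    then have "(\<lambda>n. norm (F n t) powr p) \<longlonglongrightarrow> norm (0::complex) powr p"
      using p1 by (intro tendsto_powr' tendsto_norm tendsto_const) auto
    then show ?case using p1 by simp
  qed
  have le': "AE t in unit_meas. norm (norm (F n t) powr p) \<le> w t" for n using le by simp
  have meas': "(\<lambda>t. norm (F n t) powr p) \<in> borel_measurable unit_meas" for n by measurable
  show "cls (F n) \<in> Lp p"
    using integrable_dominated_convergence2[OF _ meas' w lim' le'] by (simp add: Lp_cls)
  have "(\<lambda>n. LINT t|unit_meas. norm (F n t) powr p) \<longlonglongrightarrow> (LINT t|unit_meas. 0)"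
    using integral_dominated_convergence[OF _ meas' w lim' le'] by simp
  then have "(\<lambda>n. (LINT t|unit_meas. norm (F n t) powr p) powr (1/p)) \<longlonglongrightarrow> 0 powr (1/p)"
    using p1 by (intro tendsto_powr' tendsto_const) (auto intro!: always_eventually integral_nonneg_AE)
  then show "(\<lambda>n. Lp_norm p (cls (F n))) \<longlonglongrightarrow> 0" using p1 by (simp add: Lp_norm_cls)
qed

lemma Lp_bounded_convergence:
  fixes F :: "nat \<Rightarrow> real \<Rightarrow> complex"
  assumes "\<And>n. meas (F n)" and B: "\<And>n t. 0 \<le> t \<Longrightarrow> t \<le> 1 \<Longrightarrow> norm (F n t) \<le> B"
    and lim: "AE t in unit_meas. (\<lambda>n. F n t) \<longlonglongrightarrow> 0"
  shows "(\<lambda>n. Lp_norm p (cls (F n))) \<longlonglongrightarrow> 0"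
proof (rule Lp_dominated_convergence(2)[OF assms(1)])
  interpret finite_measure unit_meas by (rule finite_measure_unit_meas)
  show "integrable unit_meas (\<lambda>_. B powr p)" by simp
  show "AE t in unit_meas. norm (F n t) powr p \<le> B powr p" for n
    using p1 B by (intro AE_I2 powr_mono2) auto
qed (rule lim)

lemma Lp_norm_sum:
  assumes "finite I" "\<And>i. i \<in> I \<Longrightarrow> f i \<in> Lp p"
  shows "sum f I \<in> Lp p" "Lp_norm p (sum f I) \<le> (\<Sum>i\<in>I. Lp_norm p (f i))"
proof -
  have "sum f I \<in> Lp p \<and> Lp_norm p (sum f I) \<le> (\<Sum>i\<in>I. Lp_norm p (f i))"
    using assms
  proof (induction I rule: finite_induct)
    case empty
    then show ?case using Lp_norm_scaleR[of 0 0] by (simp add: zero_in_Lp)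
  next
    case (insert i I)
    then show ?case using Minkowski[of "f i" "sum f I"] by (auto intro: Lp_add)
  qed
  then show "sum f I \<in> Lp p" "Lp_norm p (sum f I) \<le> (\<Sum>i\<in>I. Lp_norm p (f i))" by auto
qed

lemma cls_sum:
  assumes "finite I" "\<And>i. i \<in> I \<Longrightarrow> meas (f i)"
  shows "(\<Sum>i\<in>I. cls (f i)) = cls (\<lambda>t. \<Sum>i\<in>I. f i t)"
  using assms by (induction I rule: finite_induct) (auto simp: cls_0 cls_add borel_measurable_sum)

text \<open>The argument of Riesz and Fischer. The partial sums \<open>g n\<close> of absolute
  values have norm at most 2, so by monotone convergence their supremum has a finite
  \<open>p\<close>-th power integral. Hence the series converges absolutely almost everywhere, and
  this supremum dominates all its tails.\<close>

lemma Lp_complete: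
  fixes x :: "nat \<Rightarrow> l0"
  assumes x: "\<And>k. x k \<in> Lp p" and le: "\<And>k. Lp_norm p (x k) \<le> (1/3) ^ k"
  shows "\<exists>s\<in>Lp p. (\<lambda>n. Lp_norm p (s - (\<Sum>k<n. x k))) \<longlonglongrightarrow> 0"
proof -
  define f where "f k = rep (x k)" for k
  have [measurable]: "meas (f k)" for k by (simp add: f_def)
  define g where "g n t = (\<Sum>k<n. norm (f k t))" for n t
  have [measurable]: "g n \<in> borel_measurable unit_meas" for n unfolding g_def by measurable
  have g0: "g n t \<ge> 0" for n t by (simp add: g_def sum_nonneg)
  have gmono: "g m t \<le> g n t" if "m \<le> n" for m n t
    unfolding g_def using that by (intro sum_mono2) auto
  have absLp: "cls (\<lambda>t. complex_of_real (norm (f k t))) \<in> Lp p"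
    "Lp_norm p (cls (\<lambda>t. complex_of_real (norm (f k t)))) \<le> (1/3)^k" for k
    using x[of k] le[of k] by (simp_all add: Lp_cls Lp_norm_cls) (simp_all add: f_def Lp_def Lp_norm_def)
  have gLp: "integrable unit_meas (\<lambda>t. g n t powr p)" and gint: "(LINT t|unit_meas. g n t powr p) \<le> 2 powr p" for n
  proof -
    let ?G = "\<Sum>k<n. cls (\<lambda>t. complex_of_real (norm (f k t)))"
    have G: "?G = cls (\<lambda>t. complex_of_real (g n t))" by (subst cls_sum) (auto simp: g_def)
    have "Lp_norm p ?G \<le> (\<Sum>k<n. Lp_norm p (cls (\<lambda>t. complex_of_real (norm (f k t)))))"
      using absLp by (intro Lp_norm_sum) auto
    also have "\<dots> \<le> (\<Sum>k<n. (1/3)^k)" using absLp by (intro sum_mono) auto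
    also have "\<dots> \<le> 2"
      using zero_le_power[of "1/3 :: real" n] by (simp add: sum_gp_strict del: zero_le_power)
    finally have 2: "Lp_norm p ?G \<le> 2" .
    have GLp: "?G \<in> Lp p" using absLp by (intro Lp_norm_sum) auto
    show "integrable unit_meas (\<lambda>t. g n t powr p)"
      using GLp g0 by (simp add: G Lp_cls)
    have "(LINT t|unit_meas. g n t powr p) = Lp_norm p ?G powr p"
      using p1 g0 by (simp add: G Lp_norm_cls powr_powr integral_nonneg_AE)
    also have "\<dots> \<le> 2 powr p" using 2 p1 by (intro powr_mono2) (auto simp: Lp_norm_nonneg)
    finally show "(LINT t|unit_meas. g n t powr p) \<le> 2 powr p" .
  qed
  \<comment> \<open>In \<open>ennreal\<close> the supremum exists at every point. It is known to be
    finite only almost everywhere, where \<open>w\<close> is its real value.\<close>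
  define W where "W t = (SUP n. ennreal (g n t powr p))" for t
  have [measurable]: "W \<in> borel_measurable unit_meas" unfolding W_def by measurable
  have "(\<integral>\<^sup>+ t. W t \<partial>unit_meas) = (SUP n. \<integral>\<^sup>+ t. ennreal (g n t powr p) \<partial>unit_meas)"
    unfolding W_def using p1 g0 gmono
    by (intro nn_integral_monotone_convergence_SUP)
       (auto simp: incseq_def le_fun_def intro!: ennreal_leI powr_mono2)
  also have "\<dots> \<le> ennreal (2 powr p)"
  proof (rule SUP_least)
    fix n
    have "(\<integral>\<^sup>+ t. ennreal (g n t powr p) \<partial>unit_meas) = ennreal (LINT t|unit_meas. g n t powr p)"
      by (rule nn_integral_eq_integral[OF gLp]) auto
    then show "(\<integral>\<^sup>+ t. ennreal (g n t powr p) \<partial>unit_meas) \<le> ennreal (2 powr p)"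
      using gint by (simp add: ennreal_leI)
  qed
  finally have Wint: "(\<integral>\<^sup>+ t. W t \<partial>unit_meas) < \<infinity>" by (simp add: le_less_trans)
  then have Wfin: "AE t in unit_meas. W t \<noteq> \<infinity>"
    by (intro nn_integral_PInf_AE) auto
  define w where "w t = enn2real (W t)" for t
  have [measurable]: "w \<in> borel_measurable unit_meas" unfolding w_def by measurable
  have w: "integrable unit_meas w"
  proof (rule integrableI_nonneg)
    have "(\<integral>\<^sup>+ t. ennreal (w t) \<partial>unit_meas) = (\<integral>\<^sup>+ t. W t \<partial>unit_meas)"
    proof (rule nn_integral_cong_AE)
      show "AE t in unit_meas. ennreal (w t) = W t"
        using Wfin by eventually_elim (simp add: w_def ennreal_enn2real top.not_eq_extremum)
    qed
    then show "(\<integral>\<^sup>+ t. ennreal (w t) \<partial>unit_meas) < \<infinity>" using Wint by simp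
  qed (auto simp: w_def)
  have gw: "AE t in unit_meas. \<forall>n. g n t powr p \<le> w t"
    using Wfin
  proof eventually_elim
    case (elim t)
    have "ennreal (g n t powr p) \<le> W t" for n unfolding W_def by (intro SUP_upper) auto
    then have "enn2real (ennreal (g n t powr p)) \<le> enn2real (W t)" for n
      using elim by (intro enn2real_mono) (auto simp: top.not_eq_extremum)
    then show ?case by (simp add: w_def)
  qed
  define s where "s t = (\<Sum>k. f k t)" for t
  have [measurable]: "meas s" unfolding s_def by measurable
  have sumb: "AE t in unit_meas. (\<forall>n. norm (s t - (\<Sum>k<n. f k t)) powr p \<le> w t) \<and> (\<lambda>n. s t - (\<Sum>k<n. f k t)) \<longlonglongrightarrow> 0"
    using gw
  proof eventually_elim
    case (elim t)
    have w0: "w t \<ge> 0" by (simp add: w_def)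
    have gle: "g n t \<le> w t powr (1/p)" for n
    proof -
      have "(g n t powr p) powr (1/p) \<le> w t powr (1/p)" using elim p1 by (intro powr_mono2) auto
      then show ?thesis using p1 g0 by (simp add: powr_powr)
    qed
    have summ: "summable (\<lambda>k. norm (f k t))"
      by (rule summableI_nonneg_bounded[of _ "w t powr (1/p)"]) (use gle in \<open>auto simp: g_def\<close>)
    then have summ': "summable (\<lambda>k. f k t)" by (rule summable_norm_cancel)
    have "(\<lambda>n. s t - (\<Sum>k<n. f k t)) \<longlonglongrightarrow> s t - s t"
      using summable_LIMSEQ[OF summ'] by (intro tendsto_intros) (simp add: s_def)
    moreover have "norm (s t - (\<Sum>k<n. f k t)) powr p \<le> w t" for n
    proof -
      have "norm (s t - (\<Sum>k<n. f k t)) = norm (\<Sum>k. f (k + n) t)"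
        using suminf_split_initial_segment[OF summ', of n] by (simp add: s_def)
      also have "\<dots> \<le> (\<Sum>k. norm (f (k + n) t))"
        using summ by (intro summable_norm) (simp add: summable_iff_shift[of "\<lambda>k. norm (f k t)"])
      also have "\<dots> \<le> (\<Sum>k. norm (f k t))"
        using suminf_split_initial_segment[OF summ, of n] by (simp add: sum_nonneg)
      also have "\<dots> \<le> w t powr (1/p)"
        using gle by (intro suminf_le_const[OF summ]) (simp add: g_def)
      finally have "norm (s t - (\<Sum>k<n. f k t)) powr p \<le> (w t powr (1/p)) powr p"
        using p1 by (intro powr_mono2) auto
      then show ?thesis using p1 w0 by (simp add: powr_powr)
    qed
    ultimately show ?case by simp
  qed
  have diff: "cls s - (\<Sum>k<n. x k) = cls (\<lambda>t. s t - (\<Sum>k<n. f k t))" for n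
  proof -
    have "(\<Sum>k<n. x k) = (\<Sum>k<n. cls (f k))" by (simp add: f_def)
    also have "\<dots> = cls (\<lambda>t. \<Sum>k<n. f k t)" by (intro cls_sum) auto
    finally show ?thesis by (simp add: cls_diff)
  qed
  have dom: "AE t in unit_meas. norm (s t - (\<Sum>k<n. f k t)) powr p \<le> w t" for n
    using sumb by eventually_elim simp
  have lim: "AE t in unit_meas. (\<lambda>n. s t - (\<Sum>k<n. f k t)) \<longlonglongrightarrow> 0"
    using sumb by eventually_elim simp
  have "(\<lambda>n. Lp_norm p (cls s - (\<Sum>k<n. x k))) \<longlonglongrightarrow> 0"
    unfolding diff by (rule Lp_dominated_convergence(2)[OF _ w dom lim]) measurable
  \<comment> \<open>The tail after the empty partial sum is \<open>s\<close> itself, so the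
    membership part of dominated convergence yields \<open>cls s \<in> Lp p\<close>.\<close>
  moreover have "cls (\<lambda>t. s t - (\<Sum>k<0. f k t)) \<in> Lp p"
    by (rule Lp_dominated_convergence(1)[OF _ w dom lim]) measurable
  ultimately show ?thesis by auto
qed

sublocale banach_subspace "Lp p" "Lp_norm p"
proof
  show "subspace (Lp p)"
    by (auto simp: subspace_def zero_in_Lp Lp_add Lp_scaleR)
qed (auto simp: Lp_norm_eq_0 Minkowski Lp_norm_scaleR Lp_complete)

lemma cls_continuous_in_Lp:
  fixes g :: "real \<Rightarrow> complex"
  assumes "continuous_on {0..1} g"
  shows "meas g" "cls g \<in> Lp p"
proof -
  show m: "meas g"
    using assms by (intro continuous_imp_measurable_on_sets_lebesgue) auto
  obtain B where "\<forall>x\<in>{0..1}. norm (g x) \<le> B"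
    using compact_imp_bounded[OF compact_continuous_image[OF assms]] by (auto simp: bounded_iff)
  then show "cls g \<in> Lp p" using Lp_bounded(1)[OF m, of B] by auto
qed

text \<open>First cut off large values of \<open>u\<close> at a level \<open>m\<close>; then use
  that a measurable function is an almost everywhere limit of continuous ones. As these need not be
  uniformly bounded, their values are clipped to the disc of radius \<open>m\<close>, after which
  bounded convergence applies.\<close>

lemma continuous_dense:
  assumes u: "u \<in> Lp p" and e: "0 < e"
  obtains g where "continuous_on UNIV g" "Lp_norm p (cls g - u) < e"
proof -
  define f where "f m t = (if norm (rep u t) \<le> real m then rep u t else 0)" for m :: nat and t
  have [measurable]: "meas (f m)" for m unfolding f_def by measurable
  have "(\<lambda>m. Lp_norm p (cls (\<lambda>t. f m t - rep u t))) \<longlonglongrightarrow> 0"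
  proof (rule Lp_dominated_convergence(2))
    show "integrable unit_meas (\<lambda>t. norm (rep u t) powr p)" using u by (simp add: Lp_def)
    show "AE t in unit_meas. norm (f m t - rep u t) powr p \<le> norm (rep u t) powr p" for m
      by (auto simp: f_def)
    show "AE t in unit_meas. (\<lambda>m. f m t - rep u t) \<longlonglongrightarrow> 0"
    proof (rule AE_I2)
      fix t
      obtain k :: nat where "norm (rep u t) \<le> real k" using real_arch_simple by blast
      then have "\<forall>\<^sub>F m in sequentially. f m t - rep u t = 0"
        unfolding eventually_sequentially by (intro exI[of _ k]) (auto simp: f_def)
      then show "(\<lambda>m. f m t - rep u t) \<longlonglongrightarrow> 0" by (rule tendsto_eventually)
    qed
  qed measurable
  then obtain m0 where m0: "\<And>m. m \<ge> m0 \<Longrightarrow> Lp_norm p (cls (\<lambda>t. f m t - rep u t)) < e / 2"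
    using order_tendstoD(2)[of _ 0 sequentially "e / 2"] e by (auto simp: eventually_sequentially)
  \<comment> \<open>The successor makes the level positive, so that the clipping map
    \<open>c\<close> never divides by zero.\<close>
  define m where "m = Suc m0"
  have m: "Lp_norm p (cls (\<lambda>t. f m t - rep u t)) < e / 2" "real m > 0" using m0 by (auto simp: m_def)
  have fm: "norm (f m t) \<le> m" for t by (simp add: f_def)
  have "f m measurable_on {0..1}" by (simp add: measurable_on_iff_borel_measurable)
  then obtain Z g where Z: "negligible Z" and g: "\<And>n. continuous_on UNIV (g n)"
    and lim: "\<And>x. x \<notin> Z \<Longrightarrow> (\<lambda>n. g n x) \<longlonglongrightarrow> (if x \<in> {0..1} then f m x else 0)"
    by (auto simp: measurable_on_def)
  \<comment> \<open>The radial retraction onto the closed disc of radius \<open>m\<close>: it is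
    continuous and fixes the values of \<open>f m\<close>, so clipping does not disturb the
    limit.\<close>
  define c where "c z = (m / max m (norm z)) *\<^sub>R z" for z :: complex
  have c_cont: "continuous_on UNIV c" unfolding c_def using m(2) by (intro continuous_intros) auto
  have c_id: "c z = z" if "norm z \<le> m" for z using that m(2) by (simp add: c_def)
  have c_le: "norm (c z) \<le> m" for z using m(2) by (simp add: c_def max_def field_simps)
  define h where "h n t = c (g n t)" for n t
  have h_cont: "continuous_on UNIV (h n)" for n
    unfolding h_def by (rule continuous_on_compose2[OF c_cont g]) simp
  have [measurable]: "meas (h n)" for n
    using h_cont by (intro cls_continuous_in_Lp(1)) (auto intro: continuous_on_subset)
  have "(\<lambda>n. Lp_norm p (cls (\<lambda>t. h n t - f m t))) \<longlonglongrightarrow> 0"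
  proof (rule Lp_bounded_convergence)
    show "norm (h n t - f m t) \<le> 2 * real m" for n t
      using norm_triangle_ineq4[of "h n t" "f m t"] c_le[of "g n t"] fm[of t] by (simp add: h_def)
    have "AE t in lebesgue. t \<notin> Z" using Z
      by (intro AE_not_in) (simp add: negligible_iff_null_sets)
    then have "AE t in unit_meas. t \<notin> Z" by (auto simp: AE_restrict_space_iff elim: eventually_mono)
    then show "AE t in unit_meas. (\<lambda>n. h n t - f m t) \<longlonglongrightarrow> 0"
      using AE_space
    proof eventually_elim
      case (elim t)
      then have "(\<lambda>n. g n t) \<longlonglongrightarrow> f m t" using lim[of t] by simp
      then have "(\<lambda>n. c (g n t)) \<longlonglongrightarrow> c (f m t)"
        using c_cont by (auto simp: continuous_on_eq_continuous_at intro: isCont_tendsto_compose)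
      then show ?case using c_id[OF fm] by (simp add: h_def LIM_zero)
    qed
  qed measurable
  then obtain n where n: "Lp_norm p (cls (\<lambda>t. h n t - f m t)) < e / 2"
    using order_tendstoD(2)[of _ 0 sequentially "e / 2"] e by (auto simp: eventually_sequentially)
  have hL: "cls (h n) \<in> Lp p"
    using h_cont by (intro cls_continuous_in_Lp(2)) (auto intro: continuous_on_subset)
  have fL: "cls (f m) \<in> Lp p" using fm by (intro Lp_bounded(1)) auto
  have "Lp_norm p (cls (h n) - u) \<le> Lp_norm p (cls (h n) - cls (f m)) + Lp_norm p (cls (f m) - cls (rep u))"
    using N_triangle[OF hL fL u] by simp
  also have "\<dots> = Lp_norm p (cls (\<lambda>t. h n t - f m t)) + Lp_norm p (cls (\<lambda>t. f m t - rep u t))"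
    by (simp add: cls_diff del: cls_rep)
  also have "\<dots> < e / 2 + e / 2" using m n by (intro add_strict_mono)
  finally show ?thesis using that[OF h_cont] by simp
qed

text \<open>After scaling \<open>u\<close> to norm 1, integrate \<open>a \<le> 1 + a powr p\<close>.
  This is where the constant 2 comes from; the bound will turn convergence of functions in
  \<open>Lp p\<close> into uniform convergence of their primitives.\<close>

lemma Lp_subset_L1:
  assumes u: "u \<in> Lp p"
  shows "integrable unit_meas (rep u)" "u \<in> Lp 1" "Lp_norm 1 u \<le> 2 * Lp_norm p u"
proof -
  interpret finite_measure unit_meas by (rule finite_measure_unit_meas)
  have le: "a \<le> 1 + a powr p" if "0 \<le> a" for a :: real
  proof (cases "a \<le> 1")
    case False
    then show ?thesis using powr_mono[of 1 p a] p1 by simp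
  qed (use that in \<open>simp add: add_increasing2\<close>)
  have int: "integrable unit_meas (\<lambda>t. norm (rep u t) powr p)" using u by (simp add: Lp_def)
  show i: "integrable unit_meas (rep u)"
    by (rule Bochner_Integration.integrable_bound[of _ "\<lambda>t. 1 + norm (rep u t) powr p"])
      (use int le in \<open>auto\<close>)
  show "u \<in> Lp 1" using i by (simp add: Lp_def)
  show "Lp_norm 1 u \<le> 2 * Lp_norm p u"
  proof (cases "Lp_norm p u = 0")
    case True
    then show ?thesis using Lp_norm_eq_0[OF u] by (simp add: cls_0[symmetric] Lp_norm_cls)
  next
    case False
    define A where "A = Lp_norm p u"
    have A: "A > 0" using False Lp_norm_nonneg[of p u] by (simp add: A_def)
    have "(LINT t|unit_meas. norm (rep u t) / A) \<le> (LINT t|unit_meas. 1 + norm (rep u t) powr p / A powr p)"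
    proof (rule integral_mono)
      fix t
      show "norm (rep u t) / A \<le> 1 + norm (rep u t) powr p / A powr p"
        using le[of "norm (rep u t) / A"] A by (simp add: powr_divide)
    qed (use i int in auto)
    also have "\<dots> = 1 + A powr p / A powr p"
      using int Lp_norm_powr[OF u, folded A_def] by (simp add: measure_unit_meas)
    finally have "(LINT t|unit_meas. norm (rep u t)) / A \<le> 2" using A by simp
    then have "Lp_norm 1 u \<le> 2 * A" using A by (simp add: Lp_norm_def integral_nonneg_AE field_simps)
    then show ?thesis by (simp add: A_def)
  qed
qed

end

subsection \<open>Weighted shifts\<close>

definition zero_ext :: "(real \<Rightarrow> complex) \<Rightarrow> real \<Rightarrow> complex"
  where "zero_ext f t = (if t \<in> {0..1} then f t else 0)"

text \<open>One family for plain shifts (weight 1), multiplication operators (\<open>s = 0\<close>)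
  and, by closure under composition, the whole product. The difference of two members with equal
  \<open>s\<close> belongs to it as well, so norm estimates become supremum bounds on
  weights.\<close>

definition wshift :: "(real \<Rightarrow> complex) \<Rightarrow> real \<Rightarrow> l0 \<Rightarrow> l0"
  where "wshift a s u = cls (\<lambda>t. a t * zero_ext (rep u) (t - s))"

lemma zero_ext_simps [simp]:
  "0 \<le> t \<Longrightarrow> t \<le> 1 \<Longrightarrow> zero_ext f t = f t" "t < 0 \<Longrightarrow> zero_ext f t = 0" "1 < t \<Longrightarrow> zero_ext f t = 0"
  by (auto simp: zero_ext_def)

lemma translation_measurable: "(\<lambda>t::real. t - s) \<in> lebesgue \<rightarrow>\<^sub>M lebesgue"
  using lebesgue_affine_measurable[of "\<lambda>_::real. 1" "- s"] by simp

lemma distr_translation: "distr lebesgue lebesgue (\<lambda>t::real. t - s) = lebesgue"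
  using lebesgue_real_affine[of 1 "- s"] by (simp add: density_1)

lemma zero_ext_measurable:
  assumes "meas f" shows "zero_ext f \<in> borel_measurable lebesgue"
  unfolding zero_ext_def using borel_measurable_if[of "{0..1::real}" f] assms by simp

lemma zero_ext_shift_measurable:
  assumes "meas f" shows "meas (\<lambda>t. zero_ext f (t - s))"
  by (rule measurable_restrict_space1)
    (rule measurable_compose[OF translation_measurable zero_ext_measurable[OF assms]])

lemma wshift_measurable [simp]: "meas a \<Longrightarrow> meas f \<Longrightarrow> meas (\<lambda>t. a t * zero_ext f (t - s))"
  by (intro borel_measurable_times zero_ext_shift_measurable)

text \<open>Translation preserves Lebesgue measure on the line, hence null sets; this is what makes
  a weighted shift independent of the chosen representative.\<close>

lemma zero_ext_shift_AE:
  assumes "meas f" "meas g" "AE t in unit_meas. f t = g t"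
  shows "AE t in unit_meas. zero_ext f (t - s) = zero_ext g (t - s)"
proof -
  have "AE t in lebesgue. t \<in> {0..1} \<longrightarrow> f t = g t"
    using assms(3) by (subst (asm) AE_restrict_space_iff) auto
  then have "AE t in distr lebesgue lebesgue (\<lambda>t::real. t - s). zero_ext f t = zero_ext g t"
    unfolding distr_translation by eventually_elim (simp add: zero_ext_def)
  then have "AE t in lebesgue. zero_ext f (t - s) = zero_ext g (t - s)"
    using AE_distrD[OF translation_measurable] by blast
  then show ?thesis by (auto simp: AE_restrict_space_iff elim: eventually_mono)
qed

lemma wshift_cls:
  assumes [measurable]: "meas a" "meas f"
  shows "wshift a s (cls f) = cls (\<lambda>t. a t * zero_ext f (t - s))"
  unfolding wshift_def
proof (rule cls_eqI)
  show "AE t in unit_meas. a t * zero_ext (rep (cls f)) (t - s) = a t * zero_ext f (t - s)"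
    using zero_ext_shift_AE[OF rep_measurable assms(2) rep_cls[OF assms(2)], of s] by eventually_elim simp
qed (use assms in simp_all)

text \<open>Below \<open>s\<close> the shifted zero extension vanishes, so the weight is felt only
  on \<open>[s, 1]\<close>.\<close>

lemma wshift_cong:
  assumes "meas a" "\<And>t. s \<le> t \<Longrightarrow> t \<le> 1 \<Longrightarrow> a t = b t"
  shows "wshift a s u = wshift b s u"
  unfolding wshift_def
proof (rule cls_cong)
  show "meas (\<lambda>t. a t * zero_ext (rep u) (t - s))"
    using assms by simp
  fix t :: real assume "t \<le> 1"
  then show "a t * zero_ext (rep u) (t - s) = b t * zero_ext (rep u) (t - s)"
    using assms(2)[of t] by (cases "s \<le> t") auto
qed

lemma wshift_0: "wshift (\<lambda>_. 1) 0 u = u"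
proof -
  have "wshift (\<lambda>_. 1) 0 u = cls (rep u)"
    unfolding wshift_def by (rule sym, rule cls_cong) auto
  then show ?thesis by simp
qed

lemma wshift_0_eq_mult_op:
  assumes "meas a" shows "wshift a 0 u = mult_op a u"
  unfolding wshift_def mult_op_def by (rule sym, rule cls_cong) (use assms in auto)

lemma wshift_add:
  assumes "meas a"
  shows "wshift a s (u + v) = wshift a s u + wshift a s v"
proof -
  note [simp] = assms
  have "u + v = cls (\<lambda>t. rep u t + rep v t)" using cls_add[of "rep u" "rep v"] by simp
  then have "wshift a s (u + v) = cls (\<lambda>t. a t * zero_ext (\<lambda>t. rep u t + rep v t) (t - s))"
    by (simp add: wshift_cls)
  also have "\<dots> = cls (\<lambda>t. a t * zero_ext (rep u) (t - s) + a t * zero_ext (rep v) (t - s))"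
    by (rule cls_cong) (simp, simp add: zero_ext_def algebra_simps)
  also have "\<dots> = wshift a s u + wshift a s v"
    by (simp add: wshift_def cls_add)
  finally show ?thesis .
qed

lemma wshift_mult_const:
  assumes "meas a"
  shows "wshift a s (mult_op (\<lambda>_. c) u) = mult_op (\<lambda>_. c) (wshift a s u)"
proof -
  note [simp] = assms
  have "mult_op (\<lambda>_. c) u = cls (\<lambda>t. c * rep u t)" by (simp add: mult_op_def)
  then have "wshift a s (mult_op (\<lambda>_. c) u) = cls (\<lambda>t. a t * zero_ext (\<lambda>t. c * rep u t) (t - s))"
    by (simp add: wshift_cls)
  also have "\<dots> = cls (\<lambda>t. c * (a t * zero_ext (rep u) (t - s)))"
    by (rule cls_cong) (simp, simp add: zero_ext_def)
  also have "\<dots> = mult_op (\<lambda>_. c) (wshift a s u)"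
    by (simp add: wshift_def mult_op_cls)
  finally show ?thesis .
qed

lemma mult_op_wshift:
  assumes "meas a" "meas b"
  shows "mult_op b (wshift a s u) = wshift (\<lambda>t. b t * a t) s u"
  unfolding wshift_def using assms by (subst mult_op_cls) (simp_all add: mult.assoc)

lemma wshift_weight_diff:
  assumes "meas a" "meas b"
  shows "wshift a s u - wshift b s u = wshift (\<lambda>t. a t - b t) s u"
  unfolding wshift_def using assms by (subst cls_diff) (simp_all add: left_diff_distrib)

lemma wshift_wshift:
  assumes "meas a" "meas b" "0 \<le> s" "0 \<le> r"
  shows "wshift a s (wshift b r u) = wshift (\<lambda>t. a t * zero_ext b (t - s)) (s + r) u"
proof -
  note [simp] = assms(1,2)
  have "wshift a s (wshift b r u) = cls (\<lambda>t. a t * zero_ext (\<lambda>t. b t * zero_ext (rep u) (t - r)) (t - s))"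
    unfolding wshift_def[of b] by (rule wshift_cls) auto
  also have "\<dots> = cls (\<lambda>t. a t * zero_ext b (t - s) * zero_ext (rep u) (t - (s + r)))"
    using assms(3,4) by (intro cls_cong) (simp, auto simp: zero_ext_def algebra_simps)
  finally show ?thesis by (simp add: wshift_def)
qed

context Lp_space
begin

text \<open>On the whole line the zero extension keeps its integral under translation, and
  restricting back to [0,1] can only lose mass. The weight then contributes the factor
  \<open>C\<close>.\<close>

lemma wshift_bounded:
  assumes a: "meas a" and s: "0 \<le> s" and "0 \<le> C"
    and C: "\<And>t. s \<le> t \<Longrightarrow> t \<le> 1 \<Longrightarrow> norm (a t) \<le> C" and u: "u \<in> Lp p"
  shows "wshift a s u \<in> Lp p" "Lp_norm p (wshift a s u) \<le> C * Lp_norm p u"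
proof -
  define G where "G t = norm (zero_ext (rep u) t) powr p" for t
  have G: "G = (\<lambda>t. indicator {0..1} t *\<^sub>R (norm (rep u t) powr p))"
    using p1 by (auto simp: G_def zero_ext_def fun_eq_iff indicator_def)
  have int: "integrable lebesgue G" "integral\<^sup>L lebesgue G = (LINT t|unit_meas. norm (rep u t) powr p)"
    using u unfolding G Lp_def
    by (simp_all add: integrable_restrict_space integral_restrict_space)
  have Gm: "G \<in> borel_measurable lebesgue" using int(1) by simp
  have int_s: "integrable lebesgue (\<lambda>t. G (t - s))" "integral\<^sup>L lebesgue (\<lambda>t. G (t - s)) = integral\<^sup>L lebesgue G"
    using int(1) integrable_distr_eq[OF translation_measurable Gm, of s]
      integral_distr[OF translation_measurable Gm, of s] by (simp_all add: distr_translation)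
  have ind: "integrable lebesgue (\<lambda>t. indicator {0..1} t *\<^sub>R G (t - s))"
    using int_s(1) by (rule integrable_mult_indicator[rotated]) simp
  have shm: "meas (\<lambda>t. zero_ext (rep u) (t - s))" by (simp add: zero_ext_shift_measurable)
  define v where "v = cls (\<lambda>t. zero_ext (rep u) (t - s))"
  have "integrable unit_meas (\<lambda>t. G (t - s))"
    using ind by (simp add: integrable_restrict_space)
  then have v: "v \<in> Lp p" by (simp add: v_def Lp_cls[OF shm] G_def)
  have "(LINT t|unit_meas. G (t - s)) = (LINT t|lebesgue. indicator {0..1} t *\<^sub>R G (t - s))"
    by (simp add: integral_restrict_space)
  also have "\<dots> \<le> (LINT t|lebesgue. G (t - s))"
    by (rule integral_mono[OF ind int_s(1)]) (auto simp: indicator_def G_def)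
  finally have le: "(LINT t|unit_meas. G (t - s)) \<le> (LINT t|unit_meas. norm (rep u t) powr p)"
    using int_s int by simp
  have "Lp_norm p v \<le> Lp_norm p u"
    unfolding v_def Lp_norm_cls[OF shm] Lp_norm_def[of p u]
    using le p1 by (intro powr_mono2) (auto simp: G_def intro!: integral_nonneg_AE)
  then have Cv: "C * Lp_norm p v \<le> C * Lp_norm p u" using \<open>0 \<le> C\<close> by (rule mult_left_mono)
  have "AE t in unit_meas. norm (a t * zero_ext (rep u) (t - s)) \<le> C * norm (rep v t)"
    using rep_cls[OF shm, folded v_def] AE_space
  proof eventually_elim
    case (elim t)
    show ?case
    proof (cases "s \<le> t")
      case True
      then show ?thesis using C[of t] elim by (simp add: norm_mult mult_right_mono)
    qed (use \<open>0 \<le> C\<close> in auto)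
  qed
  from Lp_cls_dominated[OF _ v \<open>0 \<le> C\<close> this] Cv
  show "wshift a s u \<in> Lp p" "Lp_norm p (wshift a s u) \<le> C * Lp_norm p u"
    using a shm by (auto simp: wshift_def)
qed

lemma bounded_op_wshift:
  assumes "meas a" "0 \<le> s" "\<And>t. s \<le> t \<Longrightarrow> t \<le> 1 \<Longrightarrow> norm (a t) \<le> C" "0 \<le> C"
  shows "bounded_op p (wshift a s)"
  unfolding bounded_op_def
proof (intro conjI ballI allI exI[of _ C])
  fix u assume "u \<in> Lp p"
  then show "wshift a s u \<in> Lp p" "Lp_norm p (wshift a s u) \<le> C * Lp_norm p u"
    using wshift_bounded[OF assms(1,2,4,3)] by blast+
qed (use wshift_add wshift_mult_const assms(1) in auto)

lemma bounded_op_imp_bl_op: "bounded_op p T \<Longrightarrow> bl_op T"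
  by (simp add: bounded_op_def bl_op_def flip: mult_op_const)

lemma C0_semigroup_imp_semigr: "C0_semigroup p T \<Longrightarrow> semigr T"
  by (simp add: C0_semigroup_def semigr_def bounded_op_imp_bl_op)

lemma right_deriv_at_0_eq: "right_deriv_at_0 p = rderiv"
  by (simp add: fun_eq_iff right_deriv_at_0_def rderiv_def)

text \<open>The pointwise limit is asked for \<open>t > 0\<close> only: at \<open>t = 0\<close>
  every zero extension shifted by a positive \<open>\<tau>\<close> vanishes, whatever the function
  is there. That point is a null set.\<close>

lemma bounded_convergence_at_right:
  fixes F :: "real \<Rightarrow> real \<Rightarrow> complex"
  assumes m: "\<And>\<tau>. 0 < \<tau> \<Longrightarrow> \<tau> < 1 \<Longrightarrow> meas (F \<tau>)"
    and B: "\<And>\<tau> t. 0 < \<tau> \<Longrightarrow> \<tau> < 1 \<Longrightarrow> 0 \<le> t \<Longrightarrow> t \<le> 1 \<Longrightarrow> norm (F \<tau> t) \<le> B"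
    and lim: "\<And>t. 0 < t \<Longrightarrow> t \<le> 1 \<Longrightarrow> ((\<lambda>\<tau>. F \<tau> t) \<longlongrightarrow> 0) (at_right 0)"
  shows "((\<lambda>\<tau>. Lp_norm p (cls (F \<tau>))) \<longlongrightarrow> 0) (at_right 0)"
proof (rule tendsto_at_right_sequentially)
  fix S :: "nat \<Rightarrow> real"
  assume S: "\<And>n. 0 < S n" "\<And>n. S n < 1" "S \<longlonglongrightarrow> 0"
  show "(\<lambda>n. Lp_norm p (cls (F (S n)))) \<longlonglongrightarrow> 0"
  proof (rule Lp_bounded_convergence)
    have "filterlim S (at_right 0) sequentially"
      by (intro tendsto_imp_filterlim_at_right always_eventually) (use S in auto)
    then have lim': "(\<lambda>n. F (S n) t) \<longlonglongrightarrow> 0" if "0 < t" "t \<le> 1" for t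
      using filterlim_compose[OF lim[OF that]] by blast
    have "AE t in lebesgue. t \<notin> {0::real}"
      by (rule AE_not_in) (simp add: null_sets_def)
    then have "AE t in lebesgue. t \<in> {0..1} \<longrightarrow> (\<lambda>n. F (S n) t) \<longlonglongrightarrow> 0"
      by eventually_elim (use lim' in force)
    then show "AE t in unit_meas. (\<lambda>n. F (S n) t) \<longlonglongrightarrow> 0"
      by (simp add: AE_restrict_space_iff)
    show "meas (F (S n))" for n using S m by blast
    show "norm (F (S n) t) \<le> B" if "0 \<le> t" "t \<le> 1" for n t using S B that by blast
  qed
qed simp

end

section \<open>Damped shift semigroups\<close>

locale damping = Lp_space +
  fixes R :: "real \<Rightarrow> real"
  assumes R_cont: "continuous_on UNIV R" and R_mono: "mono R"
begin

text \<open>With \<open>R\<close> a primitive of the damping rate, this is the exponential of minus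
  the integral of the rate over \<open>[t - \<tau>, t]\<close>. Monotonicity of \<open>R\<close>
  keeps it at most 1, and \<open>R = 0\<close> gives the plain shift.\<close>

definition weight :: "real \<Rightarrow> real \<Rightarrow> complex"
  where "weight \<tau> t = complex_of_real (exp (R (t - \<tau>) - R t))"

definition dshift :: "real \<Rightarrow> l0 \<Rightarrow> l0"
  where "dshift \<tau> = wshift (weight \<tau>) \<tau>"

lemma R_cont': "continuous_on S g \<Longrightarrow> continuous_on S (\<lambda>t. R (g t))"
  using continuous_on_compose2[OF R_cont] by blast

lemma weight_cont: "continuous_on S (weight \<tau>)"
  unfolding weight_def by (intro continuous_intros R_cont')

lemma weight_measurable [simp]: "meas (weight \<tau>)"
  by (rule cls_continuous_in_Lp(1)[OF weight_cont])

lemma weight_le_1: "0 \<le> \<tau> \<Longrightarrow> norm (weight \<tau> t) \<le> 1"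
  using R_mono by (simp add: weight_def monoD)

lemma dshift_V [simp]: "0 \<le> \<tau> \<Longrightarrow> u \<in> Lp p \<Longrightarrow> dshift \<tau> u \<in> Lp p"
  unfolding dshift_def by (rule wshift_bounded(1)[of _ _ 1]) (auto simp: weight_le_1)

lemma dshift_contraction: "0 \<le> \<tau> \<Longrightarrow> u \<in> Lp p \<Longrightarrow> Lp_norm p (dshift \<tau> u) \<le> Lp_norm p u"
  unfolding dshift_def using wshift_bounded(2)[of "weight \<tau>" \<tau> 1 u] by (auto simp: weight_le_1)

lemma bounded_op_dshift: "0 \<le> \<tau> \<Longrightarrow> bounded_op p (dshift \<tau>)"
  unfolding dshift_def by (rule bounded_op_wshift[of _ _ 1]) (auto simp: weight_le_1)

text \<open>For a continuous function the damped shifts stay bounded and converge at every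
  \<open>t > 0\<close>. Density gives the rest, since contractivity makes the approximation error
  independent of \<open>\<tau>\<close>.\<close>

lemma dshift_tendsto:
  assumes u: "u \<in> Lp p"
  shows "((\<lambda>\<tau>. Lp_norm p (dshift \<tau> u - u)) \<longlongrightarrow> 0) (at_right 0)"
proof -
  have cont: "((\<lambda>\<tau>. Lp_norm p (dshift \<tau> (cls g) - cls g)) \<longlongrightarrow> 0) (at_right 0)"
    if g: "continuous_on UNIV g" for g
  proof -
    have g': "continuous_on {0..1} g" using g continuous_on_subset by blast
    note [simp] = cls_continuous_in_Lp(1)[OF g']
    obtain B where "\<forall>x\<in>{0..1}. norm (g x) \<le> B"
      using compact_imp_bounded[OF compact_continuous_image[OF g']] by (auto simp: bounded_iff)
    then have B: "norm (g t) \<le> B" if "0 \<le> t" "t \<le> 1" for t using that by simp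
    have B0: "B \<ge> 0" using order_trans[OF norm_ge_zero B[of 0]] by simp
    have eq: "dshift \<tau> (cls g) - cls g = cls (\<lambda>t. weight \<tau> t * zero_ext g (t - \<tau>) - g t)" for \<tau>
      by (simp add: dshift_def wshift_cls cls_diff)
    show ?thesis unfolding eq
    proof (rule bounded_convergence_at_right)
      fix \<tau> t :: real assume *: "0 < \<tau>" "0 \<le> t" "t \<le> 1"
      have "norm (zero_ext g (t - \<tau>)) \<le> B" using B B0 by (auto simp: zero_ext_def)
      then have "norm (weight \<tau> t) * norm (zero_ext g (t - \<tau>)) \<le> 1 * B"
        using weight_le_1[of \<tau> t] * by (intro mult_mono) auto
      then show "norm (weight \<tau> t * zero_ext g (t - \<tau>) - g t) \<le> 2 * B"
        using norm_triangle_ineq4[of "weight \<tau> t * zero_ext g (t - \<tau>)" "g t"] B[of t] *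
        by (simp add: norm_mult)
    next
      fix t :: real assume t: "0 < t" "t \<le> 1"
      have "isCont g (t - 0)" "isCont R (t - 0)"
        using g R_cont by (auto simp: continuous_on_eq_continuous_at)
      then have "((\<lambda>\<tau>. complex_of_real (exp (R (t - \<tau>) - R t)) * g (t - \<tau>) - g t) \<longlongrightarrow>
          complex_of_real (exp (R (t - 0) - R t)) * g (t - 0) - g t) (at_right 0)"
        by (intro tendsto_intros isCont_tendsto_compose[of _ R] isCont_tendsto_compose[of _ g]) auto
      moreover have "\<forall>\<^sub>F \<tau> in at_right 0. complex_of_real (exp (R (t - \<tau>) - R t)) * g (t - \<tau>) - g t =
          weight \<tau> t * zero_ext g (t - \<tau>) - g t"
        unfolding eventually_at_right_field using t by (intro exI[of _ t]) (auto simp: weight_def)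
      ultimately show "((\<lambda>\<tau>. weight \<tau> t * zero_ext g (t - \<tau>) - g t) \<longlongrightarrow> 0) (at_right 0)"
        by (auto intro: Lim_transform_eventually)
    qed (intro borel_measurable_diff, simp_all)
  qed
  have "\<exists>d>0. \<forall>h. 0 < h \<longrightarrow> h < d \<longrightarrow> Lp_norm p (dshift h u - u) < e" if e: "e > 0" for e
  proof -
    have "e / 3 > 0" using e by simp
    then obtain g where g: "continuous_on UNIV g" "Lp_norm p (cls g - u) < e / 3"
      using continuous_dense[OF u] by blast
    have gL: "cls g \<in> Lp p" using g(1) by (intro cls_continuous_in_Lp) (auto intro: continuous_on_subset)
    obtain d where d: "d > 0" "\<And>h. 0 < h \<Longrightarrow> h < d \<Longrightarrow> Lp_norm p (dshift h (cls g) - cls g) < e / 3"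
    proof -
      have "\<forall>e>0. \<exists>d>0. \<forall>h. 0 < h \<longrightarrow> h < d \<longrightarrow> Lp_norm p (dshift h (cls g) - cls g) < e"
        using cont[OF g(1)] gL by (subst (asm) N_tendsto_0_at_right) auto
      then show ?thesis using that \<open>e / 3 > 0\<close> by blast
    qed
    have "Lp_norm p (dshift h u - u) < e" if h: "0 < h" "h < d" for h
    proof -
      have lin: "dshift h u - dshift h (cls g) = dshift h (u - cls g)"
        using bl_op_diff[OF bounded_op_imp_bl_op[OF bounded_op_dshift]] h u gL by simp
      have "Lp_norm p (dshift h u - u) \<le> Lp_norm p (dshift h u - dshift h (cls g)) + Lp_norm p (dshift h (cls g) - u)"
        using h u gL by (intro N_triangle) auto
      also have "Lp_norm p (dshift h (cls g) - u) \<le> Lp_norm p (dshift h (cls g) - cls g) + Lp_norm p (cls g - u)"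
        using h u gL by (intro N_triangle) auto
      also have "Lp_norm p (dshift h u - dshift h (cls g)) \<le> Lp_norm p (cls g - u)"
        unfolding lin using dshift_contraction[of h "u - cls g"] h u gL
        by (simp add: N_diff_commute)
      finally show ?thesis using d(2)[OF h] g(2) by simp
    qed
    with d(1) show ?thesis by blast
  qed
  then show ?thesis using u by (subst N_tendsto_0_at_right) auto
qed

lemma C0_semigroup_dshift: "C0_semigroup p dshift"
  unfolding C0_semigroup_def
proof (intro conjI allI impI ballI)
  fix u assume u: "u \<in> Lp p"
  show "((\<lambda>\<tau>. Lp_norm p (dshift \<tau> u - u)) \<longlongrightarrow> 0) (at_right 0)" using u by (rule dshift_tendsto)
  have "weight 0 = (\<lambda>_. 1)" by (simp add: weight_def fun_eq_iff)
  then show "dshift 0 u = u" by (simp add: dshift_def wshift_0)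
  fix \<sigma> \<tau> :: real assume \<sigma>\<tau>: "0 \<le> \<sigma>" "0 \<le> \<tau>"
  have "dshift \<sigma> (dshift \<tau> u) = wshift (\<lambda>t. weight \<sigma> t * zero_ext (weight \<tau>) (t - \<sigma>)) (\<sigma> + \<tau>) u"
    unfolding dshift_def using \<sigma>\<tau> by (intro wshift_wshift) auto
  \<comment> \<open>The exponents telescope at \<open>t - \<sigma>\<close>, and for \<open>t\<close>
    in \<open>[\<sigma> + \<tau>, 1]\<close> the zero extension leaves the inner weight
    unchanged.\<close>
  also have "\<dots> = wshift (weight (\<sigma> + \<tau>)) (\<sigma> + \<tau>) u"
    using \<sigma>\<tau> by (intro wshift_cong)
      (simp, simp add: weight_def mult_exp_exp algebra_simps flip: of_real_mult)
  finally show "dshift (\<sigma> + \<tau>) u = dshift \<sigma> (dshift \<tau> u)" by (simp add: dshift_def)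
qed (rule bounded_op_dshift)

end

subsection \<open>Primitives and weak derivatives\<close>

lemma continuous_integrable_unit:
  fixes f :: "real \<Rightarrow> 'b::euclidean_space"
  shows "continuous_on {0..1} f \<Longrightarrow> integrable unit_meas f"
  by (rule continuous_imp_integrable_real)

lemma antiderivative_exists:
  fixes f :: "real \<Rightarrow> 'b::euclidean_space"
  assumes "continuous_on UNIV f"
  obtains F where "\<And>x. (F has_vector_derivative f x) (at x)" "F 0 = 0"
proof -
  obtain G where G: "\<And>x. (G has_vector_derivative f x) (at x)"
    using einterval_antiderivative[of "-\<infinity>" "\<infinity>" f] assms
    by (auto simp: continuous_on_eq_continuous_at)
  have "((\<lambda>x. G x - G 0) has_vector_derivative f x) (at x)" for x
    by (auto intro!: derivative_eq_intros G)
  then show ?thesis using that[of "\<lambda>x. G x - G 0"] by simp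
qed

lemma integral_indicator_FTC:
  fixes f :: "real \<Rightarrow> 'b::euclidean_space"
  assumes F: "\<And>x. (F has_vector_derivative f x) (at x)" and f: "continuous_on UNIV f"
    and t: "0 \<le> t" "t \<le> 1"
  shows "(LINT s|unit_meas. indicator {..t} s *\<^sub>R f s) = F t - F 0"
proof -
  have [measurable]: "f \<in> borel_measurable borel" using f by (rule borel_measurable_continuous_onI)
  have "(LINT s|unit_meas. indicator {..t} s *\<^sub>R f s) =
      (LINT s|lebesgue. indicator {0..1} s *\<^sub>R (indicator {..t} s *\<^sub>R f s))"
    by (rule integral_restrict_space) simp
  also have "\<dots> = (LINT s|lebesgue. indicator {0..t} s *\<^sub>R f s)"
    using t by (intro Bochner_Integration.integral_cong) (auto simp: indicator_def)
  also have "\<dots> = (LINT s|lborel. indicator {0..t} s *\<^sub>R f s)"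
    by (rule integral_completion) measurable
  also have "\<dots> = F t - F 0"
    using t F f by (intro integral_FTC_atLeastAtMost)
      (auto intro: has_vector_derivative_at_within continuous_on_subset)
  finally show ?thesis .
qed

lemma integral_unit_FTC:
  fixes f :: "real \<Rightarrow> 'b::euclidean_space"
  assumes "\<And>x. (F has_vector_derivative f x) (at x)" "continuous_on UNIV f"
  shows "(LINT s|unit_meas. f s) = F 1 - F 0"
proof -
  have "(LINT s|unit_meas. f s) = (LINT s|unit_meas. indicator {..1} s *\<^sub>R f s)"
    by (rule Bochner_Integration.integral_cong) auto
  then show ?thesis using integral_indicator_FTC[OF assms, of 1] by simp
qed

text \<open>The integral from 0 to \<open>t\<close>, written over the fixed measure space [0,1] so
  that differences and norm bounds for different \<open>t\<close> concern one and the same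
  integral.\<close>

definition prim :: "(real \<Rightarrow> complex) \<Rightarrow> real \<Rightarrow> complex"
  where "prim f t = (LINT s|unit_meas. indicator {..t} s *\<^sub>R f s)"

lemma integrable_indicator_atMost:
  fixes f :: "real \<Rightarrow> complex"
  shows "integrable unit_meas f \<Longrightarrow> integrable unit_meas (\<lambda>s. indicator {..t} s *\<^sub>R f s)"
proof (rule Bochner_Integration.integrable_bound[of _ f])
  assume f: "integrable unit_meas f"
  have "indicator {..t} \<in> borel_measurable (borel :: real measure)" by measurable
  then have "indicator {..t} \<in> borel_measurable unit_meas"
    by (intro measurable_restrict_space1 measurable_completion) simp
  then show "(\<lambda>s. indicator {..t} s *\<^sub>R f s) \<in> borel_measurable unit_meas"
    using f by (intro borel_measurable_scaleR) auto
qed (auto simp: indicator_def)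

lemma prim_diff:
  "integrable unit_meas f \<Longrightarrow> integrable unit_meas g \<Longrightarrow> prim (\<lambda>s. f s - g s) t = prim f t - prim g t"
  unfolding prim_def
  by (subst Bochner_Integration.integral_diff[symmetric])
    (auto simp: integrable_indicator_atMost scaleR_diff_right)

lemma norm_prim_le:
  assumes "integrable unit_meas f"
  shows "norm (prim f t) \<le> (LINT s|unit_meas. norm (f s))"
proof -
  have "norm (prim f t) \<le> (LINT s|unit_meas. norm (indicator {..t} s *\<^sub>R f s))"
    unfolding prim_def by (rule integral_norm_bound)
  also have "\<dots> \<le> (LINT s|unit_meas. norm (f s))"
    using assms by (intro integral_mono integrable_norm integrable_indicator_atMost)
      (auto simp: indicator_def)
  finally show ?thesis .
qed

lemma continuous_bounded_on_unit:
  fixes g :: "real \<Rightarrow> 'b::real_normed_vector"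
  assumes "continuous_on {0..1} g"
  obtains B where "B \<ge> 0" "\<And>t. 0 \<le> t \<Longrightarrow> t \<le> 1 \<Longrightarrow> norm (g t) \<le> B"
proof -
  obtain B where B: "\<forall>x\<in>{0..1}. norm (g x) \<le> B"
    using compact_imp_bounded[OF compact_continuous_image[OF assms]] by (auto simp: bounded_iff)
  then have "B \<ge> 0" using order_trans[OF norm_ge_zero, of "g 0" B] by simp
  with B show ?thesis using that by simp
qed

lemma integrable_times_continuous:
  fixes f g :: "real \<Rightarrow> complex"
  assumes f: "integrable unit_meas f" and g: "continuous_on {0..1} g"
    and B: "\<And>t. 0 \<le> t \<Longrightarrow> t \<le> 1 \<Longrightarrow> norm (g t) \<le> B"
  shows "integrable unit_meas (\<lambda>t. f t * g t)"
    "norm (LINT t|unit_meas. f t * g t) \<le> (LINT t|unit_meas. norm (f t)) * B"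
proof -
  have gm: "meas g" using continuous_integrable_unit[OF g] by simp
  have le: "norm (f t * g t) \<le> norm (f t) * B" if "t \<in> space unit_meas" for t
    using B[of t] that by (simp add: norm_mult mult_left_mono)
  have "B \<ge> 0" using order_trans[OF norm_ge_zero B[of 0]] by simp
  show int: "integrable unit_meas (\<lambda>t. f t * g t)"
  proof (rule Bochner_Integration.integrable_bound)
    show "integrable unit_meas (\<lambda>t. norm (f t) * B)" using f by simp
    show "AE t in unit_meas. norm (f t * g t) \<le> norm (norm (f t) * B)"
      using AE_space by eventually_elim (use le \<open>B \<ge> 0\<close> in auto)
  qed (use f gm in \<open>auto intro!: borel_measurable_times\<close>)
  have "norm (LINT t|unit_meas. f t * g t) \<le> (LINT t|unit_meas. norm (f t * g t))"
    by (rule integral_norm_bound)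
  also have "\<dots> \<le> (LINT t|unit_meas. norm (f t) * B)"
    using int f le by (intro integral_mono) auto
  finally show "norm (LINT t|unit_meas. f t * g t) \<le> (LINT t|unit_meas. norm (f t)) * B"
    using f by simp
qed

abbreviation shift :: "real \<Rightarrow> l0 \<Rightarrow> l0"
  where "shift \<equiv> wshift (\<lambda>_. 1)"

context Lp_space
begin

lemma C0_semigroup_shift: "C0_semigroup p shift"
proof -
  interpret damping p "\<lambda>_. 0" by unfold_locales (auto simp: mono_def)
  have w: "weight = (\<lambda>_ _. 1)" by (simp add: fun_eq_iff weight_def)
  have "dshift = shift" unfolding fun_eq_iff dshift_def w by simp
  then show ?thesis using C0_semigroup_dshift by simp
qed

lemma semigr_shift: "semigr shift"
  by (rule C0_semigroup_imp_semigr[OF C0_semigroup_shift])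

text \<open>The boundary condition \<open>H 0 = 0\<close> lets the zero extension of
  \<open>H\<close> pass 0 without a jump, so the difference quotients are bounded by the Lipschitz
  constant of \<open>H\<close> and bounded convergence applies. A jump would produce quotients of
  order \<open>1 / \<tau>\<close>.\<close>

lemma shift_rderiv_continuous:
  assumes g: "continuous_on UNIV g" and H: "\<And>x. (H has_vector_derivative g x) (at x)" and H0: "H 0 = 0"
  shows "rderiv shift (cls H) (- cls g)"
proof -
  have cont_H: "continuous_on UNIV H"
    using H by (auto simp: continuous_on_eq_continuous_at intro: has_vector_derivative_continuous)
  have g': "continuous_on {0..1} g" and H': "continuous_on {0..1} H"
    using g cont_H continuous_on_subset by blast+
  note [simp] = cls_continuous_in_Lp(1)[OF g'] cls_continuous_in_Lp(1)[OF H'] wshift_measurable[of "\<lambda>_. 1", simplified]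
  obtain B where B: "B \<ge> 0" "\<And>t. 0 \<le> t \<Longrightarrow> t \<le> 1 \<Longrightarrow> norm (g t) \<le> B"
    using continuous_bounded_on_unit[OF g'] by blast
  have lip: "norm (H y - H x) \<le> B * (y - x)" if "0 \<le> x" "x \<le> y" "y \<le> 1" for x y
  proof -
    have "norm (H y - H x) \<le> B * norm (y - x)"
    proof (rule differentiable_bound[of "{0..1}"])
      show "(H has_derivative (\<lambda>h. h *\<^sub>R g t)) (at t within {0..1})" for t
        using H[of t] by (simp add: has_vector_derivative_def has_derivative_at_withinI)
      show "onorm (\<lambda>h. h *\<^sub>R g t) \<le> B" if "t \<in> {0..1}" for t
        proof (rule onorm_le)
          fix h :: real
          have "\<bar>h\<bar> * norm (g t) \<le> \<bar>h\<bar> * B" using B(2)[of t] that by (intro mult_left_mono) auto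
          then show "norm (h *\<^sub>R g t) \<le> B * norm h" by (simp add: mult.commute)
        qed
    qed (use that in auto)
    then show ?thesis using that by simp
  qed
  have eq: "(1 / \<tau>) *\<^sub>R (shift \<tau> (cls H) - cls H) - (- cls g) =
      cls (\<lambda>t. (1 / \<tau>) *\<^sub>R (zero_ext H (t - \<tau>) - H t) + g t)" for \<tau>
    by (simp add: wshift_cls cls_diff cls_scaleR cls_add borel_measurable_diff borel_measurable_scaleR)
  show ?thesis unfolding rderiv_def eq
  proof (intro conjI)
    show "- cls g \<in> Lp p" using cls_continuous_in_Lp(2)[OF g'] by simp
    show "((\<lambda>\<tau>. Lp_norm p (cls (\<lambda>t. (1 / \<tau>) *\<^sub>R (zero_ext H (t - \<tau>) - H t) + g t))) \<longlongrightarrow> 0) (at_right 0)"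
    proof (rule bounded_convergence_at_right)
      fix \<tau> t :: real assume *: "0 < \<tau>" "0 \<le> t" "t \<le> 1"
      have "norm (zero_ext H (t - \<tau>) - H t) \<le> B * \<tau>"
      proof (cases "\<tau> \<le> t")
        case True
        then show ?thesis using lip[of "t - \<tau>" t] * by (simp add: norm_minus_commute)
      next
        \<comment> \<open>For \<open>t < \<tau>\<close> the shifted value is 0, which is
          \<open>H 0\<close>, so the increment runs only from 0 to \<open>t\<close>.\<close>
        case False
        then have "norm (zero_ext H (t - \<tau>) - H t) \<le> B * t" using lip[of 0 t] * H0 by simp
        also have "\<dots> \<le> B * \<tau>" using False B(1) by (intro mult_left_mono) auto
        finally show ?thesis .
      qed
      then have "norm ((1 / \<tau>) *\<^sub>R (zero_ext H (t - \<tau>) - H t)) \<le> B"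
        unfolding norm_scaleR using * by (simp add: pos_divide_le_eq)
      then show "norm ((1 / \<tau>) *\<^sub>R (zero_ext H (t - \<tau>) - H t) + g t) \<le> 2 * B"
        using norm_triangle_ineq[of "(1 / \<tau>) *\<^sub>R (zero_ext H (t - \<tau>) - H t)" "g t"] B(2)[of t] * by linarith
    next
      fix t :: real assume t: "0 < t" "t \<le> 1"
      have "((\<lambda>h. norm (H (t + h) - H t - h *\<^sub>R g t) / norm h) \<longlongrightarrow> 0) (at 0)"
        using H[of t] by (simp add: has_vector_derivative_def has_derivative_at)
      moreover have "filterlim uminus (at 0) (at_right (0::real))"
        by (auto simp: filterlim_at intro!: tendsto_eq_intros eventually_at_rightI[of 0 1])
      ultimately have lim: "((\<lambda>\<tau>. norm (H (t + - \<tau>) - H t - (- \<tau>) *\<^sub>R g t) / norm (- \<tau>)) \<longlongrightarrow> 0) (at_right 0)"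
        by (rule filterlim_compose)
      have ev: "\<forall>\<^sub>F \<tau> in at_right 0. norm (H (t + - \<tau>) - H t - (- \<tau>) *\<^sub>R g t) / norm (- \<tau>) =
          norm ((1 / \<tau>) *\<^sub>R (zero_ext H (t - \<tau>) - H t) + g t)"
      proof (rule eventually_at_rightI)
        fix \<tau> assume \<tau>: "\<tau> \<in> {0<..<t}"
        have "(1 / \<tau>) *\<^sub>R (zero_ext H (t - \<tau>) - H t) + g t = (1 / \<tau>) *\<^sub>R (H (t + - \<tau>) - H t - (- \<tau>) *\<^sub>R g t)"
          using \<tau> t by (simp add: scaleR_add_right)
        also have "norm \<dots> = norm (H (t + - \<tau>) - H t - (- \<tau>) *\<^sub>R g t) / norm (- \<tau>)"
          using \<tau> by (simp only: norm_scaleR) simp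
        finally show "norm (H (t + - \<tau>) - H t - (- \<tau>) *\<^sub>R g t) / norm (- \<tau>) =
          norm ((1 / \<tau>) *\<^sub>R (zero_ext H (t - \<tau>) - H t) + g t)" by simp
      qed (use t in simp)
      show "((\<lambda>\<tau>. (1 / \<tau>) *\<^sub>R (zero_ext H (t - \<tau>) - H t) + g t) \<longlongrightarrow> 0) (at_right 0)"
        by (rule tendsto_norm_zero_cancel[OF Lim_transform_eventually[OF lim ev]])
    qed (intro borel_measurable_add borel_measurable_scaleR borel_measurable_diff, simp_all)
  qed
qed

lemma norm_1_cls_diff:
  assumes "continuous_on UNIV g" "v \<in> Lp p"
  shows "integrable unit_meas (\<lambda>s. g s - rep v s)"
    "(LINT s|unit_meas. norm (g s - rep v s)) \<le> 2 * Lp_norm p (cls g - v)"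
proof -
  have g: "continuous_on {0..1} g" using assms(1) continuous_on_subset by blast
  note m = cls_continuous_in_Lp[OF g]
  show i: "integrable unit_meas (\<lambda>s. g s - rep v s)"
    using continuous_integrable_unit[OF g] Lp_subset_L1(1)[OF assms(2)] by simp
  have eq: "cls g - v = cls (\<lambda>s. g s - rep v s)" using cls_diff[OF m(1), of "rep v"] by simp
  have "(LINT s|unit_meas. norm (g s - rep v s)) = Lp_norm 1 (cls g - v)"
    using m(1) unfolding eq by (subst Lp_norm_cls) (auto simp: integral_nonneg_AE)
  also have "\<dots> \<le> 2 * Lp_norm p (cls g - v)"
    using m assms by (intro Lp_subset_L1(3)) auto
  finally show "(LINT s|unit_meas. norm (g s - rep v s)) \<le> 2 * Lp_norm p (cls g - v)" .
qed

lemma weak_deriv_cls: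
  assumes "meas h"
  shows "weak_deriv (cls h) v \<longleftrightarrow> cls h \<in> Lp 1 \<and> v \<in> Lp 1 \<and>
    (\<forall>\<phi> \<phi>' :: real \<Rightarrow> complex.
      (\<forall>t. (\<phi> has_vector_derivative \<phi>' t) (at t)) \<longrightarrow>
      continuous_on UNIV \<phi>' \<longrightarrow>
      (\<exists>a b. 0 < a \<and> b < 1 \<and> (\<forall>t. t \<notin> {a..b} \<longrightarrow> \<phi> t = 0)) \<longrightarrow>
      (LINT t|unit_meas. h t * \<phi>' t) = - (LINT t|unit_meas. rep v t * \<phi> t))"
proof -
  have eq: "(LINT t|unit_meas. rep (cls h) t * \<phi>' t) = (LINT t|unit_meas. h t * \<phi>' t)"
    if "continuous_on UNIV \<phi>'" for \<phi>'
  proof (rule integral_cong_AE)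
    have "continuous_on {0..1} \<phi>'" using that continuous_on_subset by blast
    then have "meas \<phi>'" by (rule cls_continuous_in_Lp(1))
    then show "meas (\<lambda>t. rep (cls h) t * \<phi>' t)" "meas (\<lambda>t. h t * \<phi>' t)"
      using assms by (auto intro: borel_measurable_times)
    show "AE t in unit_meas. rep (cls h) t * \<phi>' t = h t * \<phi>' t"
      using rep_cls[OF assms] by eventually_elim simp
  qed
  show ?thesis unfolding weak_deriv_def by (simp add: eq cong: imp_cong)
qed

text \<open>All four claims pass to the limit from continuous approximants \<open>g n\<close> of
  \<open>v\<close> and their classical primitives \<open>H n\<close>, which converge uniformly to
  \<open>h\<close>. The derivative under the shift survives by closedness, the weak derivative
  because both integrals in the integration by parts converge.\<close>

lemma prim_properties:
  assumes v: "v \<in> Lp p"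
  defines "h \<equiv> prim (rep v)"
  shows "continuous_on {0..1} h" "h 0 = 0" "rderiv shift (cls h) (- v)" "weak_deriv (cls h) v"
proof -
  have "\<exists>g. continuous_on UNIV g \<and> Lp_norm p (cls g - v) < 1 / real (Suc n)" for n
    using continuous_dense[OF v, of "1 / real (Suc n)"] by auto
  then obtain g where g: "\<And>n. continuous_on UNIV (g n)"
    and gv: "\<And>n. Lp_norm p (cls (g n) - v) < 1 / real (Suc n)" by metis
  have g': "continuous_on {0..1} (g n)" for n using g continuous_on_subset by blast
  have "\<exists>F. (\<forall>x. (F has_vector_derivative g n x) (at x)) \<and> F 0 = 0" for n
    using antiderivative_exists[OF g[of n]] by metis
  then obtain H where H: "\<And>n x. (H n has_vector_derivative g n x) (at x)" and H0: "\<And>n. H n 0 = 0"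
    by metis
  \<comment> \<open>Twice the error in \<open>Lp p\<close> bounds the error of \<open>g n\<close> in
    the norm of exponent 1, and hence the uniform error of \<open>H n\<close>.\<close>
  define \<epsilon> where "\<epsilon> n = 2 * Lp_norm p (cls (g n) - v)" for n
  have \<epsilon>: "\<epsilon> \<longlonglongrightarrow> 0"
  proof (rule tendsto_sandwich[of "\<lambda>_. 0"])
    show "(\<lambda>n. 2 * (1 / real (Suc n))) \<longlonglongrightarrow> 0"
      using tendsto_mult_left[OF LIMSEQ_inverse_real_of_nat, of 2] by (simp add: inverse_eq_divide)
    show "\<forall>\<^sub>F n in sequentially. \<epsilon> n \<le> 2 * (1 / real (Suc n))"
      unfolding \<epsilon>_def by (intro always_eventually allI mult_left_mono[OF less_imp_le[OF gv]]) simp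
  qed (auto simp: \<epsilon>_def Lp_norm_nonneg)
  have vi: "integrable unit_meas (rep v)" by (rule Lp_subset_L1(1)[OF v])
  have Hh: "norm (H n t - h t) \<le> \<epsilon> n" if "0 \<le> t" "t \<le> 1" for n t
  proof -
    have "H n t = prim (g n) t"
      unfolding prim_def using integral_indicator_FTC[OF H g that] H0 by simp
    then have "H n t - h t = prim (\<lambda>s. g n s - rep v s) t"
      using vi continuous_integrable_unit[OF g'] by (simp add: h_def prim_diff)
    also have "norm \<dots> \<le> (LINT s|unit_meas. norm (g n s - rep v s))"
      by (rule norm_prim_le[OF norm_1_cls_diff(1)[OF g v]])
    also have "\<dots> \<le> \<epsilon> n" unfolding \<epsilon>_def by (rule norm_1_cls_diff(2)[OF g v])
    finally show ?thesis .
  qed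
  have contH: "continuous_on S (H n)" for n S
    using H by (intro continuous_at_imp_continuous_on) (auto intro: has_vector_derivative_continuous)
  show hc: "continuous_on {0..1} h"
  proof (rule uniform_limit_theorem)
    show "uniform_limit {0..1} H h sequentially"
      unfolding uniform_limit_iff
    proof (intro allI impI)
      fix e :: real assume "e > 0"
      then have "\<forall>\<^sub>F n in sequentially. \<epsilon> n < e" by (rule order_tendstoD(2)[OF \<epsilon>])
      then show "\<forall>\<^sub>F n in sequentially. \<forall>x\<in>{0..1}. dist (H n x) (h x) < e"
      proof eventually_elim
        case (elim n)
        show ?case
        proof
          fix x :: real assume "x \<in> {0..1}"
          then have "dist (H n x) (h x) \<le> \<epsilon> n" using Hh by (simp add: dist_norm)
          with elim show "dist (H n x) (h x) < e" by simp
        qed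
      qed
    qed
  qed (auto simp: contH)
  have "norm (h 0) \<le> 0"
    using Hh[of 0] H0 by (intro LIMSEQ_le_const[OF \<epsilon>]) auto
  then show "h 0 = 0" by simp
  note [simp] = cls_continuous_in_Lp[OF hc] cls_continuous_in_Lp[OF contH] cls_continuous_in_Lp[OF g']
  have gv0: "(\<lambda>n. Lp_norm p (cls (g n) - v)) \<longlonglongrightarrow> 0"
    using tendsto_mult_left[OF \<epsilon>, of "1/2"] by (simp add: \<epsilon>_def)
  show "rderiv shift (cls h) (- v)"
  proof (rule rderiv_closed[OF semigr_shift])
    show "rderiv shift (cls (H n)) (- cls (g n))" for n
      using g H H0 by (rule shift_rderiv_continuous)
    show "(\<lambda>n. Lp_norm p (cls (H n) - cls h)) \<longlonglongrightarrow> 0"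
    proof (rule tendsto_sandwich[OF _ _ tendsto_const \<epsilon>])
      have "Lp_norm p (cls (H n) - cls h) \<le> \<epsilon> n" for n
        unfolding cls_diff[OF cls_continuous_in_Lp(1)[OF contH] cls_continuous_in_Lp(1)[OF hc]]
        using Hh by (intro Lp_bounded(2) borel_measurable_diff) auto
      then show "\<forall>\<^sub>F n in sequentially. Lp_norm p (cls (H n) - cls h) \<le> \<epsilon> n" by simp
    qed (simp add: Lp_norm_nonneg)
    have "Lp_norm p (- cls (g n) - - v) = Lp_norm p (cls (g n) - v)" for n
      using v N_diff_commute[of "cls (g n)" v] by simp
    then show "(\<lambda>n. Lp_norm p (- cls (g n) - - v)) \<longlonglongrightarrow> 0" using gv0 by simp
  qed (use v in auto)
  show "weak_deriv (cls h) v"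
    unfolding weak_deriv_cls[OF cls_continuous_in_Lp(1)[OF hc]]
  proof (intro conjI allI impI)
    show "cls h \<in> Lp 1" "v \<in> Lp 1" using v by (auto intro: Lp_subset_L1(2))
    fix \<phi> \<phi>' :: "real \<Rightarrow> complex"
    assume d: "\<forall>t. (\<phi> has_vector_derivative \<phi>' t) (at t)" and c': "continuous_on UNIV \<phi>'"
      and supp: "\<exists>a b. 0 < a \<and> b < 1 \<and> (\<forall>t. t \<notin> {a..b} \<longrightarrow> \<phi> t = 0)"
    have \<phi>01: "\<phi> 0 = 0" "\<phi> 1 = 0" using supp by force+
    have c: "continuous_on S \<phi>" for S
      using d by (intro continuous_at_imp_continuous_on) (auto intro: has_vector_derivative_continuous)
    have c'': "continuous_on {0..1} \<phi>'" using c' continuous_on_subset by blast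
    obtain B1 where B1: "B1 \<ge> 0" "\<And>t. 0 \<le> t \<Longrightarrow> t \<le> 1 \<Longrightarrow> norm (\<phi> t) \<le> B1"
      using continuous_bounded_on_unit[OF c] by blast
    obtain B2 where B2: "B2 \<ge> 0" "\<And>t. 0 \<le> t \<Longrightarrow> t \<le> 1 \<Longrightarrow> norm (\<phi>' t) \<le> B2"
      using continuous_bounded_on_unit[OF c''] by blast
    \<comment> \<open>For \<open>H n\<close> and \<open>g n\<close> the two integrals cancel, as the
      sum of the integrands is the derivative of \<open>H n * \<phi>\<close> and
      \<open>\<phi>\<close> vanishes at both ends. What remains are the errors of \<open>H n\<close>
      and \<open>g n\<close>, weighted by the bounds on \<open>\<phi>'\<close> and
      \<open>\<phi>\<close>.\<close>
    have est: "norm ((LINT t|unit_meas. h t * \<phi>' t) + (LINT t|unit_meas. rep v t * \<phi> t)) \<le> \<epsilon> n * (B2 + B1)" for n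
    proof -
      have der: "((\<lambda>t. H n t * \<phi> t) has_vector_derivative H n x * \<phi>' x + g n x * \<phi> x) (at x)" for x
        using has_vector_derivative_mult[OF H d[rule_format]] by simp
      have "continuous_on UNIV (\<lambda>x. H n x * \<phi>' x + g n x * \<phi> x)"
        by (intro continuous_intros contH c c' g)
      from integral_unit_FTC[OF der this]
      have zero: "(LINT t|unit_meas. H n t * \<phi>' t + g n t * \<phi> t) = 0"
        by (simp add: \<phi>01)
      have i: "integrable unit_meas (\<lambda>t. H n t * \<phi>' t)" "integrable unit_meas (\<lambda>t. g n t * \<phi> t)"
        "integrable unit_meas (\<lambda>t. h t * \<phi>' t)"
        by (intro continuous_integrable_unit continuous_intros contH c c'' g' hc)+
      have iv: "integrable unit_meas (\<lambda>t. rep v t * \<phi> t)"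
        by (rule integrable_times_continuous(1)[OF vi c B1(2)])
      have id: "integrable unit_meas (\<lambda>t. H n t - h t)"
        by (intro continuous_integrable_unit continuous_intros contH hc)
      have "(LINT t|unit_meas. (H n t - h t) * \<phi>' t) + (LINT t|unit_meas. (g n t - rep v t) * \<phi> t) =
          (LINT t|unit_meas. H n t * \<phi>' t + g n t * \<phi> t) -
          ((LINT t|unit_meas. h t * \<phi>' t) + (LINT t|unit_meas. rep v t * \<phi> t))"
        using i iv by (simp add: left_diff_distrib)
      then have "norm ((LINT t|unit_meas. h t * \<phi>' t) + (LINT t|unit_meas. rep v t * \<phi> t)) =
          norm ((LINT t|unit_meas. (H n t - h t) * \<phi>' t) + (LINT t|unit_meas. (g n t - rep v t) * \<phi> t))"
        by (simp only: zero diff_0 norm_minus_cancel)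
      also have "\<dots> \<le> norm (LINT t|unit_meas. (H n t - h t) * \<phi>' t) + norm (LINT t|unit_meas. (g n t - rep v t) * \<phi> t)"
        by (rule norm_triangle_ineq)
      also have "norm (LINT t|unit_meas. (H n t - h t) * \<phi>' t) \<le> (LINT t|unit_meas. norm (H n t - h t)) * B2"
        by (rule integrable_times_continuous(2)[OF id c'' B2(2)])
      also have "(LINT t|unit_meas. norm (H n t - h t)) \<le> \<epsilon> n"
      proof -
        interpret finite_measure unit_meas by (rule finite_measure_unit_meas)
        have "(LINT t|unit_meas. norm (H n t - h t)) \<le> (LINT t|unit_meas. \<epsilon> n)"
          using id Hh by (intro integral_mono) auto
        then show ?thesis by (simp add: measure_unit_meas)
      qed
      also have "norm (LINT t|unit_meas. (g n t - rep v t) * \<phi> t) \<le> (LINT t|unit_meas. norm (g n t - rep v t)) * B1"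
        by (rule integrable_times_continuous(2)[OF norm_1_cls_diff(1)[OF g v] c B1(2)])
      also have "(LINT t|unit_meas. norm (g n t - rep v t)) \<le> \<epsilon> n"
        unfolding \<epsilon>_def by (rule norm_1_cls_diff(2)[OF g v])
      finally show ?thesis using B1(1) B2(1) by (simp add: distrib_left mult_right_mono)
    qed
    have "(\<lambda>n. \<epsilon> n * (B2 + B1)) \<longlonglongrightarrow> 0"
      using tendsto_mult_right[OF \<epsilon>, of "B2 + B1"] by simp
    then have "norm ((LINT t|unit_meas. h t * \<phi>' t) + (LINT t|unit_meas. rep v t * \<phi> t)) \<le> 0"
      by (rule LIMSEQ_le_const) (use est in blast)
    then show "(LINT t|unit_meas. h t * \<phi>' t) = - (LINT t|unit_meas. rep v t * \<phi> t)"
      by (simp add: eq_neg_iff_add_eq_0)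
  qed
qed

end

text \<open>The primitive of a hat function rises from one constant to a larger one. The difference
  of two translates has compact support and is continuously differentiable, exactly the smoothness
  that test functions have here.\<close>

lemma bump_antiderivative:
  assumes e: "0 < e"
  obtains B :: "real \<Rightarrow> real"
  where "\<And>x. (B has_vector_derivative max 0 (e - \<bar>x\<bar>)) (at x)"
    "\<And>x. x \<le> - e \<Longrightarrow> B x = B (- e)" "\<And>x. e \<le> x \<Longrightarrow> B x = B e" "B (- e) < B e"
proof -
  have "continuous_on UNIV (\<lambda>x::real. max 0 (e - \<bar>x\<bar>))" by (intro continuous_intros)
  then obtain B where B: "\<And>x. (B has_vector_derivative max 0 (e - \<bar>x\<bar>)) (at x)"
    using antiderivative_exists by blast
  have mvt: "\<exists>z>x. z < y \<and> B y - B x = (y - x) * max 0 (e - \<bar>z\<bar>)" if "x < y" for x y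
    using that B by (intro MVT2) (auto simp: has_real_derivative_iff_has_vector_derivative)
  have left: "B x = B (- e)" if "x \<le> - e" for x
  proof (cases "x = - e")
    case False
    then have "x < - e" using that by simp
    from mvt[OF this] obtain z where "z < - e" "B (- e) - B x = (- e - x) * max 0 (e - \<bar>z\<bar>)"
      by blast
    then show ?thesis using e by simp
  qed simp
  have right: "B x = B e" if "e \<le> x" for x
  proof (cases "x = e")
    case False
    then have "e < x" using that by simp
    from mvt[OF this] obtain z where "e < z" "B x - B e = (x - e) * max 0 (e - \<bar>z\<bar>)"
      by blast
    then show ?thesis using e by simp
  qed simp
  obtain z where z: "- e < z" "z < e" "B e - B (- e) = (e - - e) * max 0 (e - \<bar>z\<bar>)"
    using mvt[of "- e" e] e by force
  have "0 < (e - - e) * max 0 (e - \<bar>z\<bar>)" using e z(1,2) by (intro mult_pos_pos) auto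
  then have "B (- e) < B e" using z(3) by linarith
  then show ?thesis by (intro that[of B] B left right)
qed

text \<open>Testing with primitives of differences of two hat functions.\<close>

lemma weak_deriv_0_imp_eq:
  fixes f :: "real \<Rightarrow> complex"
  assumes f: "continuous_on {0..1} f"
    and zero: "\<And>\<phi> \<phi>' :: real \<Rightarrow> complex. (\<forall>t. (\<phi> has_vector_derivative \<phi>' t) (at t)) \<Longrightarrow>
      continuous_on UNIV \<phi>' \<Longrightarrow> (\<exists>a b. 0 < a \<and> b < 1 \<and> (\<forall>t. t \<notin> {a..b} \<longrightarrow> \<phi> t = 0)) \<Longrightarrow>
      (LINT t|unit_meas. f t * \<phi>' t) = 0"
    and a: "0 < a" "a < 1" and b: "0 < b" "b < 1"
  shows "f a = f b"
proof -
  have le: "norm (f a - f b) \<le> 2 * \<eta>" if \<eta>: "\<eta> > 0" for \<eta>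
  proof -
    have near: "\<exists>d>0. \<forall>t\<in>{0..1}. \<bar>t - c\<bar> < d \<longrightarrow> norm (f t - f c) \<le> \<eta>" if "0 < c" "c < 1" for c
    proof -
      have "c \<in> {0..1}" using that by simp
      with f \<eta> have "\<exists>d>0. \<forall>t\<in>{0..1}. dist t c < d \<longrightarrow> dist (f t) (f c) < \<eta>"
        by (simp only: continuous_on_iff)
      then obtain d where d: "d > 0" "\<And>t. t \<in> {0..1} \<Longrightarrow> dist t c < d \<Longrightarrow> dist (f t) (f c) < \<eta>"
        by blast
      have "norm (f t - f c) \<le> \<eta>" if "t \<in> {0..1}" "\<bar>t - c\<bar> < d" for t
        using d(2)[of t] that by (simp add: dist_norm)
      with d(1) show ?thesis by blast
    qed
    obtain da where da: "da > 0" "\<And>t. t \<in> {0..1} \<Longrightarrow> \<bar>t - a\<bar> < da \<Longrightarrow> norm (f t - f a) \<le> \<eta>"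
      using near[OF a] by blast
    obtain db where db: "db > 0" "\<And>t. t \<in> {0..1} \<Longrightarrow> \<bar>t - b\<bar> < db \<Longrightarrow> norm (f t - f b) \<le> \<eta>"
      using near[OF b] by blast
    \<comment> \<open>Within \<open>e\<close> of \<open>a\<close> or \<open>b\<close> the function
      varies by at most \<open>\<eta>\<close>; the halves keep both hats strictly inside the open
      interval.\<close>
    define e where "e = min (min da db) (min (min (a / 2) (b / 2)) (min ((1 - a) / 2) ((1 - b) / 2)))"
    have "e > 0" using da(1) db(1) a b by (simp add: e_def)
    moreover have "e \<le> da" "e \<le> db" "e \<le> a / 2" "e \<le> b / 2" "e \<le> (1 - a) / 2" "e \<le> (1 - b) / 2"
      by (simp_all only: e_def min_le_iff_disj order_refl simp_thms)
    ultimately have e: "e > 0" "e \<le> da" "e \<le> db" "e \<le> a / 2" "e \<le> b / 2"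
      "e \<le> (1 - a) / 2" "e \<le> (1 - b) / 2" .
    define \<beta> where "\<beta> x = max 0 (e - \<bar>x\<bar>)" for x :: real
    obtain B where B: "\<And>x. (B has_vector_derivative \<beta> x) (at x)"
      "\<And>x. x \<le> - e \<Longrightarrow> B x = B (- e)" "\<And>x. e \<le> x \<Longrightarrow> B x = B e" "B (- e) < B e"
      by (rule bump_antiderivative[OF e(1), folded \<beta>_def]) (rule that)
    define K where "K = B e - B (- e)"
    have K: "K > 0" using B(4) by (simp add: K_def)
    have \<beta>cont: "continuous_on S (\<lambda>t. \<beta> (t - c))" for c S
      unfolding \<beta>_def by (intro continuous_intros)
    have \<beta>0: "\<beta> x \<ge> 0" for x by (simp add: \<beta>_def)
    have Bd: "((\<lambda>t. B (t - c)) has_vector_derivative \<beta> (t - c)) (at t)" for c t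
      using B(1)[of "t - c"] unfolding has_real_derivative_iff_has_vector_derivative[symmetric]
      by (simp add: DERIV_shift[of B _ t "- c", simplified])
    have int\<beta>: "(LINT t|unit_meas. \<beta> (t - c)) = K" if "c = a \<or> c = b" for c
      using integral_unit_FTC[OF Bd \<beta>cont, of c] B(2)[of "- c"] B(3)[of "1 - c"] e that
      by (auto simp: K_def)
    have i1: "integrable unit_meas (\<lambda>t. f t * of_real (\<beta> (t - c)))" for c
      by (intro continuous_integrable_unit continuous_intros f \<beta>cont)
    have approx: "norm ((LINT t|unit_meas. f t * of_real (\<beta> (t - c))) - f c * of_real K) \<le> \<eta> * K"
      if c: "c = a \<or> c = b" for c
    proof -
      have i2: "integrable unit_meas (\<lambda>t. \<beta> (t - c))"
        by (intro continuous_integrable_unit \<beta>cont)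
      have "(LINT t|unit_meas. (f t - f c) * of_real (\<beta> (t - c))) =
          (LINT t|unit_meas. f t * of_real (\<beta> (t - c))) - (LINT t|unit_meas. f c * of_real (\<beta> (t - c)))"
        using i1 i2 by (simp add: left_diff_distrib)
      also have "(LINT t|unit_meas. f c * of_real (\<beta> (t - c))) = f c * of_real K"
        using int\<beta>[OF c] by simp
      finally have "norm ((LINT t|unit_meas. f t * of_real (\<beta> (t - c))) - f c * of_real K) =
          norm (LINT t|unit_meas. (f t - f c) * of_real (\<beta> (t - c)))" by simp
      also have "\<dots> \<le> (LINT t|unit_meas. norm ((f t - f c) * of_real (\<beta> (t - c))))"
        by (rule integral_norm_bound)
      also have "\<dots> \<le> (LINT t|unit_meas. \<eta> * \<beta> (t - c))"
      proof (rule integral_mono)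
        show "integrable unit_meas (\<lambda>t. norm ((f t - f c) * of_real (\<beta> (t - c))))"
          by (intro continuous_integrable_unit continuous_intros f \<beta>cont)
        show "integrable unit_meas (\<lambda>t. \<eta> * \<beta> (t - c))" using i2 by simp
        fix t assume "t \<in> space unit_meas"
        then have t: "t \<in> {0..1}" by simp
        show "norm ((f t - f c) * of_real (\<beta> (t - c))) \<le> \<eta> * \<beta> (t - c)"
        proof (cases "\<bar>t - c\<bar> < e")
          case True
          then have "norm (f t - f c) \<le> \<eta>" using c da(2)[OF t] db(2)[OF t] e by auto
          then show ?thesis using \<beta>0 by (simp add: norm_mult mult_right_mono)
        qed (simp add: \<beta>_def)
      qed
      also have "\<dots> = \<eta> * K" using int\<beta>[OF c] by simp
      finally show ?thesis .
    qed
    \<comment> \<open>The two translates of \<open>B\<close> share the same constant value on either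
      side of both hats, so their difference is a test function. It forces the averages of
      \<open>f\<close> against the two hats to coincide.\<close>
    have "(LINT t|unit_meas. f t * of_real (\<beta> (t - a) - \<beta> (t - b))) = 0"
    proof (rule zero)
      show "\<forall>t. ((\<lambda>t. complex_of_real (B (t - a) - B (t - b))) has_vector_derivative
          complex_of_real (\<beta> (t - a) - \<beta> (t - b))) (at t)"
        by (intro allI has_vector_derivative_of_real)
          (intro DERIV_diff Bd[folded has_real_derivative_iff_has_vector_derivative])
      show "continuous_on UNIV (\<lambda>t. complex_of_real (\<beta> (t - a) - \<beta> (t - b)))"
        by (intro continuous_intros \<beta>cont)
      have "B (t - a) - B (t - b) = 0" if "t \<notin> {min a b - e..max a b + e}" for t
        using that B(2)[of "t - a"] B(2)[of "t - b"] B(3)[of "t - a"] B(3)[of "t - b"]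
        by (cases "t < min a b - e") auto
      then show "\<exists>a' b'. 0 < a' \<and> b' < 1 \<and> (\<forall>t. t \<notin> {a'..b'} \<longrightarrow> complex_of_real (B (t - a) - B (t - b)) = 0)"
        using e a b by (intro exI[of _ "min a b - e"] exI[of _ "max a b + e"]) auto
    qed
    then have eq: "(LINT t|unit_meas. f t * of_real (\<beta> (t - a))) = (LINT t|unit_meas. f t * of_real (\<beta> (t - b)))"
      using i1 by (simp add: right_diff_distrib)
    have "norm (f a * of_real K - f b * of_real K) \<le> \<eta> * K + \<eta> * K"
      using norm_diff_triangle_le[OF _ approx[of b], of "f a * of_real K" "\<eta> * K"] approx[of a]
      by (simp add: eq norm_minus_commute)
    then have "norm (f a - f b) * K \<le> 2 * \<eta> * K"
      using K by (simp add: left_diff_distrib[symmetric] norm_mult)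
    then show ?thesis using K by simp
  qed
  have "norm (f a - f b) \<le> 0 + x" if "x > 0" for x using le[of "x / 2"] that by simp
  then have "norm (f a - f b) \<le> 0" by (rule field_le_epsilon)
  then show ?thesis by simp
qed

lemma weak_deriv_0_imp_constant:
  fixes f :: "real \<Rightarrow> complex"
  assumes f: "continuous_on {0..1} f"
    and zero: "\<And>\<phi> \<phi>' :: real \<Rightarrow> complex. (\<forall>t. (\<phi> has_vector_derivative \<phi>' t) (at t)) \<Longrightarrow>
      continuous_on UNIV \<phi>' \<Longrightarrow> (\<exists>a b. 0 < a \<and> b < 1 \<and> (\<forall>t. t \<notin> {a..b} \<longrightarrow> \<phi> t = 0)) \<Longrightarrow>
      (LINT t|unit_meas. f t * \<phi>' t) = 0"
    and t: "0 \<le> t" "t \<le> 1"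
  shows "f t = f 0"
proof -
  have cl: "closure {0<..<1} = {0..1::real}" by simp
  have inner: "f x = f (1/2)" if "x \<in> {0<..<1}" for x
  proof (rule weak_deriv_0_imp_eq[OF f])
    show "0 < x" "x < 1" using that by auto
  qed (rule zero, assumption+, simp_all)
  have "f x = f (1/2)" if "x \<in> {0..1}" for x
  proof (rule continuous_constant_on_closure[of "{0<..<1}" f])
    show "continuous_on (closure {0<..<1}) f" using f unfolding cl .
    show "x \<in> closure {0<..<1}" using that unfolding cl .
  qed (rule inner)
  from this[of t] this[of 0] show ?thesis using t by simp
qed

lemma test_function_continuous:
  "\<forall>t. (\<phi> has_vector_derivative \<phi>' t) (at t) \<Longrightarrow> continuous_on S \<phi>"
  by (intro continuous_at_imp_continuous_on) (auto intro: has_vector_derivative_continuous)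

lemma weak_derivD:
  assumes "weak_deriv u v" "\<forall>t. (\<phi> has_vector_derivative \<phi>' t) (at t)" "continuous_on UNIV \<phi>'"
    "\<exists>a b. 0 < a \<and> b < 1 \<and> (\<forall>t. t \<notin> {a..b} \<longrightarrow> \<phi> t = 0)"
  shows "(LINT t|unit_meas. rep u t * \<phi>' t) = - (LINT t|unit_meas. rep v t * \<phi> t)"
  using assms unfolding weak_deriv_def by simp

lemma weak_deriv_clsD:
  assumes "meas h" "weak_deriv (cls h) v" "\<forall>t. (\<phi> has_vector_derivative \<phi>' t) (at t)"
    "continuous_on UNIV \<phi>'" "\<exists>a b. 0 < a \<and> b < 1 \<and> (\<forall>t. t \<notin> {a..b} \<longrightarrow> \<phi> t = 0)"
  shows "(LINT t|unit_meas. h t * \<phi>' t) = - (LINT t|unit_meas. rep v t * \<phi> t)"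
proof -
  interpret L1: Lp_space 1 by unfold_locales simp
  show ?thesis using assms(2-) unfolding L1.weak_deriv_cls[OF assms(1)] by simp
qed

text \<open>\<open>h\<close> and \<open>prim (rep v)\<close> are continuous with the same weak
  derivative, so they differ by a constant, which is zero by their values at 0. The argument takes
  place at exponent 1, where weak derivatives are defined.\<close>

lemma weak_deriv_eq_prim:
  assumes h: "continuous_on {0..1} h" "h 0 = 0" and w: "weak_deriv (cls h) v"
  shows "cls h = cls (prim (rep v))"
proof -
  interpret L1: Lp_space 1 by unfold_locales simp
  have v: "v \<in> Lp 1" using w by (simp add: weak_deriv_def)
  note k = L1.prim_properties[OF v]
  note mh = L1.cls_continuous_in_Lp(1)[OF h(1)] and mk = L1.cls_continuous_in_Lp(1)[OF k(1)]
  have "h t - prim (rep v) t = h 0 - prim (rep v) 0" if t: "0 \<le> t" "t \<le> 1" for t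
  proof (rule weak_deriv_0_imp_constant[OF _ _ t])
    show "continuous_on {0..1} (\<lambda>t. h t - prim (rep v) t)" by (intro continuous_intros h k(1))
    fix \<phi> \<phi>' :: "real \<Rightarrow> complex"
    assume \<phi>: "\<forall>t. (\<phi> has_vector_derivative \<phi>' t) (at t)" "continuous_on UNIV \<phi>'"
      "\<exists>a b. 0 < a \<and> b < 1 \<and> (\<forall>t. t \<notin> {a..b} \<longrightarrow> \<phi> t = 0)"
    have c: "continuous_on {0..1} \<phi>'" using \<phi>(2) continuous_on_subset by blast
    have eq: "(LINT t|unit_meas. h t * \<phi>' t) = (LINT t|unit_meas. prim (rep v) t * \<phi>' t)"
      unfolding weak_deriv_clsD[OF mh w \<phi>] weak_deriv_clsD[OF mk k(4) \<phi>] ..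
    have "integrable unit_meas (\<lambda>t. h t * \<phi>' t)" "integrable unit_meas (\<lambda>t. prim (rep v) t * \<phi>' t)"
      by (intro continuous_integrable_unit continuous_intros h k(1) c)+
    then show "(LINT t|unit_meas. (h t - prim (rep v) t) * \<phi>' t) = 0"
      by (simp add: left_diff_distrib eq)
  qed
  then show ?thesis using h(2) k(2) by (intro cls_cong[OF mh]) simp
qed

text \<open>For the difference \<open>w\<close> of two weak derivatives, \<open>prim w\<close> has weak derivative zero, hence
  vanishes; but \<open>- w\<close> is the derivative of the orbit of \<open>prim w\<close> under the shift semigroup.\<close>

lemma weak_deriv_unique:
  assumes w: "weak_deriv u v" "weak_deriv u v'"
  shows "v = v'"
proof -
  interpret L1: Lp_space 1 by unfold_locales simp
  have v: "v \<in> Lp 1" "v' \<in> Lp 1" using w by (auto simp: weak_deriv_def)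
  define w where "w = v - v'"
  have wL: "w \<in> Lp 1" using v by (simp add: w_def)
  note k = L1.prim_properties[OF wL]
  note mk = L1.cls_continuous_in_Lp(1)[OF k(1)]
  have "v - v' = cls (\<lambda>t. rep v t - rep v' t)" using cls_diff[of "rep v" "rep v'"] by simp
  then have wAE: "AE t in unit_meas. rep w t = rep v t - rep v' t"
    unfolding w_def using rep_cls[of "\<lambda>t. rep v t - rep v' t"] by simp
  have "prim (rep w) t = prim (rep w) 0" if t: "0 \<le> t" "t \<le> 1" for t
  proof (rule weak_deriv_0_imp_constant[OF k(1) _ t])
    fix \<phi> \<phi>' :: "real \<Rightarrow> complex"
    assume \<phi>: "\<forall>t. (\<phi> has_vector_derivative \<phi>' t) (at t)" "continuous_on UNIV \<phi>'"
      "\<exists>a b. 0 < a \<and> b < 1 \<and> (\<forall>t. t \<notin> {a..b} \<longrightarrow> \<phi> t = 0)"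
    have c: "continuous_on {0..1} \<phi>" by (rule test_function_continuous[OF \<phi>(1)])
    note m\<phi> = L1.cls_continuous_in_Lp(1)[OF c]
    obtain B where B: "\<And>t. 0 \<le> t \<Longrightarrow> t \<le> 1 \<Longrightarrow> norm (\<phi> t) \<le> B"
      using continuous_bounded_on_unit[OF c] by blast
    have i: "integrable unit_meas (\<lambda>t. rep x t * \<phi> t)" if "x \<in> Lp 1" for x
      using integrable_times_continuous(1)[OF L1.Lp_subset_L1(1)[OF that] c B] by simp
    have "(LINT t|unit_meas. prim (rep w) t * \<phi>' t) = - (LINT t|unit_meas. rep w t * \<phi> t)"
      by (rule weak_deriv_clsD[OF mk k(4) \<phi>])
    also have "(LINT t|unit_meas. rep w t * \<phi> t) = (LINT t|unit_meas. rep v t * \<phi> t - rep v' t * \<phi> t)"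
    proof (rule integral_cong_AE)
      show "AE t in unit_meas. rep w t * \<phi> t = rep v t * \<phi> t - rep v' t * \<phi> t"
        using wAE by eventually_elim (simp add: left_diff_distrib)
    qed (use m\<phi> in \<open>auto intro!: borel_measurable_diff borel_measurable_times\<close>)
    also have "\<dots> = (LINT t|unit_meas. rep v t * \<phi> t) - (LINT t|unit_meas. rep v' t * \<phi> t)"
      using i v by simp
    also have "(LINT t|unit_meas. rep v t * \<phi> t) = (LINT t|unit_meas. rep v' t * \<phi> t)"
      using weak_derivD[OF w(1) \<phi>] weak_derivD[OF w(2) \<phi>] by simp
    finally show "(LINT t|unit_meas. prim (rep w) t * \<phi>' t) = 0" by simp
  qed
  then have "cls (prim (rep w)) = 0" using k(2) cls_cong[OF mk, of "\<lambda>_. 0"] by (simp add: cls_0)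
  then have d: "L1.rderiv shift 0 (- w)" using k(3) by simp
  have "L1.rderiv shift 0 0" using L1.rderiv_scaleR[OF L1.semigr_shift _ d, of 0] by simp
  then have "- w = 0" using L1.rderiv_unique[OF L1.semigr_shift _ d] by simp
  then show ?thesis by (simp add: w_def)
qed

section \<open>Identification of the generator of the shift\<close>

context Lp_space
begin

lemma D0_prim:
  assumes "v \<in> Lp p" shows "D0 (cls (prim (rep v))) = v"
  unfolding D0_def
proof (rule the_equality)
  show "weak_deriv (cls (prim (rep v))) v" by (rule prim_properties(4)[OF assms])
  then show "w = v" if "weak_deriv (cls (prim (rep v))) w" for w
    using that by (rule weak_deriv_unique[rotated])
qed

lemma prim_in_dom_D0:
  assumes v: "v \<in> Lp p" shows "cls (prim (rep v)) \<in> dom_D0 p"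
proof -
  note k = prim_properties[OF v]
  have "cls (prim (rep v)) \<in> Lp p" by (rule cls_continuous_in_Lp(2)[OF k(1)])
  then have "cls (prim (rep v)) \<in> W1p p" using v k(4) by (auto simp: W1p_def)
  then show ?thesis using k(1,2) by (auto simp: dom_D0_def)
qed

lemma dom_D0E:
  assumes "u \<in> dom_D0 p"
  obtains v where "v \<in> Lp p" "u = cls (prim (rep v))"
proof -
  obtain h v where "u = cls h" "continuous_on {0..1} h" "h 0 = 0" "v \<in> Lp p" "weak_deriv u v"
    using assms by (auto simp: dom_D0_def W1p_def)
  with weak_deriv_eq_prim[of h v] show ?thesis by (intro that[of v]) auto
qed

text \<open>For \<open>\<tau> > 1\<close> the shifted zero extension vanishes at every point of
  [0,1]; at \<open>\<tau> = 1\<close> the point \<open>t = 1\<close> would still see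
  \<open>rep u 0\<close>.\<close>

lemma shift_eq_0:
  assumes "1 < \<tau>" shows "shift \<tau> u = 0"
proof -
  have "shift \<tau> u = cls (\<lambda>_. 0)"
    unfolding wshift_def using assms by (intro cls_cong) (auto intro: wshift_measurable[of "\<lambda>_. 1", simplified])
  then show ?thesis by (simp add: cls_0)
qed

lemma shift_rderiv_iff:
  assumes u: "u \<in> Lp p"
  shows "rderiv shift u w \<longleftrightarrow> u \<in> dom_D0 p \<and> w = - D0 u"
proof
  assume d: "rderiv shift u w"
  then have w: "- w \<in> Lp p" by (auto dest: rderiv_V)
  \<comment> \<open>\<open>x\<close> is the element of the domain of \<open>D0\<close> with the same
    derivative \<open>w\<close>, so \<open>u - x\<close> has derivative zero and is fixed by the
    shift. The time 2 used below is one of those beyond 1, at which the shift annihilates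
    everything.\<close>
  define x where "x = cls (prim (rep (- w)))"
  have x: "x \<in> dom_D0 p" "D0 x = - w" "rderiv shift x w"
    using prim_in_dom_D0[OF w] D0_prim[OF w] prim_properties(3)[OF w] by (auto simp: x_def)
  have xL: "x \<in> Lp p" using x(1) by (simp add: dom_D0_def W1p_def)
  have "rderiv shift (u - x) 0" using rderiv_diff[OF semigr_shift u xL d x(3)] by simp
  then have "shift 2 (u - x) = u - x" using u xL by (intro rderiv_0_imp_fixed[OF semigr_shift]) auto
  then have "u = x" by (simp add: shift_eq_0)
  then show "u \<in> dom_D0 p \<and> w = - D0 u" using x by simp
next
  assume *: "u \<in> dom_D0 p \<and> w = - D0 u"
  then obtain v where "v \<in> Lp p" "u = cls (prim (rep v))" by (auto elim: dom_D0E)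
  then show "rderiv shift u w" using * prim_properties(3) by (simp add: D0_prim)
qed

lemma generatesI:
  assumes "C0_semigroup p T" "D \<subseteq> Lp p"
    and iff: "\<And>u w. u \<in> Lp p \<Longrightarrow> rderiv T u w \<longleftrightarrow> u \<in> D \<and> w = - G u"
  shows "generates p D G T"
proof -
  have "u \<in> D \<longleftrightarrow> u \<in> Lp p \<and> (\<exists>v. rderiv T u v)" for u using assms(2) iff[of u] by auto
  then show ?thesis using assms(1,2) iff by (auto simp: generates_def right_deriv_at_0_eq)
qed

lemma generatesD:
  assumes "generates p D G T" "u \<in> Lp p" "rderiv T u v"
  shows "u \<in> D" "rderiv T u (- G u)"
  using assms by (auto simp: generates_def right_deriv_at_0_eq)

text \<open>The selected semigroup and \<open>S\<close> have the same generator, so uniqueness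
  applies. Density is supplied case by case: full domain for \<open>Q\<close>, surjectivity of the
  generator for the shift, and the common domain for the damped shift.\<close>

lemma exp_neg_eq:
  assumes gen: "generates p D G S"
    and dense: "\<And>v e. v \<in> Lp p \<Longrightarrow> 0 < e \<Longrightarrow> \<exists>u\<in>Lp p. (\<exists>w. rderiv S u w) \<and> Lp_norm p (u - v) < e"
    and "0 \<le> \<tau>" "u \<in> Lp p"
  shows "exp_neg p D G \<tau> u = S \<tau> u"
proof (rule semigr_unique[OF _ _ _ dense assms(3,4)])
  have T: "generates p D G (exp_neg p D G)" unfolding exp_neg_def by (rule someI[of "generates p D G", OF gen])
  show S: "semigr S" and "semigr (exp_neg p D G)"
    using gen T by (auto simp: generates_def intro: C0_semigroup_imp_semigr)
  show "rderiv (exp_neg p D G) u v" if u: "u \<in> Lp p" "rderiv S u v" for u v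
  proof -
    have "v = - G u" using rderiv_unique[OF S u(1,2)] generatesD(2)[OF gen u] .
    moreover have "rderiv (exp_neg p D G) u (- G u)"
      using T generatesD(1)[OF gen u] by (simp add: generates_def right_deriv_at_0_eq)
    ultimately show ?thesis by simp
  qed
qed

end

subsection \<open>The Trotter product formula\<close>

text \<open>\<open>exp (- x)\<close> lies between \<open>1 - x\<close> and
  \<open>1 / (1 + x)\<close>, and the latter is at most \<open>1 - x + x\<^sup>2\<close> because
  \<open>(1 - x + x\<^sup>2) * (1 + x) = 1 + x ^ 3\<close>.\<close>

lemma exp_minus_taylor:
  fixes x :: real
  assumes "0 \<le> x"
  shows "\<bar>exp (- x) - 1 + x\<bar> \<le> x\<^sup>2"
proof -
  have "exp (- x) \<ge> 1 - x" using exp_ge_add_one_self[of "- x"] by simp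
  moreover have "exp (- x) \<le> 1 - x + x\<^sup>2"
  proof -
    have "1 \<le> (1 - x + x\<^sup>2) * (1 + x)"
    proof -
      have "(1 - x + x\<^sup>2) * (1 + x) = 1 + x ^ 3" by (simp add: algebra_simps power2_eq_square power3_eq_cube)
      then show ?thesis using assms by simp
    qed
    then have "1 / (1 + x) \<le> 1 - x + x\<^sup>2" using assms by (simp add: divide_le_eq)
    moreover have "exp (- x) \<le> 1 / (1 + x)"
      using assms exp_ge_add_one_self[of x] by (simp add: exp_minus inverse_eq_divide frac_le)
    ultimately show ?thesis by linarith
  qed
  ultimately show ?thesis by simp
qed

text \<open>Serves two semigroups: for multiplication \<open>x / \<tau>\<close> is \<open>c\<close>
  itself, for the damped shift it is the rate at a nearby point. The bound
  \<open>x \<le> \<tau> * B\<close> makes the second-order error uniform.\<close>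

lemma exp_minus_difference_quotient:
  fixes x c \<tau> :: real
  assumes "0 < \<tau>" "0 \<le> x" "x \<le> \<tau> * B"
  shows "\<bar>(exp (- x) - 1) / \<tau> + c\<bar> \<le> \<tau> * B\<^sup>2 + \<bar>c - x / \<tau>\<bar>"
proof -
  have "(exp (- x) - 1) / \<tau> + c = (exp (- x) - 1 + x) / \<tau> + (c - x / \<tau>)"
    using assms(1) by (simp add: field_simps)
  then have "\<bar>(exp (- x) - 1) / \<tau> + c\<bar> \<le> \<bar>exp (- x) - 1 + x\<bar> / \<tau> + \<bar>c - x / \<tau>\<bar>"
    using assms(1) abs_triangle_ineq[of "(exp (- x) - 1 + x) / \<tau>" "c - x / \<tau>"] by simp
  also have "\<bar>exp (- x) - 1 + x\<bar> / \<tau> \<le> (\<tau> * B)\<^sup>2 / \<tau>"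
    using exp_minus_taylor[OF assms(2)] power_mono[OF assms(3,2), of 2] assms(1)
    by (intro divide_right_mono) linarith+
  also have "\<dots> = \<tau> * B\<^sup>2" using assms(1) by (simp add: power2_eq_square)
  finally show ?thesis by simp
qed

lemma exp_minus_lipschitz:
  fixes x y :: real
  assumes "0 \<le> x" "0 \<le> y"
  shows "\<bar>exp (- x) - exp (- y)\<bar> \<le> \<bar>x - y\<bar>"
proof -
  have *: "exp (- a) - exp (- b) \<le> b - a" if "0 \<le> a" "a \<le> b" for a b :: real
  proof -
    have "exp (- a) - exp (- b) = exp (- a) * (1 - exp (- (b - a)))"
      by (simp add: algebra_simps flip: exp_add)
    also have "\<dots> \<le> 1 * (b - a)"
    proof (rule mult_mono)
      have "1 + - (b - a) \<le> exp (- (b - a))" by (rule exp_ge_add_one_self)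
      then show "1 - exp (- (b - a)) \<le> b - a" by linarith
    qed (use that in auto)
    finally show ?thesis by simp
  qed
  show ?thesis
  proof (cases "x \<le> y")
    case True
    then show ?thesis using *[of x y] assms by simp
  next
    case False
    then show ?thesis using *[of y x] assms by simp
  qed
qed

lemma Lp_norm_tendsto_0_sandwich:
  fixes F :: "real \<Rightarrow> l0"
  assumes "\<And>\<tau>. 0 < \<tau> \<Longrightarrow> Lp_norm p (F \<tau>) \<le> b \<tau>" "(b \<longlongrightarrow> 0) (at_right 0)"
  shows "((\<lambda>\<tau>. Lp_norm p (F \<tau>)) \<longlongrightarrow> 0) (at_right 0)"
proof (rule tendsto_sandwich[OF _ _ tendsto_const assms(2)])
  show "\<forall>\<^sub>F \<tau> in at_right 0. Lp_norm p (F \<tau>) \<le> b \<tau>"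
    by (rule eventually_mono[OF eventually_at_right_less[of 0]]) (rule assms(1))
qed (simp add: Lp_norm_nonneg)

section \<open>The multiplication semigroup and the perturbed shift\<close>

locale damping_rate = Lp_space +
  fixes R r :: "real \<Rightarrow> real" and B :: real
  assumes R_deriv: "\<And>t. (R has_real_derivative r t) (at t)"
    and r_uc: "uniformly_continuous_on UNIV r"
    and r_nonneg: "\<And>t. 0 \<le> r t" and r_le: "\<And>t. r t \<le> B"
begin

sublocale damping p R
proof
  show "continuous_on UNIV R"
    by (intro continuous_at_imp_continuous_on ballI DERIV_isCont[OF R_deriv])
  show "mono R"
  proof (rule monoI)
    fix x y :: real assume "x \<le> y"
    then show "R x \<le> R y"
      by (rule DERIV_nonneg_imp_nondecreasing) (use R_deriv r_nonneg in blast)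
  qed
qed

lemma r_cont: "continuous_on S r"
  by (rule continuous_on_subset[OF uniformly_continuous_imp_continuous[OF r_uc]]) simp

lemma r_cont': "continuous_on S g \<Longrightarrow> continuous_on S (\<lambda>t. r (g t))"
  by (rule continuous_on_compose2[OF r_cont[of UNIV]]) simp_all

lemma B_nonneg: "0 \<le> B"
  using r_nonneg[of 0] r_le[of 0] by linarith

lemma r_measurable [simp]: "meas (\<lambda>t. complex_of_real (r t))"
  by (intro cls_continuous_in_Lp(1) continuous_intros r_cont)

text \<open>Replaces the integral of \<open>r\<close> over \<open>[t - h, t]\<close> by
  \<open>h\<close> times a single value of \<open>r\<close>, to which uniform continuity can be
  applied.\<close>

lemma R_mvt:
  assumes "0 < h" obtains z where "t - h < z" "z < t" "R t - R (t - h) = h * r z"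
proof -
  have "t - h < t" using assms by simp
  from MVT2[OF this R_deriv] obtain z where "t - h < z" "z < t" "R t - R (t - h) = (t - (t - h)) * r z"
    by blast
  then show ?thesis by (intro that[of z]) simp_all
qed

definition Q :: "l0 \<Rightarrow> l0"
  where "Q = mult_op (\<lambda>t. complex_of_real (r t))"

lemma Q_eq_wshift: "Q u = wshift (\<lambda>t. complex_of_real (r t)) 0 u"
  by (simp add: Q_def wshift_0_eq_mult_op)

lemma Q_V [simp]: "u \<in> Lp p \<Longrightarrow> Q u \<in> Lp p"
  unfolding Q_eq_wshift by (rule wshift_bounded(1)[of _ _ B]) (auto simp: B_nonneg r_nonneg r_le)

lemma Q_bound: "u \<in> Lp p \<Longrightarrow> Lp_norm p (Q u) \<le> B * Lp_norm p u"
  unfolding Q_eq_wshift by (rule wshift_bounded(2)) (auto simp: B_nonneg r_nonneg r_le)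

lemma Q_diff: "Q (u - v) = Q u - Q v"
proof -
  have "Q ((u - v) + v) = Q (u - v) + Q v" unfolding Q_eq_wshift by (rule wshift_add) simp
  then show ?thesis by simp
qed

definition mult_semigr :: "real \<Rightarrow> l0 \<Rightarrow> l0"
  where "mult_semigr \<tau> = wshift (\<lambda>t. complex_of_real (exp (- (\<tau> * r t)))) 0"

lemma mult_weight_measurable [simp]: "meas (\<lambda>t. complex_of_real (exp (- (\<tau> * r t))))"
  by (intro cls_continuous_in_Lp(1) continuous_intros r_cont)

lemma bounded_op_mult_semigr: "0 \<le> \<tau> \<Longrightarrow> bounded_op p (mult_semigr \<tau>)"
  unfolding mult_semigr_def by (rule bounded_op_wshift[of _ _ 1]) (auto simp: r_nonneg)

lemma mult_semigr_V [simp]: "0 \<le> \<tau> \<Longrightarrow> u \<in> Lp p \<Longrightarrow> mult_semigr \<tau> u \<in> Lp p"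
  using bounded_op_mult_semigr by (auto simp: bounded_op_def)

text \<open>The quotient minus its limit is multiplication by a function of size at most
  \<open>\<tau> * B\<^sup>2\<close>. As the rate is bounded, this holds for every vector, so the
  generator is defined on all of \<open>Lp p\<close>.\<close>

lemma mult_semigr_difference_quotient:
  assumes "0 < \<tau>" "u \<in> Lp p"
  shows "Lp_norm p ((1 / \<tau>) *\<^sub>R (mult_semigr \<tau> u - u) - (- Q u)) \<le> \<tau> * B\<^sup>2 * Lp_norm p u"
proof -
  let ?w = "\<lambda>t. complex_of_real ((exp (- (\<tau> * r t)) - 1) / \<tau> + r t)"
  have "(1 / \<tau>) *\<^sub>R (mult_semigr \<tau> u - u) =
      mult_op (\<lambda>_. complex_of_real (1 / \<tau>)) (wshift (\<lambda>t. complex_of_real (exp (- (\<tau> * r t))) - 1) 0 u)"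
    unfolding mult_semigr_def mult_op_const
    using wshift_weight_diff[of "\<lambda>t. complex_of_real (exp (- (\<tau> * r t)))" "\<lambda>_. 1" 0 u]
    by (simp add: wshift_0)
  also have "\<dots> = wshift (\<lambda>t. complex_of_real (1 / \<tau>) * (complex_of_real (exp (- (\<tau> * r t))) - 1)) 0 u"
    by (rule mult_op_wshift) (intro borel_measurable_diff, simp_all)
  finally have eq: "(1 / \<tau>) *\<^sub>R (mult_semigr \<tau> u - u) =
      wshift (\<lambda>t. complex_of_real (1 / \<tau>) * (complex_of_real (exp (- (\<tau> * r t))) - 1)) 0 u" .
  have "(1 / \<tau>) *\<^sub>R (mult_semigr \<tau> u - u) - (- Q u) = wshift ?w 0 u"
  proof -
    have "- Q u = wshift (\<lambda>t. - complex_of_real (r t)) 0 u"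
      using wshift_mult_const[of "\<lambda>t. complex_of_real (r t)" 0 "- 1" u]
        mult_op_wshift[of "\<lambda>t. complex_of_real (r t)" "\<lambda>_. - 1" 0 u]
        mult_op_const[of "- 1" "Q u"] by (simp add: Q_eq_wshift)
    moreover have ma: "meas (\<lambda>t. complex_of_real (1 / \<tau>) * (complex_of_real (exp (- (\<tau> * r t))) - 1))"
      and mb: "meas (\<lambda>t. - complex_of_real (r t))"
      by (intro cls_continuous_in_Lp(1) continuous_intros r_cont)+
    ultimately have "(1 / \<tau>) *\<^sub>R (mult_semigr \<tau> u - u) - (- Q u) =
        wshift (\<lambda>t. complex_of_real (1 / \<tau>) * (complex_of_real (exp (- (\<tau> * r t))) - 1) -
          - complex_of_real (r t)) 0 u"
      using wshift_weight_diff[OF ma mb, of 0 u] by (simp only: eq)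
    also have "\<dots> = wshift ?w 0 u"
      by (rule arg_cong[where f = "\<lambda>a. wshift a 0 u"]) (simp add: fun_eq_iff)
    finally show ?thesis .
  qed
  moreover have "Lp_norm p (wshift ?w 0 u) \<le> (\<tau> * B\<^sup>2) * Lp_norm p u"
  proof (rule wshift_bounded(2)[OF _ _ _ _ assms(2)])
    show "meas ?w" using assms(1) by (intro cls_continuous_in_Lp(1) continuous_intros r_cont) auto
    fix t
    show "norm (?w t) \<le> \<tau> * B\<^sup>2"
      using exp_minus_difference_quotient[of \<tau> "\<tau> * r t" B "r t"] assms(1) r_nonneg[of t] r_le[of t]
      unfolding norm_of_real by simp
  qed (use assms(1) in auto)
  ultimately show ?thesis by simp
qed

lemma mult_semigr_rderiv_tendsto:
  assumes "u \<in> Lp p"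
  shows "((\<lambda>\<tau>. Lp_norm p ((1 / \<tau>) *\<^sub>R (mult_semigr \<tau> u - u) - (- Q u))) \<longlongrightarrow> 0) (at_right 0)"
proof (rule Lp_norm_tendsto_0_sandwich)
  show "((\<lambda>\<tau>. \<tau> * B\<^sup>2 * Lp_norm p u) \<longlongrightarrow> 0) (at_right 0)"
    by (auto intro!: tendsto_eq_intros)
qed (use mult_semigr_difference_quotient assms in auto)

lemma C0_semigroup_mult_semigr: "C0_semigroup p mult_semigr"
  unfolding C0_semigroup_def
proof (intro conjI allI impI ballI)
  fix u assume u: "u \<in> Lp p"
  show "mult_semigr 0 u = u" by (simp add: mult_semigr_def wshift_0)
  show "((\<lambda>\<tau>. Lp_norm p (mult_semigr \<tau> u - u)) \<longlongrightarrow> 0) (at_right 0)"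
  proof (rule Lp_norm_tendsto_0_sandwich)
    fix \<tau> :: real assume \<tau>: "0 < \<tau>"
    \<comment> \<open>Strong continuity is read off from differentiability: the increment is
      \<open>\<tau>\<close> times \<open>d - Q u\<close>, which stays bounded as
      \<open>\<tau>\<close> tends to 0.\<close>
    define d where "d = (1 / \<tau>) *\<^sub>R (mult_semigr \<tau> u - u) - (- Q u)"
    have d: "d \<in> Lp p" unfolding d_def using \<tau> u by (intro V_intros) auto
    have "mult_semigr \<tau> u - u = \<tau> *\<^sub>R (d - Q u)" using \<tau> by (simp add: d_def)
    then have "Lp_norm p (mult_semigr \<tau> u - u) = \<tau> * Lp_norm p (d - Q u)"
      using \<tau> by (simp add: Lp_norm_scaleR)
    also have "\<dots> \<le> \<tau> * (Lp_norm p d + Lp_norm p (Q u))"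
      using \<tau> d u by (intro mult_left_mono N_diff_le) auto
    also have "\<dots> \<le> \<tau> * (\<tau> * B\<^sup>2 * Lp_norm p u + B * Lp_norm p u)"
      using \<tau> u mult_semigr_difference_quotient[OF \<tau> u, folded d_def] Q_bound[OF u] by (intro mult_left_mono add_mono) auto
    finally show "Lp_norm p (mult_semigr \<tau> u - u) \<le> \<tau> * (\<tau> * B\<^sup>2 * Lp_norm p u + B * Lp_norm p u)" .
  qed (auto intro!: tendsto_eq_intros)
  fix \<sigma> \<tau> :: real assume "0 \<le> \<sigma>" "0 \<le> \<tau>"
  let ?m = "\<lambda>\<tau> t. complex_of_real (exp (- (\<tau> * r t)))"
  have "mult_semigr \<sigma> (mult_semigr \<tau> u) = wshift (\<lambda>t. ?m \<sigma> t * zero_ext (?m \<tau>) (t - 0)) (0 + 0) u"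
    unfolding mult_semigr_def by (intro wshift_wshift) auto
  also have "\<dots> = wshift (?m (\<sigma> + \<tau>)) (0 + 0) u"
    by (intro wshift_cong wshift_measurable)
      (simp_all add: mult_exp_exp algebra_simps flip: of_real_mult)
  finally show "mult_semigr (\<sigma> + \<tau>) u = mult_semigr \<sigma> (mult_semigr \<tau> u)" by (simp add: mult_semigr_def)
qed (rule bounded_op_mult_semigr)

lemma generates_mult_semigr: "generates p (Lp p) Q mult_semigr"
proof (rule generatesI[OF C0_semigroup_mult_semigr])
  fix u w assume u: "u \<in> Lp p"
  have d: "rderiv mult_semigr u (- Q u)"
    unfolding rderiv_def using mult_semigr_rderiv_tendsto[OF u] u by simp
  show "rderiv mult_semigr u w \<longleftrightarrow> u \<in> Lp p \<and> w = - Q u"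
    using d u rderiv_unique[OF C0_semigroup_imp_semigr[OF C0_semigroup_mult_semigr] u d] by blast
qed simp

lemma exp_neg_Q:
  assumes "0 \<le> \<tau>" "u \<in> Lp p"
  shows "exp_neg p (Lp p) Q \<tau> u = mult_semigr \<tau> u"
proof (rule exp_neg_eq[OF generates_mult_semigr _ assms])
  fix v and e :: real assume v: "v \<in> Lp p" and "0 < e"
  then have "rderiv mult_semigr v (- Q v)"
    unfolding rderiv_def using mult_semigr_rderiv_tendsto[OF v] by simp
  then show "\<exists>u\<in>Lp p. (\<exists>w. rderiv mult_semigr u w) \<and> Lp_norm p (u - v) < e"
    using v \<open>0 < e\<close> by (intro bexI[of _ v]) auto
qed

text \<open>The exponent is \<open>- \<tau> * r z\<close> for some \<open>z\<close> between
  \<open>t - \<tau>\<close> and \<open>t\<close>. Uniform continuity brings \<open>r z\<close> close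
  to \<open>r t\<close> with one \<open>d\<close> for all \<open>t\<close>, and the supremum over
  \<open>t\<close> is what controls the operators.\<close>

lemma weight_difference_quotient:
  assumes "0 < e"
  shows "\<exists>d>0. \<forall>\<tau> t. 0 < \<tau> \<longrightarrow> \<tau> < d \<longrightarrow>
    norm (complex_of_real (1 / \<tau>) * (weight \<tau> t - 1) + complex_of_real (r t)) \<le> \<tau> * B\<^sup>2 + e"
proof -
  obtain d where d: "d > 0" "\<And>x y. dist x y < d \<Longrightarrow> dist (r x) (r y) < e"
    using r_uc assms unfolding uniformly_continuous_on_def by (metis UNIV_I)
  have "norm (complex_of_real (1 / \<tau>) * (weight \<tau> t - 1) + complex_of_real (r t)) \<le> \<tau> * B\<^sup>2 + e"
    if \<tau>: "0 < \<tau>" "\<tau> < d" for \<tau> t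
  proof -
    obtain z where z: "t - \<tau> < z" "z < t" "R t - R (t - \<tau>) = \<tau> * r z"
      using R_mvt[OF \<tau>(1)] by blast
    have "complex_of_real (1 / \<tau>) * (weight \<tau> t - 1) + complex_of_real (r t) =
        complex_of_real ((exp (- (\<tau> * r z)) - 1) / \<tau> + r t)"
    proof -
      have "R (t - \<tau>) - R t = - (\<tau> * r z)" using z(3) by linarith
      then have "weight \<tau> t = complex_of_real (exp (- (\<tau> * r z)))" by (simp add: weight_def)
      then show ?thesis by simp
    qed
    moreover have "\<bar>(exp (- (\<tau> * r z)) - 1) / \<tau> + r t\<bar> \<le> \<tau> * B\<^sup>2 + \<bar>r t - \<tau> * r z / \<tau>\<bar>"
      using \<tau> r_nonneg[of z] r_le[of z] by (intro exp_minus_difference_quotient) auto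
    moreover have "\<bar>r t - r z\<bar> < e" using d(2)[of t z] z \<tau> by (simp add: dist_real_def)
    ultimately show ?thesis using \<tau>(1) by (simp only: norm_of_real) simp
  qed
  with d(1) show ?thesis by blast
qed

text \<open>Dividing the difference of the two weights by \<open>\<tau>\<close> gives a function
  uniformly close to \<open>- r\<close>, so the quotient is close to
  \<open>- Q (shift \<tau> u)\<close>. Strong continuity of the shift then replaces
  \<open>shift \<tau> u\<close> by \<open>u\<close>.\<close>

lemma perturbation_tendsto:
  assumes u: "u \<in> Lp p"
  shows "((\<lambda>\<tau>. Lp_norm p ((1 / \<tau>) *\<^sub>R (dshift \<tau> u - shift \<tau> u) + Q u)) \<longlongrightarrow> 0) (at_right 0)"
proof -
  have sh: "shift \<tau> u \<in> Lp p" if "0 \<le> \<tau>" for \<tau>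
    using semigr_V[OF semigr_shift that u] .
  have V: "(1 / \<tau>) *\<^sub>R (dshift \<tau> u - shift \<tau> u) + Q u \<in> Lp p" if "0 < \<tau>" for \<tau>
    using that sh u by (intro V_intros) auto
  have est: "Lp_norm p ((1 / \<tau>) *\<^sub>R (dshift \<tau> u - shift \<tau> u) + Q u) \<le>
      C * Lp_norm p u + B * Lp_norm p (shift \<tau> u - u)"
    if \<tau>: "0 < \<tau>" and C: "\<And>t. norm (complex_of_real (1 / \<tau>) * (weight \<tau> t - 1) + complex_of_real (r t)) \<le> C" for \<tau> C
  proof -
    let ?w = "\<lambda>t. complex_of_real (1 / \<tau>) * (weight \<tau> t - 1) + complex_of_real (r t)"
    have wm: "meas (\<lambda>t. complex_of_real (1 / \<tau>) * (weight \<tau> t - 1))"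
      by (intro borel_measurable_times borel_measurable_diff) simp_all
    have "(1 / \<tau>) *\<^sub>R (dshift \<tau> u - shift \<tau> u) = mult_op (\<lambda>_. complex_of_real (1 / \<tau>)) (wshift (\<lambda>t. weight \<tau> t - 1) \<tau> u)"
      unfolding mult_op_const dshift_def by (subst wshift_weight_diff) simp_all
    also have "\<dots> = wshift (\<lambda>t. complex_of_real (1 / \<tau>) * (weight \<tau> t - 1)) \<tau> u"
      by (rule mult_op_wshift) (intro borel_measurable_diff, simp_all)
    finally have 1: "(1 / \<tau>) *\<^sub>R (dshift \<tau> u - shift \<tau> u) = wshift (\<lambda>t. complex_of_real (1 / \<tau>) * (weight \<tau> t - 1)) \<tau> u" .
    have 2: "Q (shift \<tau> u) = wshift (\<lambda>t. complex_of_real (r t)) \<tau> u"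
      unfolding Q_def by (subst mult_op_wshift) simp_all
    have "wshift ?w \<tau> u - Q (shift \<tau> u) = wshift (\<lambda>t. complex_of_real (1 / \<tau>) * (weight \<tau> t - 1)) \<tau> u"
      unfolding 2 by (subst wshift_weight_diff) (use wm in \<open>auto intro!: borel_measurable_add\<close>)
    then have "(1 / \<tau>) *\<^sub>R (dshift \<tau> u - shift \<tau> u) + Q u = wshift ?w \<tau> u - Q (shift \<tau> u - u)"
      unfolding 1 by (simp add: Q_diff algebra_simps)
    moreover have "C \<ge> 0" using order_trans[OF norm_ge_zero C] .
    have "meas ?w" by (intro borel_measurable_add wm) simp
    from wshift_bounded[OF this less_imp_le[OF \<tau>] \<open>C \<ge> 0\<close> C u]
    have "wshift ?w \<tau> u \<in> Lp p" "Lp_norm p (wshift ?w \<tau> u) \<le> C * Lp_norm p u" .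
    moreover have "Lp_norm p (wshift ?w \<tau> u - Q (shift \<tau> u - u)) \<le>
        Lp_norm p (wshift ?w \<tau> u) + Lp_norm p (Q (shift \<tau> u - u))"
      using calculation sh \<tau> u by (intro N_diff_le) auto
    moreover have "Lp_norm p (Q (shift \<tau> u - u)) \<le> B * Lp_norm p (shift \<tau> u - u)"
      using sh \<tau> u by (intro Q_bound) auto
    ultimately show ?thesis by simp
  qed
  have "\<forall>\<^sub>F \<tau> in at_right 0. Lp_norm p ((1 / \<tau>) *\<^sub>R (dshift \<tau> u - shift \<tau> u) + Q u) < e" if e: "e > 0" for e
  proof -
    \<comment> \<open>Adding 1 avoids a division by zero when \<open>u\<close> has norm
      zero.\<close>
    define k where "k = Lp_norm p u + 1"
    have k: "k > 0" "Lp_norm p u < k" using Lp_norm_nonneg[of p u] by (simp_all add: k_def)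
    define e1 where "e1 = e / (2 * k)"
    have e1: "e1 > 0" using e k by (simp add: e1_def)
    have "e1 * Lp_norm p u < e1 * k" using e1 k by (intro mult_strict_left_mono) auto
    also have "\<dots> = e / 2" using k by (simp add: e1_def)
    finally have e1': "e1 * Lp_norm p u < e / 2" .
    obtain d where d: "d > 0" "\<And>\<tau> t. 0 < \<tau> \<Longrightarrow> \<tau> < d \<Longrightarrow>
        norm (complex_of_real (1 / \<tau>) * (weight \<tau> t - 1) + complex_of_real (r t)) \<le> \<tau> * B\<^sup>2 + e1"
      using weight_difference_quotient[OF e1] by blast
    have "((\<lambda>\<tau>. \<tau> * B\<^sup>2 * Lp_norm p u + B * Lp_norm p (shift \<tau> u - u)) \<longlongrightarrow> 0 * B\<^sup>2 * Lp_norm p u + B * 0) (at_right 0)"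
      by (intro tendsto_intros semigr_tendsto[OF semigr_shift u])
    then have "\<forall>\<^sub>F \<tau> in at_right 0. \<tau> * B\<^sup>2 * Lp_norm p u + B * Lp_norm p (shift \<tau> u - u) < e / 2"
      using e by (intro order_tendstoD(2)) auto
    moreover have "\<forall>\<^sub>F \<tau> in at_right 0. 0 < \<tau> \<and> \<tau> < d"
      using d(1) by (auto simp: eventually_at_right_field)
    ultimately show ?thesis
    proof eventually_elim
      case (elim \<tau>)
      have "Lp_norm p ((1 / \<tau>) *\<^sub>R (dshift \<tau> u - shift \<tau> u) + Q u) \<le>
          (\<tau> * B\<^sup>2 + e1) * Lp_norm p u + B * Lp_norm p (shift \<tau> u - u)"
        using elim d(2)[of \<tau>] by (intro est) auto
      then show ?case using elim e1' by (simp add: distrib_right)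
    qed
  qed
  moreover have "a < Lp_norm p v" if "a < 0" for a v
    using that Lp_norm_nonneg by (rule less_le_trans)
  ultimately show ?thesis
    by (intro order_tendstoI) (auto intro!: always_eventually)
qed

text \<open>By \<open>perturbation_tendsto\<close> the difference quotients of the two semigroups
  differ by a term converging to \<open>- Q u\<close> for every \<open>u\<close>, so one converges
  exactly when the other does. This comparison of explicit semigroups takes the place of a
  perturbation series.\<close>

lemma rderiv_dshift_iff:
  assumes u: "u \<in> Lp p"
  shows "rderiv dshift u (w - Q u) \<longleftrightarrow> rderiv shift u w"
proof -
  let ?E = "\<lambda>\<tau>. (1 / \<tau>) *\<^sub>R (dshift \<tau> u - shift \<tau> u) + Q u"
  let ?a = "\<lambda>\<tau>. (1 / \<tau>) *\<^sub>R (shift \<tau> u - u) - w"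
  let ?b = "\<lambda>\<tau>. (1 / \<tau>) *\<^sub>R (dshift \<tau> u - u) - (w - Q u)"
  have sh: "shift \<tau> u \<in> Lp p" if "0 \<le> \<tau>" for \<tau>
    using semigr_V[OF semigr_shift that u] .
  have ab: "?b \<tau> = ?a \<tau> + ?E \<tau>" for \<tau> by (simp add: scaleR_diff_right)
  have "w - Q u \<in> Lp p \<longleftrightarrow> w \<in> Lp p" using u Lp_add[of "w - Q u" "Q u"] by auto
  moreover have "((\<lambda>\<tau>. Lp_norm p (?b \<tau>)) \<longlongrightarrow> 0) (at_right 0) \<longleftrightarrow> ((\<lambda>\<tau>. Lp_norm p (?a \<tau>)) \<longlongrightarrow> 0) (at_right 0)"
    if w: "w \<in> Lp p"
  proof
    assume "((\<lambda>\<tau>. Lp_norm p (?b \<tau>)) \<longlongrightarrow> 0) (at_right 0)"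
    then have "((\<lambda>\<tau>. Lp_norm p (?b \<tau>) + Lp_norm p (?E \<tau>)) \<longlongrightarrow> 0) (at_right 0)"
      using tendsto_add[OF _ perturbation_tendsto[OF u]] by fastforce
    then show "((\<lambda>\<tau>. Lp_norm p (?a \<tau>)) \<longlongrightarrow> 0) (at_right 0)"
    proof (rule Lp_norm_tendsto_0_sandwich[rotated])
      fix \<tau> :: real assume "0 < \<tau>"
      then have "?b \<tau> \<in> Lp p" "?E \<tau> \<in> Lp p" using u w sh by (auto intro!: V_intros)
      from N_diff_le[OF this] show "Lp_norm p (?a \<tau>) \<le> Lp_norm p (?b \<tau>) + Lp_norm p (?E \<tau>)"
        by (simp add: ab)
    qed
  next
    assume "((\<lambda>\<tau>. Lp_norm p (?a \<tau>)) \<longlongrightarrow> 0) (at_right 0)"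
    then have "((\<lambda>\<tau>. Lp_norm p (?a \<tau>) + Lp_norm p (?E \<tau>)) \<longlongrightarrow> 0) (at_right 0)"
      using tendsto_add[OF _ perturbation_tendsto[OF u]] by fastforce
    then show "((\<lambda>\<tau>. Lp_norm p (?b \<tau>)) \<longlongrightarrow> 0) (at_right 0)"
    proof (rule Lp_norm_tendsto_0_sandwich[rotated])
      fix \<tau> :: real assume "0 < \<tau>"
      then have "?a \<tau> \<in> Lp p" "?E \<tau> \<in> Lp p" using u w sh by (auto intro!: V_intros)
      from N_add[OF this] show "Lp_norm p (?b \<tau>) \<le> Lp_norm p (?a \<tau>) + Lp_norm p (?E \<tau>)"
        by (simp only: ab)
    qed
  qed
  ultimately show ?thesis unfolding rderiv_def by blast
qed

lemma generates_dshift: "generates p (dom_D0 p) (\<lambda>v. D0 v + Q v) dshift"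
proof (rule generatesI[OF C0_semigroup_dshift])
  show "dom_D0 p \<subseteq> Lp p" by (auto simp: dom_D0_def W1p_def)
  fix u w assume u: "u \<in> Lp p"
  show "rderiv dshift u w \<longleftrightarrow> u \<in> dom_D0 p \<and> w = - (D0 u + Q u)"
    using rderiv_dshift_iff[OF u, of "w + Q u"] shift_rderiv_iff[OF u, of "w + Q u"]
    by (auto simp: eq_neg_iff_add_eq_0 algebra_simps)
qed

lemma dom_D0_dense:
  assumes v: "v \<in> Lp p" and e: "0 < e"
  shows "\<exists>u\<in>dom_D0 p. Lp_norm p (u - v) < e"
proof -
  have "\<exists>u\<in>Lp p. rderiv shift u v" if v: "v \<in> Lp p" for v
  proof -
    have "- v \<in> Lp p" using v by simp
    from prim_properties(3)[OF this] cls_continuous_in_Lp(2)[OF prim_properties(1)[OF this]]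
    show ?thesis by auto
  qed
  from domain_dense[OF semigr_shift this v e] show ?thesis using shift_rderiv_iff by blast
qed

lemma exp_neg_dshift:
  assumes "0 \<le> \<tau>" "u \<in> Lp p"
  shows "exp_neg p (dom_D0 p) (\<lambda>v. D0 v + Q v) \<tau> u = dshift \<tau> u"
proof (rule exp_neg_eq[OF generates_dshift _ assms])
  fix v and e :: real assume "v \<in> Lp p" "0 < e"
  then obtain u where u: "u \<in> dom_D0 p" "Lp_norm p (u - v) < e" using dom_D0_dense by blast
  have "\<exists>w. rderiv dshift u w" "u \<in> Lp p"
    using generates_dshift u(1) unfolding generates_def right_deriv_at_0_eq by blast+
  with u show "\<exists>u\<in>Lp p. (\<exists>w. rderiv dshift u w) \<and> Lp_norm p (u - v) < e" by blast
qed

lemma exp_neg_shift: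
  assumes "0 \<le> \<tau>" "u \<in> Lp p"
  shows "exp_neg p (dom_D0 p) D0 \<tau> u = shift \<tau> u"
proof (rule exp_neg_eq[OF _ _ assms])
  show "generates p (dom_D0 p) D0 shift"
    by (rule generatesI[OF C0_semigroup_shift _ shift_rderiv_iff]) (auto simp: dom_D0_def W1p_def)
  fix v and e :: real assume "v \<in> Lp p" "0 < e"
  then obtain u where u: "u \<in> dom_D0 p" "Lp_norm p (u - v) < e" using dom_D0_dense by blast
  have "u \<in> Lp p" using u(1) by (auto simp: dom_D0_def W1p_def)
  then show "\<exists>u\<in>Lp p. (\<exists>w. rderiv shift u w) \<and> Lp_norm p (u - v) < e"
    using u shift_rderiv_iff by blast
qed

section \<open>The product as a shift weighted by a Riemann sum\<close>

definition riemann_weight :: "real \<Rightarrow> nat \<Rightarrow> real \<Rightarrow> complex"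
  where "riemann_weight h k t = complex_of_real (exp (- (h * (\<Sum>j<k. r (t - real (Suc j) * h)))))"

lemma riemann_weight_measurable [simp]: "meas (riemann_weight h k)"
  unfolding riemann_weight_def by (intro cls_continuous_in_Lp(1) continuous_intros r_cont')

text \<open>In each factor the multiplication acts before the shift, so after the shift its rate is
  read at \<open>t - h\<close>. This is why the samples start at \<open>t - h\<close> and are the
  left endpoints of the subintervals of \<open>[t - k * h, t]\<close>.\<close>

lemma riemann_weight_Suc:
  "riemann_weight h (Suc k) t = complex_of_real (exp (- (h * r (t - h)))) * riemann_weight h k (t - h)"
  by (simp add: riemann_weight_def sum.lessThan_Suc_shift algebra_simps exp_add[symmetric]
      flip: of_real_mult del: sum.lessThan_Suc)

lemma trotter_power:
  assumes h: "0 \<le> h" and u: "u \<in> Lp p"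
  shows "((\<lambda>v. exp_neg p (dom_D0 p) D0 h (exp_neg p (Lp p) Q h v)) ^^ k) u =
    wshift (riemann_weight h k) (real k * h) u"
proof (induction k)
  case 0
  have "riemann_weight h 0 = (\<lambda>_. 1)" by (simp add: fun_eq_iff riemann_weight_def)
  then show ?case by (simp add: wshift_0)
next
  case (Suc k)
  let ?m = "\<lambda>t. complex_of_real (exp (- (h * r t)))"
  let ?v = "wshift (riemann_weight h k) (real k * h) u"
  have v: "?v \<in> Lp p"
  proof (rule wshift_bounded(1)[OF _ _ _ _ u])
    show "norm (riemann_weight h k t) \<le> 1" for t
      using h by (simp add: riemann_weight_def sum_nonneg r_nonneg)
  qed (use h in auto)
  have m: "meas (\<lambda>t. 1 * zero_ext ?m (t - h))" by (rule wshift_measurable) simp_all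
  have "((\<lambda>v. exp_neg p (dom_D0 p) D0 h (exp_neg p (Lp p) Q h v)) ^^ Suc k) u = shift h (mult_semigr h ?v)"
    using Suc.IH h v by (simp add: exp_neg_shift exp_neg_Q)
  also have "\<dots> = wshift (\<lambda>t. 1 * zero_ext ?m (t - h)) (h + 0) ?v"
    unfolding mult_semigr_def by (rule wshift_wshift) (use h in auto)
  also have "\<dots> = wshift (\<lambda>t. 1 * zero_ext ?m (t - h) * zero_ext (riemann_weight h k) (t - h)) (h + real k * h) u"
    using h m wshift_wshift[of "\<lambda>t. 1 * zero_ext ?m (t - h)" "riemann_weight h k" h "real k * h" u] by simp
  also have "\<dots> = wshift (riemann_weight h (Suc k)) (h + real k * h) u"
  proof (rule wshift_cong)
    show "meas (\<lambda>t. 1 * zero_ext ?m (t - h) * zero_ext (riemann_weight h k) (t - h))"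
      using m by (intro wshift_measurable) simp_all
    fix t assume t: "h + real k * h \<le> t" "t \<le> 1"
    have "0 \<le> real k * h" using h by simp
    then have "0 \<le> t - h" "t - h \<le> 1" using t h by linarith+
    then show "1 * zero_ext ?m (t - h) * zero_ext (riemann_weight h k) (t - h) = riemann_weight h (Suc k) t"
      by (simp add: riemann_weight_Suc)
  qed
  finally show ?case by (simp add: distrib_right)
qed

text \<open>Telescope \<open>R\<close> over the \<open>n\<close> subintervals. On each of them the
  mean value theorem gives a value of \<open>r\<close> at a point within \<open>h\<close> of the
  sample point, so the error there is at most \<open>h * e\<close>.\<close>

lemma riemann_sum_approx:
  assumes h: "0 \<le> h" and osc: "\<And>x y. \<bar>x - y\<bar> \<le> h \<Longrightarrow> \<bar>r x - r y\<bar> \<le> e"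
  shows "\<bar>(R t - R (t - real n * h)) - h * (\<Sum>j<n. r (t - real (Suc j) * h))\<bar> \<le> real n * h * e"
proof -
  have step: "\<bar>(R (t - real j * h) - R (t - real (Suc j) * h)) - h * r (t - real (Suc j) * h)\<bar> \<le> h * e" for j
  proof (cases "h = 0")
    case False
    then have "0 < h" using h by simp
    from R_mvt[OF this, of "t - real j * h"] obtain z where
      z: "t - real j * h - h < z" "z < t - real j * h" "R (t - real j * h) - R (t - real j * h - h) = h * r z" .
    have eq: "t - real (Suc j) * h = t - real j * h - h" by (simp add: algebra_simps)
    have "\<bar>h * r z - h * r (t - real j * h - h)\<bar> = h * \<bar>r z - r (t - real j * h - h)\<bar>"
      using h by (simp add: abs_mult flip: right_diff_distrib)
    also have "\<dots> \<le> h * e" using h z by (intro mult_left_mono osc) auto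
    finally show ?thesis unfolding eq z(3) .
  qed simp
  have "R t - R (t - real n * h) = (\<Sum>j<n. R (t - real j * h) - R (t - real (Suc j) * h))"
    using sum_lessThan_telescope'[of "\<lambda>j. R (t - real j * h)" n] by simp
  then have "\<bar>(R t - R (t - real n * h)) - h * (\<Sum>j<n. r (t - real (Suc j) * h))\<bar> =
      \<bar>\<Sum>j<n. (R (t - real j * h) - R (t - real (Suc j) * h)) - h * r (t - real (Suc j) * h)\<bar>"
    by (simp add: sum_subtractf sum_distrib_left)
  also have "\<dots> \<le> (\<Sum>j<n. \<bar>(R (t - real j * h) - R (t - real (Suc j) * h)) - h * r (t - real (Suc j) * h)\<bar>)"
    by (rule sum_abs)
  also have "\<dots> \<le> (\<Sum>j<n. h * e)" by (intro sum_mono step)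
  finally show ?thesis by (simp add: mult.assoc)
qed

lemma trotter_error:
  assumes h: "0 \<le> h" and osc: "\<And>x y. \<bar>x - y\<bar> \<le> h \<Longrightarrow> \<bar>r x - r y\<bar> \<le> e" and "0 \<le> e" and u: "u \<in> Lp p"
  shows "Lp_norm p (dshift (real n * h) u - wshift (riemann_weight h n) (real n * h) u) \<le> real n * h * e * Lp_norm p u"
proof -
  have nh: "0 \<le> real n * h" using h by simp
  have "dshift (real n * h) u - wshift (riemann_weight h n) (real n * h) u =
      wshift (\<lambda>t. weight (real n * h) t - riemann_weight h n t) (real n * h) u"
    unfolding dshift_def by (rule wshift_weight_diff) auto
  also have "Lp_norm p \<dots> \<le> (real n * h * e) * Lp_norm p u"
  proof (rule wshift_bounded(2)[OF _ nh _ _ u])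
    show "meas (\<lambda>t. weight (real n * h) t - riemann_weight h n t)"
      by (rule borel_measurable_diff) auto
    show "0 \<le> real n * h * e" using nh \<open>0 \<le> e\<close> by simp
    fix t
    let ?x = "R t - R (t - real n * h)" and ?y = "h * (\<Sum>j<n. r (t - real (Suc j) * h))"
    have "weight (real n * h) t - riemann_weight h n t = complex_of_real (exp (- ?x) - exp (- ?y))"
      by (simp add: weight_def riemann_weight_def)
    then have "norm (weight (real n * h) t - riemann_weight h n t) = \<bar>exp (- ?x) - exp (- ?y)\<bar>"
      by (simp only: norm_of_real)
    also have "\<dots> \<le> \<bar>?x - ?y\<bar>"
    proof (rule exp_minus_lipschitz)
      show "0 \<le> ?x" using R_mono nh by (simp add: monoD)
      show "0 \<le> ?y" using h by (intro mult_nonneg_nonneg sum_nonneg r_nonneg)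
    qed
    also have "\<dots> \<le> real n * h * e" by (rule riemann_sum_approx[OF h osc])
    finally show "norm (weight (real n * h) t - riemann_weight h n t) \<le> real n * h * e" .
  qed
  finally show ?thesis .
qed

text \<open>A real supremum is controlled only for a nonempty set that is bounded above; the zero
  vector and \<open>C\<close> provide this. The lower bound turns the estimate into one on the
  absolute value.\<close>

lemma op_norm_le:
  assumes "0 \<le> C" "\<And>u. u \<in> Lp p \<Longrightarrow> Lp_norm p (T u) \<le> C * Lp_norm p u"
  shows "0 \<le> op_norm p T" "op_norm p T \<le> C"
proof -
  let ?A = "{Lp_norm p (T u) | u. u \<in> Lp p \<and> Lp_norm p u \<le> 1}"
  have le: "a \<le> C" if a: "a \<in> ?A" for a
  proof -
    obtain u where u: "a = Lp_norm p (T u)" "u \<in> Lp p" "Lp_norm p u \<le> 1" using a by blast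
    have "a \<le> C * Lp_norm p u" using assms(2) u by simp
    also have "\<dots> \<le> C * 1" using u assms(1) by (intro mult_left_mono)
    finally show ?thesis by simp
  qed
  have mem: "Lp_norm p (T 0) \<in> ?A" using N_0 zero_in_Lp by force
  then have ne: "?A \<noteq> {}" by blast
  show "op_norm p T \<le> C" unfolding op_norm_def using ne le by (rule cSup_least)
  have "Lp_norm p (T 0) \<le> op_norm p T"
    unfolding op_norm_def using mem le by (intro cSup_upper bdd_aboveI)
  then show "0 \<le> op_norm p T" using Lp_norm_nonneg order_trans by blast
qed

theorem trotter_convergence:
  assumes \<tau>: "0 \<le> \<tau>"
  shows "(\<lambda>n::nat. op_norm p (\<lambda>u. exp_neg p (dom_D0 p) (\<lambda>v. D0 v + Q v) \<tau> u
      - ((\<lambda>v. exp_neg p (dom_D0 p) D0 (\<tau> / real n) (exp_neg p (Lp p) Q (\<tau> / real n) v)) ^^ n) u))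
    \<longlonglongrightarrow> 0"
proof (rule LIMSEQ_I)
  fix e :: real assume e: "0 < e"
  \<comment> \<open>\<open>\<tau> + 1\<close> instead of \<open>\<tau>\<close> allows division also
    when \<open>\<tau> = 0\<close>, and still gives \<open>\<tau> * e1 < e\<close>.\<close>
  define k where "k = \<tau> + 1"
  have k: "k > 0" "\<tau> < k" using \<tau> by (simp_all add: k_def)
  define e1 where "e1 = e / k"
  have "e1 > 0" using e k by (simp add: e1_def)
  moreover from this have "\<tau> * e1 < k * e1" using k by (intro mult_strict_right_mono)
  ultimately have e1: "e1 > 0" "\<tau> * e1 < e" using k by (simp_all add: e1_def)
  obtain d where d: "d > 0" "\<And>x y. dist x y < d \<Longrightarrow> dist (r x) (r y) < e1"
    using r_uc e1(1) unfolding uniformly_continuous_on_def by (metis UNIV_I)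
  obtain n0 :: nat where n0: "\<tau> / d < real n0" using reals_Archimedean2 by blast
  show "\<exists>no. \<forall>n\<ge>no. norm (op_norm p (\<lambda>u. exp_neg p (dom_D0 p) (\<lambda>v. D0 v + Q v) \<tau> u
      - ((\<lambda>v. exp_neg p (dom_D0 p) D0 (\<tau> / real n) (exp_neg p (Lp p) Q (\<tau> / real n) v)) ^^ n) u) - 0) < e"
  \<comment> \<open>The 1 excludes \<open>n = 0\<close>, where the step
    \<open>\<tau> / real n\<close> is 0 by convention and the steps need not add up to
    \<open>\<tau>\<close>.\<close>
  proof (intro exI[of _ "max n0 1"] allI impI)
    fix n assume n: "max n0 1 \<le> n"
    define h where "h = \<tau> / real n"
    have nh: "real n * h = \<tau>" "0 \<le> h" using n \<tau> by (auto simp: h_def)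
    have "\<tau> / d < real n" using n n0 by linarith
    then have hd: "h < d" using d(1) n by (simp add: h_def field_simps)
    have osc: "\<bar>r x - r y\<bar> \<le> e1" if "\<bar>x - y\<bar> \<le> h" for x y
      using d(2)[of x y] that hd by (simp add: dist_real_def)
    let ?T = "\<lambda>u. exp_neg p (dom_D0 p) (\<lambda>v. D0 v + Q v) \<tau> u
      - ((\<lambda>v. exp_neg p (dom_D0 p) D0 h (exp_neg p (Lp p) Q h v)) ^^ n) u"
    have T: "Lp_norm p (?T u) \<le> (\<tau> * e1) * Lp_norm p u" if u: "u \<in> Lp p" for u
      using trotter_error[OF nh(2) osc less_imp_le[OF e1(1)] u, of n]
      by (simp add: exp_neg_dshift[OF \<tau> u] trotter_power[OF nh(2) u] nh(1))
    have "0 \<le> \<tau> * e1" using \<tau> e1 by simp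
    from op_norm_le[OF this T] e1(2)
    show "norm (op_norm p (\<lambda>u. exp_neg p (dom_D0 p) (\<lambda>v. D0 v + Q v) \<tau> u
      - ((\<lambda>v. exp_neg p (dom_D0 p) D0 (\<tau> / real n) (exp_neg p (Lp p) Q (\<tau> / real n) v)) ^^ n) u) - 0) < e"
      unfolding h_def by simp
  qed
qed

end

theorem theorem3p5:
  fixes p \<tau> :: real and q :: "real \<Rightarrow> complex"
  assumes "1 \<le> p"
    and "continuous_on {0..1} q"
    and "\<forall>t\<in>{0..1}. q t \<in> \<real>\<^sub>\<ge>\<^sub>0"
    and "0 \<le> \<tau>"
  shows "(\<lambda>n::nat. op_norm p (\<lambda>u.
      exp_neg p (dom_D0 p) (\<lambda>v. D0 v + mult_op q v) \<tau> u
      - ((\<lambda>v. exp_neg p (dom_D0 p) D0 (\<tau> / real n)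
               (exp_neg p (Lp p) (mult_op q) (\<tau> / real n) v)) ^^ n) u))
    \<in> o[sequentially](\<lambda>_. 1)"
proof -
  \<comment> \<open>The retraction of the line onto [0,1]. It is 1-Lipschitz, so \<open>r\<close>,
    the real part of \<open>q\<close> continued by its endpoint values, is uniformly continuous on
    the line and keeps the bounds of \<open>q\<close>.\<close>
  define c where "c t = max 0 (min 1 t)" for t :: real
  define r where "r t = Re (q (c t))" for t
  have c: "c t \<in> {0..1}" for t by (auto simp: c_def)
  have q: "q t = complex_of_real (r t)" "0 \<le> r t" if "t \<in> {0..1}" for t
  proof -
    have "c t = t" using that by (auto simp: c_def)
    moreover have "q t \<in> \<real>\<^sub>\<ge>\<^sub>0" using assms(3) that by blast
    ultimately show "q t = complex_of_real (r t)" "0 \<le> r t"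
      by (auto simp: r_def complex_nonneg_Reals_iff complex_eq_iff)
  qed
  have rc: "r (c t) = r t" for t by (auto simp: r_def c_def)
  have uc_q: "uniformly_continuous_on {0..1} q"
    using assms(2) by (intro compact_uniformly_continuous) auto
  have r_uc: "uniformly_continuous_on UNIV r"
    unfolding uniformly_continuous_on_def
  proof (intro allI impI)
    fix e :: real assume "e > 0"
    then obtain d where d: "d > 0" "\<And>x y. x \<in> {0..1} \<Longrightarrow> y \<in> {0..1} \<Longrightarrow> dist y x < d \<Longrightarrow> dist (q y) (q x) < e"
      using uc_q unfolding uniformly_continuous_on_def by metis
    have "dist (r y) (r x) < e" if "dist y x < d" for x y
    proof -
      have "dist (c y) (c x) \<le> dist y x" by (auto simp: c_def dist_real_def)
      then have "dist (q (c y)) (q (c x)) < e" using that c by (intro d(2)) auto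
      moreover have "dist (r y) (r x) \<le> dist (q (c y)) (q (c x))"
        using abs_Re_le_cmod[of "q (c y) - q (c x)"] by (simp add: r_def dist_real_def dist_norm)
      ultimately show ?thesis by simp
    qed
    with d(1) show "\<exists>d>0. \<forall>x\<in>UNIV. \<forall>y\<in>UNIV. dist y x < d \<longrightarrow> dist (r y) (r x) < e" by blast
  qed
  then have "continuous_on UNIV r" by (rule uniformly_continuous_imp_continuous)
  then obtain R where R: "\<And>t. (R has_vector_derivative r t) (at t)" using antiderivative_exists by blast
  obtain B where B: "\<And>t. 0 \<le> t \<Longrightarrow> t \<le> 1 \<Longrightarrow> norm (q t) \<le> B"
    using continuous_bounded_on_unit[OF assms(2)] by blast
  interpret damping_rate p R r B
  proof
    show "1 \<le> p" by fact
    show "(R has_real_derivative r t) (at t)" for t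
      using R by (simp add: has_real_derivative_iff_has_vector_derivative)
    show "uniformly_continuous_on UNIV r" by fact
    show "0 \<le> r t" for t using q(2)[OF c[of t]] by (simp add: rc)
    show "r t \<le> B" for t
      using B[of "c t"] c[of t] complex_Re_le_cmod[of "q (c t)"] by (simp add: r_def)
  qed
  \<comment> \<open>Equality of functions on all of \<open>l0\<close> lets \<open>Q\<close> replace
    \<open>mult_op q\<close> inside both occurrences of \<open>exp_neg\<close>; it holds because
    classes see only the values on [0,1].\<close>
  have "mult_op q = Q"
  proof
    fix u
    show "mult_op q u = Q u" unfolding Q_def mult_op_def
    proof (rule sym, rule cls_cong)
      show "meas (\<lambda>t. complex_of_real (r t) * rep u t)" by (rule borel_measurable_times) simp_all
    qed (use q(1) in simp)
  qed
  then show ?thesis using trotter_convergence[OF assms(4)] by (intro smalloI_tendsto) auto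
qed

end
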